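(* Let $\nu$ be a non-zero finite Borel measure on $(0,1)$. (1) If $\overline s_\nu=1/2$, then $\beta_\nu(q)=1-q$ for all $q\in[0,1]$. (2) If for some $q_0\in(0,1)$ the limit $\lim_{n\to\infty}\beta_n^\nu(q_0)$ exists and $\beta_\nu(q_0)=\lim_{n\to\infty}\beta_n^\nu(q_0)=1-q_0$, then $\beta_\nu(q)=1-q$ for all $q\in[0,1]$, and the spectral dimension exists with $s_\nu=1/2$ (i.e. $\underline s_\nu=\overline s_\nu=1/2$).
   Context: $\Lambda$ is Lebesgue measure. For $n\in\mathbb N$ and $0\le k<2^n$ let $A^n_k:=(k2^{-n},(k+1)2^{-n}]$ and $\mathcal D_{\nu,n}:=\{A^n_k:\nu(A^n_k)>0\}$. For $q\in\mathbb R$ put $\beta^\nu_n(q):=\frac{1}{\log 2^n}\log\sum_{C\in\mathcal D_{\nu,n}}\nu(C)^q$ and $\beta_\nu(q):=\limsup_{n\to\infty}\beta_n^\nu(q)$. Spectral dimension. $\nu$ is regarded as a measure on $[0,1]$. $H^1_0(0,1)$ is the space of functions $f:[0,1]\to\mathbb R$ with $f(x)=\int_{[0,x]}g\,d\Lambda$ for some $g\in L^2_\Lambda([0,1])$ and $f(0)=f(1)=0$; $\nabla_\Lambda f:=g$. $C_\nu([0,1])$ is the set of continuous real functions on $[0,1]$ that are affine linear on every connected component of $[0,1]\setminus\operatorname{supp}\nu$. $\operatorname{dom}(\mathcal E_\nu):=H^1_0(0,1)\cap C_\nu([0,1])$, $\mathcal E_\nu(f,g):=\int_{(0,1)}\nabla_\Lambda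 f\,\nabla_\Lambda g\,d\Lambda$. A number $\lambda$ is an eigenvalue of $\mathcal E_\nu$ if there is $f\in\operatorname{dom}(\mathcal E_\nu)\setminus\{0\}$ with $\mathcal E_\nu(f,g)=\lambda\int fg\,d\nu$ for all $g\in\operatorname{dom}(\mathcal E_\nu)$. $N_\nu(x)$ is the number of eigenvalues $\le x$ (with multiplicity). $\underline{s}_\nu:=\liminf_{x\to\infty}\frac{\log N_\nu(x)}{\log x}$, $\overline{s}_\nu:=\limsup_{x\to\infty}\frac{\log N_\nu(x)}{\log x}$; if they coincide the common value is $s_\nu$. *)

theory Defs
  imports "HOL-Analysis.Analysis" "HOL-Library.Function_Algebras"
begin

text \<open>
  A Borel measure on \<open>(0,1)\<close> is represented by a Borel measure \<open>\<nu>\<close> on the real line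
  for which the complement of \<open>(0,1)\<close> is a null set.
\<close>

definition dyadic_interval :: "nat \<Rightarrow> nat \<Rightarrow> real set" where
  "dyadic_interval n k = {real k / 2 ^ n <.. (real k + 1) / 2 ^ n}"

definition dyadic_cells :: "real measure \<Rightarrow> nat \<Rightarrow> real set set" where
  "dyadic_cells \<nu> n = {dyadic_interval n k | k. k < 2 ^ n \<and> measure \<nu> (dyadic_interval n k) > 0}"

definition Lq_spectrum_level :: "real measure \<Rightarrow> nat \<Rightarrow> real \<Rightarrow> real" where
  "Lq_spectrum_level \<nu> n q =
     1 / ln (2 ^ n) * ln (\<Sum>C\<in>dyadic_cells \<nu> n. measure \<nu> C powr q)"

definition Lq_spectrum :: "real measure \<Rightarrow> real \<Rightarrow> ereal" where
  "Lq_spectrum \<nu> q = limsup (\<lambda>n. ereal (Lq_spectrum_level \<nu> n q))"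

definition measure_supp :: "real measure \<Rightarrow> real set" where
  "measure_supp \<nu> = {x. \<forall>U. open U \<and> x \<in> U \<longrightarrow> emeasure \<nu> U > 0}"

definition L2_unit :: "(real \<Rightarrow> real) set" where
  "L2_unit = {g. set_borel_measurable lborel {0..1} g \<and> set_integrable lborel {0..1} (\<lambda>x. (g x)\<^sup>2)}"

definition is_weak_gradient :: "(real \<Rightarrow> real) \<Rightarrow> (real \<Rightarrow> real) \<Rightarrow> bool" where
  "is_weak_gradient f g \<longleftrightarrow> g \<in> L2_unit \<and> (\<forall>x\<in>{0..1}. f x = (LINT t:{0..x}|lborel. g t))"

text \<open>
  Functions on \<open>[0,1]\<close> are represented by their extension by zero to the real line, so that
  distinct representatives are distinct functions on \<open>[0,1]\<close> and the spaces below are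
  real vector spaces under the pointwise operations.
\<close>

definition H10 :: "(real \<Rightarrow> real) set" where
  "H10 = {f. (\<exists>g. is_weak_gradient f g) \<and> f 0 = 0 \<and> f 1 = 0 \<and> (\<forall>x. x \<notin> {0..1} \<longrightarrow> f x = 0)}"

text \<open>
  The gradient is determined only up to Lebesgue-null subsets of \<open>[0,1]\<close>, so it may be used only
  under integrals against Lebesgue measure.
\<close>

definition weak_gradient :: "(real \<Rightarrow> real) \<Rightarrow> real \<Rightarrow> real" where
  "weak_gradient f = (SOME g. is_weak_gradient f g)"

definition C_affine :: "real measure \<Rightarrow> (real \<Rightarrow> real) set" where
  "C_affine \<nu> = {f. continuous_on {0..1} f \<and>
     (\<forall>I\<in>components ({0..1} - measure_supp \<nu>). \<exists>a b. \<forall>x\<in>I. f x = a * x + b)}"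

definition form_dom :: "real measure \<Rightarrow> (real \<Rightarrow> real) set" where
  "form_dom \<nu> = H10 \<inter> C_affine \<nu>"

text \<open>The measure enters the form \<open>\<E>\<^sub>\<nu>\<close> only through its domain.\<close>

definition energy :: "(real \<Rightarrow> real) \<Rightarrow> (real \<Rightarrow> real) \<Rightarrow> real" where
  "energy f g = (LINT x:{0<..<1}|lborel. weak_gradient f x * weak_gradient g x)"

definition eigenspace :: "real measure \<Rightarrow> real \<Rightarrow> (real \<Rightarrow> real) set" where
  "eigenspace \<nu> l =
     {f \<in> form_dom \<nu>. \<forall>g\<in>form_dom \<nu>. energy f g = l * (LINT x|\<nu>. f x * g x)}"

definition is_eigenvalue :: "real measure \<Rightarrow> real \<Rightarrow> bool" where
  "is_eigenvalue \<nu> l \<longleftrightarrow> (\<exists>f\<in>eigenspace \<nu> l. f \<noteq> (\<lambda>x. 0))"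

definition fun_scale :: "real \<Rightarrow> (real \<Rightarrow> real) \<Rightarrow> real \<Rightarrow> real" where
  "fun_scale c f = (\<lambda>x. c * f x)"

global_interpretation real_fun: vector_space fun_scale
  by unfold_locales (auto simp: fun_scale_def fun_eq_iff algebra_simps)

definition multiplicity :: "real measure \<Rightarrow> real \<Rightarrow> nat" where
  "multiplicity \<nu> l = real_fun.dim (eigenspace \<nu> l)"

text \<open>
  For a finite measure the form has compact resolvent: there are finitely many eigenvalues below any
  bound, each of finite multiplicity, so neither the sum nor the dimension takes its default value.
\<close>

definition eigenvalue_count :: "real measure \<Rightarrow> real \<Rightarrow> nat" where
  "eigenvalue_count \<nu> x = (\<Sum>l | is_eigenvalue \<nu> l \<and> l \<le> x. multiplicity \<nu> l)"

definition lower_spectral_dim :: "real measure \<Rightarrow> ereal" where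
  "lower_spectral_dim \<nu> = Liminf at_top (\<lambda>x::real. ereal (ln (real (eigenvalue_count \<nu> x)) / ln x))"

definition upper_spectral_dim :: "real measure \<Rightarrow> ereal" where
  "upper_spectral_dim \<nu> = Limsup at_top (\<lambda>x::real. ereal (ln (real (eigenvalue_count \<nu> x)) / ln x))"

end

theory Submission
  imports Defs "HOL-Complex_Analysis.Great_Picard" "HOL-Real_Asymp.Real_Asymp"
begin

text \<open>
  The Green operator \<open>T u x = \<integral> (min x y - x y) u y d\<nu>\<close> inverts the form, so the eigenfunctions for
  \<open>\<lambda>\<close> are the solutions of \<open>f = \<lambda> T f\<close>. As \<open>T\<close> is positive, symmetric for the inner product of
  \<open>L\<^sup>2 \<nu>\<close> and maps bounded sets to equi-Lipschitz ones, eigenvalues can be counted by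
  the usual variational comparison.

  If an \<open>H\<^sup>1\<close> function vanishes at the midpoints of all dyadic cells \<open>C\<close> with \<open>\<nu> C \<bar>C\<bar> > t\<close>, then
  \<open>\<integral> f\<^sup>2 d\<nu> \<le> t \<E> f f\<close>, whence \<open>N (1/2t)\<close> is at most the number of these cells. By Markov's inequality
  level \<open>n\<close> contains at most \<open>t powr -q\<close> times a constant of them as soon as \<open>\<beta> n q \<le> q + O (1/n)\<close>. This
  always holds for \<open>q = 1/2\<close>, and for some \<open>q < 1/2\<close> if \<open>\<beta> (1/2) < 1/2\<close>. Conversely, \<open>\<beta> n q \<longlongrightarrow> 1 - q\<close>
  forces about \<open>2 ^ n\<close> cells of mass about \<open>2 ^ -n\<close>, and disjointly supported tents over them bound \<open>N\<close>
  from below. The remaining exponents \<open>q\<close> are reached by convexity, since \<open>\<beta> 0 \<le> 1\<close> and \<open>\<beta> 1 = 0\<close>.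
\<close>

subsection \<open>Linear algebra and integration\<close>

text \<open>Elements of \<open>form_dom\<close> are affine on the gaps of the support, whereas tents
  are not. The identity \<open>integral_green_grad_gradient\<close> holds for every H^1 function
  with zero boundary values, so Cauchy-Schwarz in the Dirichlet integral compares tents directly
  with T; this takes the place of a projection onto \<open>form_dom\<close>. Every eigenfunction is
  a multiple of a value of T, hence continuous and controlled pointwise by its L^2 norm, so honest
  bounded functions can replace equivalence classes throughout. A second obstacle is that
  \<open>sum\<close> and \<open>dim\<close>, from which \<open>eigenvalue_count\<close> is built,
  collapse to 0 in infinite situations. Finiteness must be proved before anything is counted, and
  even the lower bound on the count starts from the vanishing conditions that give the upper
  bound.\<close>

lemma homogeneous_system_nontrivial:
  fixes A :: "'p \<Rightarrow> 'i \<Rightarrow> real"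
  assumes "finite P" "finite S" "card P < card S"
  shows "\<exists>c. (\<exists>i\<in>S. c i \<noteq> 0) \<and> (\<forall>p\<in>P. (\<Sum>i\<in>S. c i * A p i) = 0)"
  using assms
proof (induction P arbitrary: S A rule: finite_induct)
  case empty
  then have "S \<noteq> {}" by auto
  then show ?case by (intro exI[of _ "\<lambda>_. 1"]) auto
next
  case (insert p P)
  show ?case
  proof (cases "\<forall>i\<in>S. A p i = 0")
    case True
    have "card P < card S" using insert by simp
    from insert.IH[OF insert.prems(1) this, of A] obtain c where
      c: "\<exists>i\<in>S. c i \<noteq> 0" "\<forall>q\<in>P. (\<Sum>i\<in>S. c i * A q i) = 0" by blast
    have "(\<Sum>i\<in>S. c i * A p i) = 0" using True by (simp add: sum.neutral)
    with c show ?thesis by blast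
  next
    case False
    then obtain k where k: "k \<in> S" "A p k \<noteq> 0" by blast
    let ?S = "S - {k}"
    let ?A = "\<lambda>q i. A q i - A q k * A p i / A p k"
    have "card P < card ?S" using insert k by simp
    from insert.IH[OF _ this, of ?A] insert.prems obtain c where
      c: "\<exists>i\<in>?S. c i \<noteq> 0" "\<And>q. q \<in> P \<Longrightarrow> (\<Sum>i\<in>?S. c i * ?A q i) = 0" by auto
    \<comment> \<open>Gaussian elimination: the pivot unknown \<open>k\<close> has been removed from
      the other equations, and its value is now recovered from equation \<open>p\<close>.\<close>
    define d where "d = (\<lambda>i. if i = k then - (\<Sum>i\<in>?S. c i * A p i) / A p k else c i)"
    have d: "(\<Sum>i\<in>S. d i * A q i) = (\<Sum>i\<in>?S. c i * ?A q i)" for q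
    proof -
      have "(\<Sum>i\<in>S. d i * A q i) = d k * A q k + (\<Sum>i\<in>?S. d i * A q i)"
        using insert.prems k by (simp add: sum.remove)
      also have "(\<Sum>i\<in>?S. d i * A q i) = (\<Sum>i\<in>?S. c i * A q i)"
        by (intro sum.cong) (auto simp: d_def)
      also have "d k * A q k = - (\<Sum>i\<in>?S. c i * (A q k * A p i / A p k))"
        by (simp add: d_def sum_distrib_left sum_divide_distrib sum_distrib_right algebra_simps)
      finally show ?thesis by (simp add: algebra_simps sum_subtractf)
    qed
    have "(\<Sum>i\<in>?S. c i * ?A p i) = 0" using k by simp
    with c d have "\<forall>q\<in>insert p P. (\<Sum>i\<in>S. d i * A q i) = 0" by auto
    moreover have "\<exists>i\<in>S. d i \<noteq> 0" using c(1) by (auto simp: d_def)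
    ultimately show ?thesis by blast
  qed
qed

lemma discriminant_le:
  fixes a b c :: real
  assumes "\<And>t. a + 2 * b * t + c * t\<^sup>2 \<ge> 0"
  shows "b\<^sup>2 \<le> a * c"
proof (cases "c = 0")
  case True
  have "b = 0"
  proof (rule ccontr)
    assume "b \<noteq> 0"
    with assms[of "- (a + 1) / (2 * b)"] True show False by (simp add: field_simps)
  qed
  then show ?thesis using True by simp
next
  case False
  have "c > 0"
  proof (rule ccontr)
    assume "\<not> c > 0"
    with False have c: "c < 0" by simp
    \<comment> \<open>This t is at least 1 and makes \<open>c * t\<close> so negative that it
      outweighs both other coefficients.\<close>
    define t where "t = (\<bar>a\<bar> + 1 + 2 * \<bar>b\<bar>) / (- c) + 1"
    have t1: "t \<ge> 1" using c by (simp add: t_def divide_nonneg_neg)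
    have ct: "c * t = - (\<bar>a\<bar> + 1 + 2 * \<bar>b\<bar>) + c" using c by (simp add: t_def field_simps)
    have "a + 2 * b * t + c * t\<^sup>2 = a + t * (2 * b + c * t)" by (simp add: power2_eq_square algebra_simps)
    also have "\<dots> \<le> a + t * (- \<bar>a\<bar> - 1)" using t1 ct c by (intro add_left_mono mult_left_mono) auto
    also have "\<dots> \<le> a + 1 * (- \<bar>a\<bar> - 1)" using t1 by (intro add_left_mono mult_right_mono_neg) auto
    also have "\<dots> < 0" by simp
    finally show False using assms[of t] by simp
  qed
  have "a + 2 * b * (- b / c) + c * (- b / c)\<^sup>2 = a - b\<^sup>2 / c"
    using \<open>c > 0\<close> by (simp add: power2_eq_square)
  then have "b\<^sup>2 / c \<le> a" using assms[of "- b / c"] by simp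
  then show ?thesis using \<open>c > 0\<close> by (simp add: pos_divide_le_eq)
qed

text \<open>The integral of the square of f + t g is a nonnegative quadratic polynomial in t; its
  discriminant gives Cauchy-Schwarz.\<close>

lemma integral_mult_squared_le:
  fixes f g :: "'a \<Rightarrow> real"
  assumes "integrable M (\<lambda>x. (f x)\<^sup>2)" "integrable M (\<lambda>x. (g x)\<^sup>2)" "integrable M (\<lambda>x. f x * g x)"
  shows "(LINT x|M. f x * g x)\<^sup>2 \<le> (LINT x|M. (f x)\<^sup>2) * (LINT x|M. (g x)\<^sup>2)"
proof (rule discriminant_le)
  fix t
  have "0 \<le> (LINT x|M. (f x + t * g x)\<^sup>2)" by simp
  also have "\<dots> = (LINT x|M. (f x)\<^sup>2 + ((2 * t) * (f x * g x) + t\<^sup>2 * (g x)\<^sup>2))"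
    by (intro Bochner_Integration.integral_cong) (auto simp: power2_eq_square algebra_simps)
  also have "\<dots> = (LINT x|M. (f x)\<^sup>2) + ((2 * t) * (LINT x|M. f x * g x) + t\<^sup>2 * (LINT x|M. (g x)\<^sup>2))"
    using assms by (subst Bochner_Integration.integral_add; simp)+
  finally show "0 \<le> (LINT x|M. (f x)\<^sup>2) + 2 * (LINT x|M. f x * g x) * t + (LINT x|M. (g x)\<^sup>2) * t\<^sup>2"
    by (simp add: algebra_simps)
qed

lemma integrable_mult_of_squares:
  fixes f g :: "'a \<Rightarrow> real"
  assumes [measurable]: "f \<in> borel_measurable M" "g \<in> borel_measurable M"
    and "integrable M (\<lambda>x. (f x)\<^sup>2)" "integrable M (\<lambda>x. (g x)\<^sup>2)"
  shows "integrable M (\<lambda>x. f x * g x)"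
proof (rule Bochner_Integration.integrable_bound)
  show "integrable M (\<lambda>x. (f x)\<^sup>2 + (g x)\<^sup>2)" using assms by simp
  show "AE x in M. norm (f x * g x) \<le> norm ((f x)\<^sup>2 + (g x)\<^sup>2)"
  proof (rule AE_I2)
    fix x
    have "2 * \<bar>f x * g x\<bar> \<le> (f x)\<^sup>2 + (g x)\<^sup>2"
      using sum_squares_bound[of "\<bar>f x\<bar>" "\<bar>g x\<bar>"] by (simp add: abs_mult)
    then show "norm (f x * g x) \<le> norm ((f x)\<^sup>2 + (g x)\<^sup>2)" by simp
  qed
qed simp

text \<open>Dynkin's argument: half-lines form an intersection-stable generator, so vanishing
  integrals over them spread to all Borel sets. Since g is zero off [0,1], half-lines reduce to the
  intervals [0,x]. This is the source of the uniqueness of gradients.\<close>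

lemma integral_zero_on_initial_intervals_AE:
  fixes g :: "real \<Rightarrow> real"
  assumes g: "integrable lborel g" and out: "\<And>x. x \<notin> {0..1} \<Longrightarrow> g x = 0"
    and z: "\<And>x. x \<in> {0..1} \<Longrightarrow> (LINT t:{0..x}|lborel. g t) = 0"
  shows "AE x in lborel. g x = 0"
proof (rule sigma_finite_measure.density_zero[OF sigma_finite_lborel g])
  have [measurable]: "g \<in> borel_measurable borel" using g by auto
  have int: "set_integrable lborel A g" if "A \<in> sets borel" for A
    using that g unfolding set_integrable_def by (intro integrable_mult_indicator) auto
  have lower: "(LINT t:{..x}|lborel. g t) = 0" for x
  proof (cases "x \<in> {0..1}")
    case True
    then have "(LINT t:{..x}|lborel. g t) = (LINT t:{0..x}|lborel. g t)"
      unfolding set_lebesgue_integral_def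
      by (intro Bochner_Integration.integral_cong) (auto simp: out indicator_def)
    then show ?thesis using z[OF True] by simp
  next
    case False
    show ?thesis
    proof (cases "x < 0")
      case True
      then have "(LINT t:{..x}|lborel. g t) = (LINT t::real|lborel. (0::real))"
        unfolding set_lebesgue_integral_def
        by (intro Bochner_Integration.integral_cong) (auto simp: out indicator_def)
      then show ?thesis by simp
    next
      case x: False
      then have "(LINT t:{..x}|lborel. g t) = (LINT t:{0..1}|lborel. g t)"
        using False unfolding set_lebesgue_integral_def
        by (intro Bochner_Integration.integral_cong) (auto simp: out indicator_def)
      then show ?thesis using z[of 1] by simp
    qed
  qed
  have whole: "(LINT t:UNIV|lborel. g t) = 0"
  proof -
    have "(LINT t:UNIV|lborel. g t) = (LINT t:{..1}|lborel. g t)"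
      unfolding set_lebesgue_integral_def
      by (intro Bochner_Integration.integral_cong) (auto simp: out indicator_def)
    then show ?thesis using lower by simp
  qed
  fix A :: "real set" assume "A \<in> sets lborel"
  then have "A \<in> sigma_sets UNIV (range (\<lambda>a. {..a::real}))"
    by (simp add: borel_eq_atMost)
  moreover have "Int_stable (range (\<lambda>a. {..a::real}))"
    by (auto simp: Int_stable_def)
  ultimately have "Int_stable (range (\<lambda>a. {..a::real}))" "range (\<lambda>a. {..a::real}) \<subseteq> Pow UNIV"
    "A \<in> sigma_sets UNIV (range (\<lambda>a. {..a::real}))" by auto
  then show "(LINT t:A|lborel. g t) = 0"
  proof (induction rule: sigma_sets_induct_disjoint)
    case (basic A)
    then show ?case using lower by auto
  next
    case empty
    then show ?case by (simp add: set_lebesgue_integral_def)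
  next
    case (compl A)
    have A: "A \<in> sets borel" using compl by (simp add: borel_eq_atMost)
    have "(LINT t:A \<union> (UNIV - A)|lborel. g t) = (LINT t:A|lborel. g t) + (LINT t:UNIV - A|lborel. g t)"
      using A by (intro set_integral_Un int) auto
    then show ?case using whole compl by simp
  next
    case (union F)
    have F: "F i \<in> sets borel" for i using union by (auto simp: borel_eq_atMost)
    have "(LINT t:(\<Union>i. F i)|lborel. g t) = (\<Sum>i. (LINT t:F i|lborel. g t))"
      using F union(1) by (intro lebesgue_integral_countable_add int)
        (auto simp: disjoint_family_on_def)
    then show ?case using union by simp
  qed
qed

text \<open>Hoelder's inequality with exponents 1/(1-t) and 1/t: Young's inequality is applied
  termwise after both sums have been scaled to 1. It yields the log-convexity of the partition sums
  and, with one factor constant, the lower bound on the number of large cells.\<close>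

lemma sum_mult_powr_le:
  fixes a b :: "'i \<Rightarrow> real"
  assumes "finite S" and a: "\<And>i. i \<in> S \<Longrightarrow> a i > 0" and b: "\<And>i. i \<in> S \<Longrightarrow> b i > 0"
    and t: "0 \<le> t" "t \<le> 1"
  shows "(\<Sum>i\<in>S. a i powr (1 - t) * b i powr t) \<le> (\<Sum>i\<in>S. a i) powr (1 - t) * (\<Sum>i\<in>S. b i) powr t"
proof (cases "S = {}")
  case False
  define A B where "A = (\<Sum>i\<in>S. a i)" and "B = (\<Sum>i\<in>S. b i)"
  have A: "A > 0" and B: "B > 0"
    unfolding A_def B_def using assms False by (auto intro!: sum_pos)
  have "(a i / A) powr (1 - t) * (b i / B) powr t \<le> (1 - t) * (a i / A) + t * (b i / B)" if "i \<in> S" for i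
    using Youngs_inequality_0[of "1 - t" t "a i / A" "b i / B"] t a[OF that] b[OF that] A B by simp
  then have "(\<Sum>i\<in>S. (a i / A) powr (1 - t) * (b i / B) powr t)
      \<le> (\<Sum>i\<in>S. (1 - t) * (a i / A) + t * (b i / B))" by (rule sum_mono)
  also have "\<dots> = (1 - t) * ((\<Sum>i\<in>S. a i) / A) + t * ((\<Sum>i\<in>S. b i) / B)"
    by (simp only: sum.distrib sum_distrib_left[symmetric] sum_divide_distrib[symmetric])
  also have "\<dots> = 1" using A B unfolding A_def[symmetric] B_def[symmetric] by simp
  finally have le1: "(\<Sum>i\<in>S. (a i / A) powr (1 - t) * (b i / B) powr t) \<le> 1" .
  have "(\<Sum>i\<in>S. (a i / A) powr (1 - t) * (b i / B) powr t)
      = (\<Sum>i\<in>S. (a i powr (1 - t) * b i powr t) / (A powr (1 - t) * B powr t))"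
    using a b A B by (intro sum.cong refl) (simp add: powr_divide less_imp_le)
  also have "\<dots> = (\<Sum>i\<in>S. a i powr (1 - t) * b i powr t) / (A powr (1 - t) * B powr t)"
    by (simp only: sum_divide_distrib)
  finally have "(\<Sum>i\<in>S. a i powr (1 - t) * b i powr t) / (A powr (1 - t) * B powr t) \<le> 1"
    using le1 by simp
  then show ?thesis using A B unfolding A_def[symmetric] B_def[symmetric] by (simp add: pos_divide_le_eq)
qed simp

subsection \<open>The Green operator\<close>

lemma fun_scale_apply [simp]: "fun_scale c f x = c * f x"
  by (simp add: fun_scale_def)

lemma sum_fun_scale_apply:
  fixes e :: "'i \<Rightarrow> real \<Rightarrow> real"
  shows "(\<Sum>i\<in>S. fun_scale (c i) (e i)) x = (\<Sum>i\<in>S. c i * e i x)"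
  by (induction S rule: infinite_finite_induct) auto

text \<open>Stands in for L^2(\<nu>). The members are integrable against every finite Borel measure,
  form an algebra, include all eigenfunctions and are genuine functions, so T acts without a choice
  of representatives.\<close>

definition bdd_borel :: "(real \<Rightarrow> real) set" where
  "bdd_borel = {u \<in> borel_measurable borel. \<exists>B. \<forall>x. \<bar>u x\<bar> \<le> B}"

lemma bdd_borelI:
  assumes "u \<in> borel_measurable borel" "\<And>x. \<bar>u x\<bar> \<le> B"
  shows "u \<in> bdd_borel"
  using assms by (auto simp: bdd_borel_def)

lemma bdd_borelD [measurable_dest]: "u \<in> bdd_borel \<Longrightarrow> u \<in> borel_measurable borel"
  by (simp add: bdd_borel_def)

lemma bdd_borelE:
  assumes "u \<in> bdd_borel"
  obtains B where "B > 0" "\<And>x. \<bar>u x\<bar> \<le> B"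
proof -
  from assms obtain B where B: "\<And>x. \<bar>u x\<bar> \<le> B" by (auto simp: bdd_borel_def)
  have "\<bar>u x\<bar> \<le> \<bar>B\<bar> + 1" for x using B[of x] by linarith
  then show ?thesis by (intro that[of "\<bar>B\<bar> + 1"]) auto
qed

lemma bdd_borel_zero: "(\<lambda>x. 0) \<in> bdd_borel"
  by (auto simp: bdd_borel_def)

lemma bdd_borel_add: "u \<in> bdd_borel \<Longrightarrow> v \<in> bdd_borel \<Longrightarrow> (\<lambda>x. u x + v x) \<in> bdd_borel"
proof -
  assume u: "u \<in> bdd_borel" and v: "v \<in> bdd_borel"
  obtain B where B: "\<And>x. \<bar>u x\<bar> \<le> B" using bdd_borelE[OF u] by blast
  obtain C where C: "\<And>x. \<bar>v x\<bar> \<le> C" using bdd_borelE[OF v] by blast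
  show ?thesis
    using u v by (intro bdd_borelI[of _ "B + C"] borel_measurable_add)
      (auto dest: bdd_borelD intro: order_trans[OF abs_triangle_ineq] add_mono B C)
qed

lemma bdd_borel_mult: "u \<in> bdd_borel \<Longrightarrow> v \<in> bdd_borel \<Longrightarrow> (\<lambda>x. u x * v x) \<in> bdd_borel"
proof -
  assume u: "u \<in> bdd_borel" and v: "v \<in> bdd_borel"
  obtain B where B: "\<And>x. \<bar>u x\<bar> \<le> B" "B > 0" using bdd_borelE[OF u] by blast
  obtain C where C: "\<And>x. \<bar>v x\<bar> \<le> C" "C > 0" using bdd_borelE[OF v] by blast
  show ?thesis
    using u v B C by (intro bdd_borelI[of _ "B * C"] borel_measurable_times)
      (auto dest: bdd_borelD simp: abs_mult intro!: mult_mono)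
qed

lemma bdd_borel_abs: "u \<in> bdd_borel \<Longrightarrow> (\<lambda>x. \<bar>u x\<bar>) \<in> bdd_borel"
  by (auto simp: bdd_borel_def)

lemma bdd_borel_scale: "u \<in> bdd_borel \<Longrightarrow> (\<lambda>x. c * u x) \<in> bdd_borel"
  by (rule bdd_borel_mult) (auto simp: bdd_borel_def)

lemma bdd_borel_diff: "u \<in> bdd_borel \<Longrightarrow> v \<in> bdd_borel \<Longrightarrow> (\<lambda>x. u x - v x) \<in> bdd_borel"
  using bdd_borel_add[of u "\<lambda>x. (-1) * v x"] bdd_borel_scale[of v "-1"] by simp

lemma bdd_borel_sum:
  "(\<And>i. i \<in> S \<Longrightarrow> u i \<in> bdd_borel) \<Longrightarrow> (\<lambda>x. \<Sum>i\<in>S. c i * u i x) \<in> bdd_borel"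
  by (induction S rule: infinite_finite_induct)
    (auto intro!: bdd_borel_zero bdd_borel_add bdd_borel_scale)

lemma bdd_borel_indicator: "A \<in> sets borel \<Longrightarrow> indicator A \<in> bdd_borel"
  by (rule bdd_borelI[of _ 1]) (auto simp: indicator_def)

lemma bdd_borel_of_continuous_on:
  fixes f :: "real \<Rightarrow> real"
  assumes "continuous_on {0..1} f" "\<And>x. x \<notin> {0..1} \<Longrightarrow> f x = 0"
  shows "f \<in> bdd_borel"
proof -
  have f: "f = (\<lambda>x. indicator {0..1} x *\<^sub>R f x)" using assms by (auto simp: indicator_def fun_eq_iff)
  have "f \<in> borel_measurable borel"
    by (subst f) (rule borel_measurable_continuous_on_indicator[OF _ assms(1)], simp)
  moreover have "bounded (f ` {0..1})"
    using assms(1) by (intro compact_imp_bounded compact_continuous_image) auto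
  then obtain B where B: "\<And>x. x \<in> {0..1} \<Longrightarrow> \<bar>f x\<bar> \<le> B" by (metis bounded_iff imageI real_norm_def)
  have "\<bar>f x\<bar> \<le> \<bar>B\<bar>" for x
    using B[of x] assms(2)[of x] by (cases "x \<in> {0..1}") auto
  ultimately show ?thesis by (intro bdd_borelI)
qed

text \<open>Green's function of -f'' on (0,1) with Dirichlet conditions. The indicator removes the
  points y that \<nu> does not charge, so that the bounds hold for every y.\<close>

definition green :: "real \<Rightarrow> real \<Rightarrow> real" where
  "green x y = indicator {0<..<1} y * (min x y - x * y)"

text \<open>The slope of \<open>\<lambda>x. green x y\<close> at t, namely 1 - y to the left of y
  and -y to the right. At t = y the value is a convention, invisible to Lebesgue integrals in
  t.\<close>

definition green_deriv :: "real \<Rightarrow> real \<Rightarrow> real" where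
  "green_deriv t y = indicator {0<..<1} y * (indicator {t<..} y - y)"

lemma green_deriv_measurable [measurable]:
  "case_prod green_deriv \<in> borel_measurable (borel \<Otimes>\<^sub>M borel)"
proof -
  have "case_prod green_deriv = (\<lambda>p. indicator {0<..<1} (snd p) * ((if fst p < snd p then 1 else 0) - snd p))"
    by (auto simp: green_deriv_def fun_eq_iff indicator_def)
  then show ?thesis by simp
qed

lemma green_measurable [measurable]: "green x \<in> borel_measurable borel"
  unfolding green_def by measurable

lemma green_deriv_measurable1 [measurable]: "green_deriv t \<in> borel_measurable borel"
  unfolding green_deriv_def by measurable

lemma abs_green_deriv_le: "\<bar>green_deriv t y\<bar> \<le> 1"
  by (auto simp: green_deriv_def indicator_def)

lemma abs_green_le: "x \<in> {0..1} \<Longrightarrow> \<bar>green x y\<bar> \<le> 1"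
proof -
  assume x: "x \<in> {0..1}"
  show ?thesis
  proof (cases "y \<in> {0<..<1}")
    case True
    have "0 \<le> x * y" "x * y \<le> 1" "x * y \<le> min x y"
      using x True by (auto intro: mult_nonneg_nonneg mult_le_one mult_left_le mult_right_le_one_le mult_left_le_one_le)
    then show ?thesis using x True by (auto simp: green_def)
  qed (simp add: green_def)
qed

text \<open>Both \<open>min x y - min z y\<close> and \<open>(x - z) * y\<close> lie between 0 and x
  - z, so their difference is at most the distance of x and z.\<close>

lemma green_lipschitz:
  assumes "x \<in> {0..1}" "z \<in> {0..1}"
  shows "\<bar>green x y - green z y\<bar> \<le> \<bar>x - z\<bar>"
proof (cases "y \<in> {0<..<1}")
  case True
  define d where "d = min x y - min z y"
  have d: "d = 0 \<and> True \<or> 0 \<le> d \<and> d \<le> x - z \<or> x - z \<le> d \<and> d \<le> 0"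
    by (auto simp: d_def min_def)
  have e: "green x y - green z y = d - (x - z) * y"
    using True by (simp add: green_def d_def algebra_simps)
  have "\<bar>(x - z) * y\<bar> \<le> \<bar>x - z\<bar>" using True by (simp add: abs_mult mult_left_le)
  moreover have "x \<ge> z \<Longrightarrow> 0 \<le> (x - z) * y" "x \<le> z \<Longrightarrow> (x - z) * y \<le> 0"
    using True by (auto intro: mult_nonneg_nonneg mult_nonpos_nonneg)
  ultimately show ?thesis unfolding e using d by (cases "x \<ge> z") auto
qed (simp add: green_def)

section \<open>The Green operator of the measure and its bounds\<close>

locale string_measure = finite_measure \<nu> for \<nu> :: "real measure" +
  assumes sets_eq [simp, measurable_cong]: "sets \<nu> = sets borel"
    and null_outside: "emeasure \<nu> (- {0<..<1}) = 0"
begin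

abbreviation mass :: real where "mass \<equiv> measure \<nu> UNIV"

lemma space_eq [simp]: "space \<nu> = UNIV"
  using sets_eq_imp_space_eq[OF sets_eq] by simp

lemma AE_inside: "AE y in \<nu>. y \<in> {0<..<1}"
  by (rule AE_I[of _ _ "- {0<..<1}"]) (auto simp: null_outside)

lemma integrable_bdd_borel: "u \<in> bdd_borel \<Longrightarrow> integrable \<nu> u"
proof -
  assume u: "u \<in> bdd_borel"
  then have [measurable]: "u \<in> borel_measurable borel" by (rule bdd_borelD)
  obtain B where "\<And>x. \<bar>u x\<bar> \<le> B" using bdd_borelE[OF u] by blast
  then show ?thesis by (intro integrable_const_bound[of _ B]) auto
qed

text \<open>Semidefinite only: functions are not identified \<nu>-almost everywhere, so norm zero
  does not by itself mean pointwise zero.\<close>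

definition ip :: "(real \<Rightarrow> real) \<Rightarrow> (real \<Rightarrow> real) \<Rightarrow> real" where
  "ip u v = (LINT y|\<nu>. u y * v y)"

definition green_op :: "(real \<Rightarrow> real) \<Rightarrow> real \<Rightarrow> real" where
  "green_op u x = indicator {0..1} x * (LINT y|\<nu>. green x y * u y)"

text \<open>Differentiation under the integral sign. The cutoff to [0,1] is added where this serves
  as a gradient.\<close>

definition green_grad :: "(real \<Rightarrow> real) \<Rightarrow> real \<Rightarrow> real" where
  "green_grad u t = (LINT y|\<nu>. green_deriv t y * u y)"

lemma ip_commute: "ip u v = ip v u"
  by (simp add: ip_def mult.commute)

lemma ip_self_nonneg: "0 \<le> ip u u"
  by (simp add: ip_def)

lemma ip_sum_left:
  assumes "\<And>i. i \<in> S \<Longrightarrow> u i \<in> bdd_borel" "v \<in> bdd_borel"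
  shows "ip (\<lambda>x. \<Sum>i\<in>S. c i * u i x) v = (\<Sum>i\<in>S. c i * ip (u i) v)"
proof -
  have "ip (\<lambda>x. \<Sum>i\<in>S. c i * u i x) v = (LINT y|\<nu>. (\<Sum>i\<in>S. c i * (u i y * v y)))"
    by (simp add: ip_def sum_distrib_right mult.assoc)
  also have "\<dots> = (\<Sum>i\<in>S. (LINT y|\<nu>. c i * (u i y * v y)))"
    using assms by (intro Bochner_Integration.integral_sum integrable_bdd_borel bdd_borel_scale bdd_borel_mult)
  finally show ?thesis by (simp add: ip_def)
qed

lemma ip_sum_right:
  assumes "\<And>i. i \<in> S \<Longrightarrow> u i \<in> bdd_borel" "v \<in> bdd_borel"
  shows "ip v (\<lambda>x. \<Sum>i\<in>S. c i * u i x) = (\<Sum>i\<in>S. c i * ip v (u i))"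
  using ip_sum_left[OF assms, where c = c] by (simp add: ip_commute)

lemma ip_add_left:
  "u \<in> bdd_borel \<Longrightarrow> w \<in> bdd_borel \<Longrightarrow> v \<in> bdd_borel \<Longrightarrow> ip (\<lambda>x. u x + w x) v = ip u v + ip w v"
  unfolding ip_def distrib_right
  by (intro Bochner_Integration.integral_add integrable_bdd_borel bdd_borel_mult)

lemma ip_scale_left: "ip (\<lambda>x. c * u x) v = c * ip u v"
  by (simp add: ip_def mult.assoc)

lemma ip_scale_right: "ip v (\<lambda>x. c * u x) = c * ip v u"
  by (simp add: ip_def algebra_simps)

lemma ip_diff_left:
  "u \<in> bdd_borel \<Longrightarrow> w \<in> bdd_borel \<Longrightarrow> v \<in> bdd_borel \<Longrightarrow> ip (\<lambda>x. u x - w x) v = ip u v - ip w v"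
  using ip_add_left[of u "\<lambda>x. (-1) * w x" v] bdd_borel_scale[of w "-1"] ip_scale_left[of "-1" w v] by simp

lemma ip_Cauchy_Schwarz:
  "u \<in> bdd_borel \<Longrightarrow> v \<in> bdd_borel \<Longrightarrow> (ip u v)\<^sup>2 \<le> ip u u * ip v v"
  using integral_mult_squared_le[of \<nu> u v]
  by (simp add: ip_def power2_eq_square integrable_bdd_borel bdd_borel_mult)

text \<open>Cauchy-Schwarz against the constant 1. Through it the pointwise bounds on
  \<open>green_op u\<close> depend on u only via \<open>ip u u\<close>, as compactness of a
  maximising sequence demands.\<close>

lemma integral_abs_le:
  assumes u: "u \<in> bdd_borel"
  shows "(LINT y|\<nu>. \<bar>u y\<bar>) \<le> sqrt mass * sqrt (ip u u)"
proof -
  have a: "(\<lambda>y. \<bar>u y\<bar>) \<in> bdd_borel" by (rule bdd_borel_abs[OF u])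
  have "(ip (\<lambda>y. \<bar>u y\<bar>) (\<lambda>_. 1))\<^sup>2 \<le> ip (\<lambda>y. \<bar>u y\<bar>) (\<lambda>y. \<bar>u y\<bar>) * ip (\<lambda>_. 1) (\<lambda>_. 1)"
    by (intro ip_Cauchy_Schwarz a) (auto simp: bdd_borel_def)
  then have "(LINT y|\<nu>. \<bar>u y\<bar>)\<^sup>2 \<le> ip u u * mass" by (simp add: ip_def abs_mult_self)
  then have "\<bar>LINT y|\<nu>. \<bar>u y\<bar>\<bar> \<le> sqrt (ip u u * mass)" using real_sqrt_le_mono by fastforce
  then show ?thesis by (simp add: real_sqrt_mult mult.commute)
qed

lemma green_bdd_borel: "x \<in> {0..1} \<Longrightarrow> green x \<in> bdd_borel"
  by (rule bdd_borelI[of _ 1]) (auto simp: abs_green_le)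

lemma green_deriv_bdd_borel: "green_deriv t \<in> bdd_borel"
  by (rule bdd_borelI[of _ 1]) (auto simp: abs_green_deriv_le)

lemma green_grad_bdd_borel:
  assumes u: "u \<in> bdd_borel" shows "green_grad u \<in> bdd_borel"
proof (rule bdd_borelI)
  have [measurable]: "u \<in> borel_measurable borel" by (rule bdd_borelD[OF u])
  show "green_grad u \<in> borel_measurable borel" unfolding green_grad_def by measurable
  fix t
  have "\<bar>green_grad u t\<bar> \<le> (LINT y|\<nu>. \<bar>green_deriv t y * u y\<bar>)"
    unfolding green_grad_def by (rule integral_abs_bound)
  also have "\<dots> \<le> (LINT y|\<nu>. \<bar>u y\<bar>)"
  proof (rule integral_mono)
    show "integrable \<nu> (\<lambda>y. \<bar>green_deriv t y * u y\<bar>)" "integrable \<nu> (\<lambda>y. \<bar>u y\<bar>)"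
      using u by (auto intro!: integrable_bdd_borel bdd_borel_abs bdd_borel_mult green_deriv_bdd_borel)
    show "\<bar>green_deriv t y * u y\<bar> \<le> \<bar>u y\<bar>" for y
      using mult_right_mono[OF abs_green_deriv_le[of t y] abs_ge_zero[of "u y"]] by (simp add: abs_mult)
  qed
  finally show "\<bar>green_grad u t\<bar> \<le> (LINT y|\<nu>. \<bar>u y\<bar>)" .
qed

lemma green_op_diff_le:
  assumes u: "u \<in> bdd_borel" and x: "x \<in> {0..1}" "z \<in> {0..1}"
  shows "\<bar>green_op u x - green_op u z\<bar> \<le> \<bar>x - z\<bar> * (sqrt mass * sqrt (ip u u))"
proof -
  have i: "integrable \<nu> (\<lambda>y. green w y * u y)" if "w \<in> {0..1}" for w
    using that u by (intro integrable_bdd_borel bdd_borel_mult green_bdd_borel)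
  have "green_op u x - green_op u z = (LINT y|\<nu>. green x y * u y - green z y * u y)"
    using x i by (simp add: green_op_def)
  also have "\<bar>\<dots>\<bar> \<le> (LINT y|\<nu>. \<bar>green x y * u y - green z y * u y\<bar>)"
    by (rule integral_abs_bound)
  also have "\<dots> \<le> (LINT y|\<nu>. \<bar>x - z\<bar> * \<bar>u y\<bar>)"
  proof (rule integral_mono)
    show "integrable \<nu> (\<lambda>y. \<bar>green x y * u y - green z y * u y\<bar>)" "integrable \<nu> (\<lambda>y. \<bar>x - z\<bar> * \<bar>u y\<bar>)"
      using u i x by (auto intro!: integrable_bdd_borel bdd_borel_abs)
    show "\<bar>green x y * u y - green z y * u y\<bar> \<le> \<bar>x - z\<bar> * \<bar>u y\<bar>" for y
      using mult_right_mono[OF green_lipschitz[OF x, of y] abs_ge_zero[of "u y"]]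
      by (simp add: abs_mult[symmetric] left_diff_distrib)
  qed
  also have "\<dots> \<le> \<bar>x - z\<bar> * (sqrt mass * sqrt (ip u u))"
    using integral_abs_le[OF u] by (simp add: mult_left_mono)
  finally show ?thesis .
qed

lemma green_op_0 [simp]: "green_op u 0 = 0"
proof -
  have "green 0 y = 0" for y by (auto simp: green_def indicator_def)
  then show ?thesis by (simp add: green_op_def)
qed

lemma green_op_1 [simp]: "green_op u 1 = 0"
proof -
  have "green 1 y = 0" for y by (auto simp: green_def indicator_def)
  then show ?thesis by (simp add: green_op_def)
qed

lemma green_op_outside: "x \<notin> {0..1} \<Longrightarrow> green_op u x = 0"
  by (simp add: green_op_def)

lemma abs_green_op_le:
  assumes u: "u \<in> bdd_borel"
  shows "\<bar>green_op u x\<bar> \<le> sqrt mass * sqrt (ip u u)"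
proof (cases "x \<in> {0..1}")
  case True
  have "\<bar>green_op u x\<bar> \<le> \<bar>x\<bar> * (sqrt mass * sqrt (ip u u))"
    using green_op_diff_le[OF u True, of 0] by simp
  also have "\<dots> \<le> 1 * (sqrt mass * sqrt (ip u u))"
    using True by (intro mult_right_mono) (auto simp: ip_self_nonneg)
  finally show ?thesis by simp
qed (simp add: green_op_def ip_self_nonneg)

lemma green_op_continuous_on:
  assumes u: "u \<in> bdd_borel" shows "continuous_on {0..1} (green_op u)"
proof (rule continuous_onI)
  fix x e :: real assume x: "x \<in> {0..1}" "0 < e"
  define C where "C = sqrt mass * sqrt (ip u u) + 1"
  have C: "C > 0" by (simp add: C_def ip_self_nonneg add_nonneg_pos)
  have "dist (green_op u z) (green_op u x) \<le> e" if "z \<in> {0..1}" "dist z x < e / C" for z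
  proof -
    have "\<bar>green_op u z - green_op u x\<bar> \<le> \<bar>z - x\<bar> * (sqrt mass * sqrt (ip u u))" by (rule green_op_diff_le[OF u that(1) x(1)])
    also have "\<dots> \<le> \<bar>z - x\<bar> * C" by (intro mult_left_mono) (auto simp: C_def)
    also have "\<dots> \<le> e" using that C by (simp add: dist_real_def field_simps)
    finally show ?thesis by (simp add: dist_real_def)
  qed
  with C x show "\<exists>d>0. \<forall>x'\<in>{0..1}. dist x' x < d \<longrightarrow> dist (green_op u x') (green_op u x) \<le> e"
    by (intro exI[of _ "e / C"]) auto
qed

lemma green_op_bdd_borel: "u \<in> bdd_borel \<Longrightarrow> green_op u \<in> bdd_borel"
  by (rule bdd_borel_of_continuous_on[OF green_op_continuous_on green_op_outside])

lemma green_op_sum: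
  assumes "\<And>i. i \<in> S \<Longrightarrow> u i \<in> bdd_borel"
  shows "green_op (\<lambda>x. \<Sum>i\<in>S. c i * u i x) = (\<lambda>x. \<Sum>i\<in>S. c i * green_op (u i) x)"
proof
  fix x
  show "green_op (\<lambda>x. \<Sum>i\<in>S. c i * u i x) x = (\<Sum>i\<in>S. c i * green_op (u i) x)"
  proof (cases "x \<in> {0..1}")
    case True
    have "ip (green x) (\<lambda>x. \<Sum>i\<in>S. c i * u i x) = (\<Sum>i\<in>S. c i * ip (green x) (u i))"
      using assms True by (intro ip_sum_right green_bdd_borel)
    then show ?thesis using True by (simp add: green_op_def ip_def)
  qed (simp add: green_op_outside)
qed

lemma green_op_scale: "green_op (\<lambda>x. c * u x) = (\<lambda>x. c * green_op u x)"
  by (simp add: green_op_def fun_eq_iff algebra_simps)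

lemma green_op_diff:
  assumes "u \<in> bdd_borel" "v \<in> bdd_borel"
  shows "green_op (\<lambda>x. u x - v x) = (\<lambda>x. green_op u x - green_op v x)"
proof
  fix x show "green_op (\<lambda>x. u x - v x) x = green_op u x - green_op v x"
  proof (cases "x \<in> {0..1}")
    case True
    have "integrable \<nu> (\<lambda>y. green x y * u y)" "integrable \<nu> (\<lambda>y. green x y * v y)"
      using assms True by (auto intro!: integrable_bdd_borel bdd_borel_mult green_bdd_borel)
    then show ?thesis using True by (simp add: green_op_def right_diff_distrib)
  qed (simp add: green_op_outside)
qed

text \<open>Fubini, with the majorant \<open>\<bar>g t\<bar> * B\<close>, integrable on the product
  because \<nu> is finite.\<close>

lemma integral_mult_green_grad:
  assumes u: "u \<in> bdd_borel" and g: "integrable lborel g"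
  shows "(LINT t|lborel. g t * green_grad u t) = (LINT y|\<nu>. u y * (LINT t|lborel. g t * green_deriv t y))"
proof -
  interpret P: pair_sigma_finite lborel \<nu> ..
  have [measurable]: "u \<in> borel_measurable borel" "g \<in> borel_measurable borel"
    using bdd_borelD[OF u] g by auto
  obtain B where B: "B > 0" "\<And>x. \<bar>u x\<bar> \<le> B" using bdd_borelE[OF u] by blast
  let ?F = "\<lambda>t y. g t * (green_deriv t y * u y)"
  have "integrable (lborel \<Otimes>\<^sub>M \<nu>) (case_prod ?F)"
  proof (rule Bochner_Integration.integrable_bound)
    show "integrable (lborel \<Otimes>\<^sub>M \<nu>) (\<lambda>p. g (fst p) * B)"
    proof (rule P.Fubini_integrable)
      show "integrable lborel (\<lambda>x. LINT y|\<nu>. norm (g (fst (x, y)) * B))"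
        using g by (simp add: abs_mult)
    qed (auto)
    show "AE p in lborel \<Otimes>\<^sub>M \<nu>. norm (case_prod ?F p) \<le> norm (g (fst p) * B)"
    proof (rule AE_I2)
      fix p :: "real \<times> real"
      have "\<bar>green_deriv (fst p) (snd p)\<bar> * \<bar>u (snd p)\<bar> \<le> 1 * B"
        by (intro mult_mono abs_green_deriv_le B) auto
      then have "\<bar>g (fst p)\<bar> * (\<bar>green_deriv (fst p) (snd p)\<bar> * \<bar>u (snd p)\<bar>) \<le> \<bar>g (fst p)\<bar> * B"
        by (intro mult_left_mono) auto
      then show "norm (case_prod ?F p) \<le> norm (g (fst p) * B)"
        using B by (simp add: case_prod_beta abs_mult)
    qed
  qed measurable
  then have "(LINT y|\<nu>. LINT t|lborel. ?F t y) = (LINT t|lborel. LINT y|\<nu>. ?F t y)"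
    by (rule P.Fubini_integral)
  also have "\<dots> = (LINT t|lborel. g t * green_grad u t)"
    by (simp add: green_grad_def)
  also have "(LINT y|\<nu>. LINT t|lborel. ?F t y) = (LINT y|\<nu>. u y * (LINT t|lborel. g t * green_deriv t y))"
    by (simp flip: integral_mult_right_zero add: algebra_simps)
  finally show ?thesis ..
qed

end

subsection \<open>Gradients and eigenspaces\<close>

text \<open>A normalised weak gradient: Borel on the whole line and zero off [0,1], so that set
  integrals become plain integrals and gradients combine pointwise.\<close>

definition is_gradient :: "(real \<Rightarrow> real) \<Rightarrow> (real \<Rightarrow> real) \<Rightarrow> bool" where
  "is_gradient f g \<longleftrightarrow> g \<in> borel_measurable borel \<and> integrable lborel (\<lambda>t. (g t)\<^sup>2) \<and>
     (\<forall>t. t \<notin> {0..1} \<longrightarrow> g t = 0) \<and> (\<forall>x\<in>{0..1}. f x = (LINT t:{0..x}|lborel. g t))"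

lemma integrable_of_square:
  fixes g :: "real \<Rightarrow> real"
  assumes [measurable]: "g \<in> borel_measurable borel"
    and g: "integrable lborel (\<lambda>t. (g t)\<^sup>2)" "\<And>t. t \<notin> {0..1} \<Longrightarrow> g t = 0"
  shows "integrable lborel g"
proof -
  have "integrable lborel (\<lambda>t. indicator {0..1} t * g t)"
  proof (rule integrable_mult_of_squares)
    have "(\<lambda>t. (indicat_real {0..1::real} t)\<^sup>2) = indicator {0..1}" by (auto simp: indicator_def fun_eq_iff)
    then show "integrable lborel (\<lambda>t. (indicat_real {0..1::real} t)\<^sup>2)" by simp
  qed (use g in auto)
  moreover have "(\<lambda>t. indicator {0..1} t * g t) = g" using g by (auto simp: fun_eq_iff indicator_def)
  ultimately show ?thesis by simp
qed

lemma is_gradientD: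
  assumes "is_gradient f g"
  shows "g \<in> borel_measurable borel" "integrable lborel g" "integrable lborel (\<lambda>t. (g t)\<^sup>2)"
    "\<And>t. t \<notin> {0..1} \<Longrightarrow> g t = 0" "\<And>x. x \<in> {0..1} \<Longrightarrow> f x = (LINT t:{0..x}|lborel. g t)"
proof -
  have g: "g \<in> borel_measurable borel" "integrable lborel (\<lambda>t. (g t)\<^sup>2)" "\<And>t. t \<notin> {0..1} \<Longrightarrow> g t = 0"
    "\<And>x. x \<in> {0..1} \<Longrightarrow> f x = (LINT t:{0..x}|lborel. g t)"
    using assms unfolding is_gradient_def by blast+
  then show "g \<in> borel_measurable borel" "integrable lborel (\<lambda>t. (g t)\<^sup>2)" "\<And>t. t \<notin> {0..1} \<Longrightarrow> g t = 0"
    "\<And>x. x \<in> {0..1} \<Longrightarrow> f x = (LINT t:{0..x}|lborel. g t)" by blast+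
  show "integrable lborel g" by (rule integrable_of_square[OF g(1-3)])
qed

lemma set_integrable_of_integrable:
  fixes g :: "real \<Rightarrow> real"
  shows "integrable lborel g \<Longrightarrow> A \<in> sets borel \<Longrightarrow> set_integrable lborel A g"
  unfolding set_integrable_def by (intro integrable_mult_indicator) auto

lemma is_gradient_unique:
  assumes f: "is_gradient f g" "is_gradient f h"
  shows "AE t in lborel. g t = h t"
proof -
  have "AE t in lborel. g t - h t = 0"
  proof (rule integral_zero_on_initial_intervals_AE)
    show "integrable lborel (\<lambda>t. g t - h t)"
      using is_gradientD(2)[OF f(1)] is_gradientD(2)[OF f(2)] by simp
    show "g t - h t = 0" if "t \<notin> {0..1}" for t
      using is_gradientD(4)[OF f(1) that] is_gradientD(4)[OF f(2) that] by simp
    fix x :: real assume x: "x \<in> {0..1}"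
    have "(LINT t:{0..x}|lborel. g t - h t) = (LINT t:{0..x}|lborel. g t) - (LINT t:{0..x}|lborel. h t)"
      using is_gradientD(2)[OF f(1)] is_gradientD(2)[OF f(2)]
      by (intro set_integral_diff set_integrable_of_integrable) auto
    also have "\<dots> = f x - f x"
      unfolding is_gradientD(5)[OF f(1) x, symmetric] is_gradientD(5)[OF f(2) x, symmetric] ..
    finally show "(LINT t:{0..x}|lborel. g t - h t) = 0" by simp
  qed
  then show ?thesis by simp
qed

lemma is_gradient_imp_weak: "is_gradient f g \<Longrightarrow> is_weak_gradient f g"
  unfolding is_gradient_def is_weak_gradient_def L2_unit_def set_borel_measurable_def set_integrable_def
  by (auto intro!: integrable_mult_indicator[where 'b = real, simplified])

lemma is_weak_gradient_imp:
  assumes "is_weak_gradient f g"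
  shows "is_gradient f (\<lambda>t. indicator {0..1} t * g t)"
proof -
  let ?g = "\<lambda>t. indicator {0..1} t * g t"
  have "?g \<in> borel_measurable borel"
    using assms by (simp add: is_weak_gradient_def L2_unit_def set_borel_measurable_def)
  moreover have "(\<lambda>t. (?g t)\<^sup>2) = (\<lambda>t. indicator {0..1} t *\<^sub>R (g t)\<^sup>2)"
    by (auto simp: fun_eq_iff indicator_def)
  then have "integrable lborel (\<lambda>t. (?g t)\<^sup>2)"
    using assms by (simp add: is_weak_gradient_def L2_unit_def set_integrable_def)
  moreover have "(LINT t:{0..x}|lborel. ?g t) = (LINT t:{0..x}|lborel. g t)" if "x \<in> {0..1}" for x
    using that unfolding set_lebesgue_integral_def
    by (intro Bochner_Integration.integral_cong) (auto simp: indicator_def)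
  then have "\<forall>x\<in>{0..1}. f x = (LINT t:{0..x}|lborel. ?g t)"
    using assms by (simp add: is_weak_gradient_def)
  ultimately show ?thesis by (auto simp: is_gradient_def)
qed

text \<open>The value at 0 is recovered as an integral over the null set \<open>{0}\<close>.\<close>

lemma H10_iff:
  "f \<in> H10 \<longleftrightarrow> (\<exists>g. is_gradient f g) \<and> f 1 = 0 \<and> (\<forall>x. x \<notin> {0..1} \<longrightarrow> f x = 0)"
proof -
  have "f 0 = 0" if "is_gradient f g" for g
  proof -
    have "f 0 = (LINT t:{0}|lborel. g t)" using is_gradientD(5)[OF that, of 0] by simp
    also have "\<dots> = (LINT t::real|lborel. 0)"
      unfolding set_lebesgue_integral_def
    proof (rule integral_cong_AE)
      show "AE t in lborel. indicator {0} t *\<^sub>R g t = 0"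
        using AE_lborel_singleton[of "0::real"] by eventually_elim simp
    qed (use is_gradientD(1)[OF that] in auto)
    finally show ?thesis by simp
  qed
  then show ?thesis
    unfolding H10_def using is_gradient_imp_weak is_weak_gradient_imp by blast
qed

text \<open>\<open>weak_gradient\<close> picks an unknown representative; by uniqueness it agrees
  almost everywhere with any known gradient. The endpoints are excluded because
  \<open>energy\<close> integrates over the open interval.\<close>

lemma energy_eq:
  assumes f: "is_gradient f g" and h: "is_gradient h k"
  shows "energy f h = (LINT t|lborel. g t * k t)"
proof -
  have wf: "is_gradient f (\<lambda>t. indicator {0..1} t * weak_gradient f t)"
    unfolding weak_gradient_def
    by (intro is_weak_gradient_imp someI[of "is_weak_gradient f"]) (rule is_gradient_imp_weak[OF f])
  have wh: "is_gradient h (\<lambda>t. indicator {0..1} t * weak_gradient h t)"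
    unfolding weak_gradient_def
    by (intro is_weak_gradient_imp someI[of "is_weak_gradient h"]) (rule is_gradient_imp_weak[OF h])
  note [measurable] = is_gradientD(1)[OF f] is_gradientD(1)[OF h] is_gradientD(1)[OF wf] is_gradientD(1)[OF wh]
  have "energy f h = (LINT t|lborel. indicator {0<..<1} t *
      ((indicator {0..1} t * weak_gradient f t) * (indicator {0..1} t * weak_gradient h t)))"
    unfolding energy_def set_lebesgue_integral_def
    by (intro Bochner_Integration.integral_cong) (auto simp: indicator_def)
  also have "\<dots> = (LINT t|lborel. g t * k t)"
  proof (rule integral_cong_AE)
    show "AE t in lborel. indicator {0<..<1} t *
      ((indicator {0..1} t * weak_gradient f t) * (indicator {0..1} t * weak_gradient h t)) = g t * k t"
      using is_gradient_unique[OF wf f] is_gradient_unique[OF wh h]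
        AE_lborel_singleton[of 0] AE_lborel_singleton[of 1]
    proof eventually_elim
      case (elim t)
      then show ?case
        using is_gradientD(4)[OF f, of t] by (cases "t \<in> {0..1}") (auto simp: indicator_def)
    qed
  qed measurable
  finally show ?thesis .
qed

lemma is_gradient_diff:
  assumes f: "is_gradient f g" and h: "is_gradient h k"
  shows "is_gradient (\<lambda>x. f x - h x) (\<lambda>t. g t - k t)"
  unfolding is_gradient_def
proof (intro conjI allI ballI impI)
  note [measurable] = is_gradientD(1)[OF f] is_gradientD(1)[OF h]
  show "(\<lambda>t. g t - k t) \<in> borel_measurable borel" by simp
  have "integrable lborel (\<lambda>t. g t * k t)"
    by (rule integrable_mult_of_squares) (use is_gradientD(3)[OF f] is_gradientD(3)[OF h] in auto)
  then have "integrable lborel (\<lambda>t. (g t)\<^sup>2 + (k t)\<^sup>2 - 2 * (g t * k t))"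
    using is_gradientD(3)[OF f] is_gradientD(3)[OF h] by simp
  then show "integrable lborel (\<lambda>t. (g t - k t)\<^sup>2)"
    by (simp add: power2_diff mult.assoc)
  show "g t - k t = 0" if "t \<notin> {0..1}" for t
    using is_gradientD(4)[OF f that] is_gradientD(4)[OF h that] by simp
  fix x :: real assume x: "x \<in> {0..1}"
  have "(LINT t:{0..x}|lborel. g t - k t) = (LINT t:{0..x}|lborel. g t) - (LINT t:{0..x}|lborel. k t)"
    using is_gradientD(2)[OF f] is_gradientD(2)[OF h]
    by (intro set_integral_diff set_integrable_of_integrable) auto
  then show "f x - h x = (LINT t:{0..x}|lborel. g t - k t)"
    using is_gradientD(5)[OF f x] is_gradientD(5)[OF h x] by simp
qed

lemma is_gradient_zeroD:
  assumes f: "is_gradient f g" and z: "(LINT t|lborel. (g t)\<^sup>2) = 0" and x: "x \<in> {0..1}"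
  shows "f x = 0"
proof -
  note [measurable] = is_gradientD(1)[OF f]
  have "AE t in lborel. (g t)\<^sup>2 = 0"
    using z is_gradientD(3)[OF f] by (subst (asm) integral_nonneg_eq_0_iff_AE) auto
  then have "(LINT t:{0..x}|lborel. g t) = (LINT t::real|lborel. 0)"
    unfolding set_lebesgue_integral_def by (intro integral_cong_AE) auto
  then show ?thesis using is_gradientD(5)[OF f x] by simp
qed

text \<open>The reproducing property: if g is the gradient of h and \<open>h 1 = 0\<close>, the
  right-hand side is \<open>h y\<close> for y in (0,1).\<close>

lemma integral_green_deriv:
  fixes g :: "real \<Rightarrow> real"
  assumes g: "integrable lborel g" "\<And>t. t \<notin> {0..1} \<Longrightarrow> g t = 0"
  shows "(LINT t|lborel. g t * green_deriv t y) =
    indicator {0<..<1} y * ((LINT t:{0..y}|lborel. g t) - y * (LINT t:{0..1}|lborel. g t))"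
proof (cases "y \<in> {0<..<1}")
  case True
  have [measurable]: "g \<in> borel_measurable borel" using g by auto
  have i: "set_integrable lborel {0..y} g" "set_integrable lborel {0..1} g"
    using g by (auto intro: set_integrable_of_integrable)
  have "(LINT t|lborel. g t * green_deriv t y) =
      (LINT t|lborel. indicator {0..y} t *\<^sub>R g t - y * (indicator {0..1} t *\<^sub>R g t))"
  proof (rule integral_cong_AE)
    show "AE t in lborel. g t * green_deriv t y = indicator {0..y} t *\<^sub>R g t - y * (indicator {0..1} t *\<^sub>R g t)"
      using AE_lborel_singleton[of y]
    proof eventually_elim
      case (elim t)
      then show ?case using True g(2)[of t]
        by (cases "t \<in> {0..1}") (auto simp: green_deriv_def indicator_def algebra_simps)
    qed
  qed measurable
  also have "\<dots> = (LINT t:{0..y}|lborel. g t) - y * (LINT t:{0..1}|lborel. g t)"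
    using i unfolding set_integrable_def set_lebesgue_integral_def by simp
  finally show ?thesis using True by simp
qed (simp add: green_deriv_def)

text \<open>This is \<open>integral_green_deriv\<close> for the indicator of [0,x], whose primitive
  at z is \<open>min x z\<close>.\<close>

lemma integral_interval_green_deriv:
  assumes x: "x \<in> {0..1}"
  shows "(LINT t|lborel. indicator {0..x} t * green_deriv t y) = green x y"
proof (cases "y \<in> {0<..<1}")
  case True
  have *: "(LINT t:{0..z}|lborel. indicat_real {0..x} t) = min x z" if "z \<ge> 0" for z
  proof -
    have "(LINT t:{0..z}|lborel. indicat_real {0..x} t) = (LINT t|lborel. indicat_real {0..min x z} t)"
      unfolding set_lebesgue_integral_def
      by (intro Bochner_Integration.integral_cong) (auto simp: indicator_def)
    then show ?thesis using x that by simp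
  qed
  have "(LINT t|lborel. indicator {0..x} t * green_deriv t y) =
    indicator {0<..<1} y * ((LINT t:{0..y}|lborel. indicat_real {0..x} t) - y * (LINT t:{0..1}|lborel. indicat_real {0..x} t))"
    using x by (intro integral_green_deriv) auto
  then show ?thesis using True x by (simp add: * green_def mult.commute)
qed (simp add: green_def green_deriv_def)

section \<open>Weak solutions, gaps of the support, and eigenfunctions\<close>

context string_measure
begin

lemma green_op_is_gradient:
  assumes u: "u \<in> bdd_borel"
  shows "is_gradient (green_op u) (\<lambda>t. indicator {0..1} t * green_grad u t)"
  unfolding is_gradient_def
proof (intro conjI allI ballI impI)
  have b: "(\<lambda>t. indicator {0..1} t * green_grad u t) \<in> bdd_borel"
    by (intro bdd_borel_mult bdd_borel_indicator green_grad_bdd_borel u) auto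
  then show [measurable]: "(\<lambda>t. indicator {0..1} t * green_grad u t) \<in> borel_measurable borel" by (rule bdd_borelD)
  obtain B where B: "\<And>t. \<bar>indicator {0..1} t * green_grad u t\<bar> \<le> B" "B > 0" using bdd_borelE[OF b] by blast
  show "integrable lborel (\<lambda>t. (indicator {0..1} t * green_grad u t)\<^sup>2)"
  proof (rule Bochner_Integration.integrable_bound)
    show "integrable lborel (\<lambda>t::real. indicator {0..1} t * B\<^sup>2)" by simp
    show "AE t in lborel. norm ((indicator {0..1} t * green_grad u t)\<^sup>2) \<le> norm (indicator {0..1} t * B\<^sup>2)"
    proof (rule AE_I2)
      fix t :: real
      have "\<bar>indicator {0..1} t * green_grad u t\<bar>\<^sup>2 \<le> B\<^sup>2" by (intro power_mono B) simp
      then show "norm ((indicator {0..1} t * green_grad u t)\<^sup>2) \<le> norm (indicator {0..1} t * B\<^sup>2)"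
        by (cases "t \<in> {0..1}") (auto simp del: atLeastAtMost_iff)
    qed
  qed measurable
  show "indicator {0..1} t * green_grad u t = 0" if "t \<notin> {0..1}" for t using that by simp
  fix x :: real assume x: "x \<in> {0..1}"
  have "(LINT t:{0..x}|lborel. indicator {0..1} t * green_grad u t) = (LINT t|lborel. indicator {0..x} t * green_grad u t)"
    using x unfolding set_lebesgue_integral_def
    by (intro Bochner_Integration.integral_cong) (auto simp: indicator_def)
  also have "\<dots> = (LINT y|\<nu>. u y * (LINT t|lborel. indicator {0..x} t * green_deriv t y))"
    using u x by (intro integral_mult_green_grad) auto
  also have "\<dots> = green_op u x"
    unfolding integral_interval_green_deriv[OF x] using x by (simp add: green_op_def mult.commute)
  finally show "green_op u x = (LINT t:{0..x}|lborel. indicator {0..1} t * green_grad u t)" ..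
qed

text \<open>The weak form of the equation -(T u)'' = u \<nu>. The test function h is any H^1
  function with zero boundary values, whatever its shape on the gaps of the support.\<close>

lemma integral_green_grad_gradient:
  assumes u: "u \<in> bdd_borel" and h: "is_gradient h k" "h 1 = 0" "h \<in> borel_measurable borel"
  shows "(LINT t|lborel. k t * green_grad u t) = ip u h"
proof -
  note [measurable] = is_gradientD(1)[OF h(1)] bdd_borelD[OF u] h(3)
  have [measurable]: "(\<lambda>y. LINT t|lborel. k t * green_deriv t y) \<in> borel_measurable borel"
    by measurable
  have "(LINT t|lborel. k t * green_grad u t) = (LINT y|\<nu>. u y * (LINT t|lborel. k t * green_deriv t y))"
    by (rule integral_mult_green_grad[OF u is_gradientD(2)[OF h(1)]])
  also have "\<dots> = (LINT y|\<nu>. u y * h y)"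
  proof (rule integral_cong_AE)
    show "AE y in \<nu>. u y * (LINT t|lborel. k t * green_deriv t y) = u y * h y"
      using AE_inside
    proof eventually_elim
      case (elim y)
      have "(LINT t|lborel. k t * green_deriv t y) =
          indicator {0<..<1} y * ((LINT t:{0..y}|lborel. k t) - y * (LINT t:{0..1}|lborel. k t))"
        by (rule integral_green_deriv[OF is_gradientD(2,4)[OF h(1)]])
      then show ?case
        using is_gradientD(5)[OF h(1), of y] is_gradientD(5)[OF h(1), of 1] h(2) elim by simp
    qed
  qed measurable
  finally show ?thesis by (simp add: ip_def)
qed

lemma integral_green_grad_green_grad:
  assumes "u \<in> bdd_borel" "v \<in> bdd_borel"
  shows "(LINT t|lborel. (indicator {0..1} t * green_grad v t) * (indicator {0..1} t * green_grad u t)) = ip u (green_op v)"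
proof -
  have "(LINT t|lborel. (indicator {0..1} t * green_grad v t) * (indicator {0..1} t * green_grad u t))
      = (LINT t|lborel. (indicator {0..1} t * green_grad v t) * green_grad u t)"
    by (intro Bochner_Integration.integral_cong) (auto simp: indicator_def)
  also have "\<dots> = ip u (green_op v)"
    using assms by (intro integral_green_grad_gradient green_op_is_gradient bdd_borelD green_op_bdd_borel) auto
  finally show ?thesis .
qed

text \<open>Both sides are the Dirichlet product of \<open>green_op u\<close> and
  \<open>green_op v\<close>.\<close>

lemma ip_green_op_commute:
  assumes "u \<in> bdd_borel" "v \<in> bdd_borel"
  shows "ip (green_op u) v = ip u (green_op v)"
  using integral_green_grad_green_grad[OF assms] integral_green_grad_green_grad[OF assms(2,1)] by (simp add: mult.commute ip_commute)

lemma ip_green_op_nonneg: "u \<in> bdd_borel \<Longrightarrow> 0 \<le> ip (green_op u) u"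
proof -
  assume u: "u \<in> bdd_borel"
  have "0 \<le> (LINT t|lborel. (indicator {0..1} t * green_grad u t) * (indicator {0..1} t * green_grad u t))"
    by (intro Bochner_Integration.integral_nonneg) simp
  then show ?thesis unfolding integral_green_grad_green_grad[OF u u] by (simp add: ip_commute)
qed

text \<open>The complement of the support is covered by open null sets, and Lindelof's theorem
  extracts a countable subcover.\<close>

lemma AE_supp: "AE y in \<nu>. y \<in> measure_supp \<nu>"
proof -
  let ?F = "{U. open U \<and> emeasure \<nu> U = 0}"
  obtain F where F: "F \<subseteq> ?F" "countable F" "\<Union>F = \<Union>?F"
    using Lindelof[of ?F] by auto
  have "(\<Union>U\<in>F. U) \<in> null_sets \<nu>"
    using F by (intro null_sets_UN') (auto simp: null_sets_def)
  moreover have "- measure_supp \<nu> \<subseteq> \<Union>?F" by (auto simp: measure_supp_def)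
  ultimately show ?thesis using F by (intro AE_I'[of "\<Union>F"]) auto
qed

text \<open>\<open>green x y\<close> is affine in x as long as x does not cross y, and \<nu>-almost
  every y lies in the support, hence off the gap. The slope is \<open>green_grad u z\<close> for a
  point z of the gap.\<close>

lemma green_op_affine_on_gap:
  assumes u: "u \<in> bdd_borel" and I: "I \<in> components ({0..1} - measure_supp \<nu>)"
  shows "\<exists>a b. \<forall>x\<in>I. green_op u x = a * x + b"
proof -
  have sub: "I \<subseteq> {0..1} - measure_supp \<nu>" and conn: "connected I" and "I \<noteq> {}"
    using in_components_subset[OF I] in_components_connected[OF I] in_components_nonempty[OF I] by auto
  then obtain z where z: "z \<in> I" by blast
  have "green_op u x = green_op u z + (x - z) * green_grad u z" if x: "x \<in> I" for x
  proof -
    have xz: "x \<in> {0..1}" "z \<in> {0..1}" using x z sub by auto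
    note [measurable] = bdd_borelD[OF u]
    have i: "integrable \<nu> (\<lambda>y. green w y * u y)" if "w \<in> {0..1}" for w
      using that u by (intro integrable_bdd_borel bdd_borel_mult green_bdd_borel)
    have "green_op u x - green_op u z = (LINT y|\<nu>. green x y * u y - green z y * u y)"
      using xz i by (simp add: green_op_def)
    also have "\<dots> = (LINT y|\<nu>. (x - z) * (green_deriv z y * u y))"
    proof (rule integral_cong_AE)
      show "AE y in \<nu>. green x y * u y - green z y * u y = (x - z) * (green_deriv z y * u y)"
        using AE_supp AE_inside
      proof eventually_elim
        case (elim y)
        \<comment> \<open>Otherwise y would lie between two points of the connected set
          \<open>I\<close>, hence in \<open>I\<close>, which avoids the support.\<close>
        have "y < x \<and> y < z \<or> x < y \<and> z < y"
        proof (rule ccontr)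
          assume "\<not> ?thesis"
          then have "x \<le> y \<and> y \<le> z \<or> z \<le> y \<and> y \<le> x" by auto
          then have "y \<in> I" using connectedD_interval[OF conn] x z by blast
          then show False using sub elim by auto
        qed
        then have "green x y - green z y = (x - z) * green_deriv z y"
          using elim by (auto simp: green_def green_deriv_def algebra_simps)
        then show ?case by (metis left_diff_distrib mult.assoc)
      qed
    qed measurable
    also have "\<dots> = (x - z) * green_grad u z" by (simp add: green_grad_def)
    finally show ?thesis by simp
  qed
  then have "\<forall>x\<in>I. green_op u x = green_grad u z * x + (green_op u z - z * green_grad u z)" by (simp add: algebra_simps)
  then show ?thesis by blast
qed

lemma green_op_form_dom:
  assumes "u \<in> bdd_borel" shows "green_op u \<in> form_dom \<nu>"
  using assms green_op_is_gradient[OF assms] green_op_continuous_on[OF assms] green_op_affine_on_gap[OF assms]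
  by (auto simp: form_dom_def H10_iff C_affine_def green_op_outside)

lemma form_dom_bdd_borel: "f \<in> form_dom \<nu> \<Longrightarrow> f \<in> bdd_borel"
  by (rule bdd_borel_of_continuous_on) (auto simp: form_dom_def H10_iff C_affine_def)

lemma form_dom_gradient: "f \<in> form_dom \<nu> \<Longrightarrow> \<exists>g. is_gradient f g"
  by (auto simp: form_dom_def H10_iff)

lemma form_dom_ends: "f \<in> form_dom \<nu> \<Longrightarrow> f 1 = 0" "f \<in> form_dom \<nu> \<Longrightarrow> x \<notin> {0..1} \<Longrightarrow> f x = 0"
  by (auto simp: form_dom_def H10_iff)

lemma form_dom_diff:
  assumes f: "f \<in> form_dom \<nu>" and h: "h \<in> form_dom \<nu>"
  shows "(\<lambda>x. f x - h x) \<in> form_dom \<nu>"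
proof -
  have "(\<lambda>x. f x - h x) \<in> H10"
  proof -
    obtain g k where "is_gradient f g" "is_gradient h k"
      using form_dom_gradient f h by blast
    then have "\<exists>g. is_gradient (\<lambda>x. f x - h x) g" using is_gradient_diff by blast
    then show ?thesis using form_dom_ends[OF f] form_dom_ends[OF h] by (simp add: H10_iff)
  qed
  moreover have "\<exists>a b. \<forall>x\<in>I. f x - h x = a * x + b" if I: "I \<in> components ({0..1} - measure_supp \<nu>)" for I
  proof -
    obtain a b c d where "\<forall>x\<in>I. f x = a * x + b" "\<forall>x\<in>I. h x = c * x + d"
      using f h I unfolding form_dom_def C_affine_def by blast
    then have "\<forall>x\<in>I. f x - h x = (a - c) * x + (b - d)" by (simp add: algebra_simps)
    then show ?thesis by blast
  qed
  moreover have "continuous_on {0..1} (\<lambda>x. f x - h x)"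
    using f h by (intro continuous_on_diff) (auto simp: form_dom_def C_affine_def)
  ultimately show ?thesis by (simp add: form_dom_def C_affine_def)
qed

lemma energy_green_op:
  assumes u: "u \<in> bdd_borel" and h: "h \<in> form_dom \<nu>"
  shows "energy (green_op u) h = ip u h"
proof -
  obtain k where k: "is_gradient h k" using form_dom_gradient[OF h] by blast
  have "energy (green_op u) h = (LINT t|lborel. (indicator {0..1} t * green_grad u t) * k t)"
    by (rule energy_eq[OF green_op_is_gradient[OF u] k])
  also have "\<dots> = (LINT t|lborel. k t * green_grad u t)"
    using is_gradientD(4)[OF k] by (intro Bochner_Integration.integral_cong) (auto simp: indicator_def)
  also have "\<dots> = ip u h"
    using form_dom_ends(1)[OF h] form_dom_bdd_borel[OF h] by (intro integral_green_grad_gradient u k bdd_borelD)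
  finally show ?thesis .
qed

text \<open>The difference of f and l T f lies in the form domain, so the eigenvalue equation and
  the weak equation may both be tested with it. Together they give it zero energy, and it starts
  from 0. Conversely, a bounded fixed point of l T is in \<open>form_dom\<close> because T maps
  there.\<close>

lemma eigenspace_eq: "eigenspace \<nu> l = {f \<in> bdd_borel. f = (\<lambda>x. l * green_op f x)}"
proof (intro set_eqI iffI)
  fix f assume f: "f \<in> eigenspace \<nu> l"
  then have fd: "f \<in> form_dom \<nu>" by (simp add: eigenspace_def)
  have fb: "f \<in> bdd_borel" by (rule form_dom_bdd_borel[OF fd])
  let ?u = "\<lambda>x. l * f x"
  have u: "?u \<in> bdd_borel" by (rule bdd_borel_scale[OF fb])
  let ?h = "\<lambda>x. f x - green_op ?u x"
  have h: "?h \<in> form_dom \<nu>" by (rule form_dom_diff[OF fd green_op_form_dom[OF u]])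
  obtain g where g: "is_gradient f g" using form_dom_gradient[OF fd] by blast
  let ?k = "\<lambda>t. indicator {0..1} t * green_grad ?u t"
  note k = green_op_is_gradient[OF u]
  have gk: "is_gradient ?h (\<lambda>t. g t - ?k t)" by (rule is_gradient_diff[OF g k])
  have "energy f ?h = energy (green_op ?u) ?h"
    using f h energy_green_op[OF u h] by (simp add: eigenspace_def ip_scale_left flip: ip_def)
  then have e: "(LINT t|lborel. g t * (g t - ?k t)) = (LINT t|lborel. ?k t * (g t - ?k t))"
    by (simp only: energy_eq[OF g gk] energy_eq[OF k gk])
  have i: "integrable lborel (\<lambda>t. g t * (g t - ?k t))" "integrable lborel (\<lambda>t. ?k t * (g t - ?k t))"
    using is_gradientD(1,3)[OF g] is_gradientD(1,3)[OF k] is_gradientD(1,3)[OF gk]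
    by (auto intro!: integrable_mult_of_squares)
  have "(LINT t|lborel. (g t - ?k t)\<^sup>2) = (LINT t|lborel. g t * (g t - ?k t) - ?k t * (g t - ?k t))"
    by (simp add: power2_eq_square algebra_simps)
  also have "\<dots> = 0" using i e by (simp only: Bochner_Integration.integral_diff)
  finally have z: "(LINT t|lborel. (g t - ?k t)\<^sup>2) = 0" .
  have "f x = l * green_op f x" for x
  proof (cases "x \<in> {0..1}")
    case True
    then show ?thesis using is_gradient_zeroD[OF gk z True] by (simp add: green_op_scale)
  next
    case False
    then show ?thesis using form_dom_ends(2)[OF fd False] by (simp add: green_op_outside)
  qed
  then show "f \<in> {f \<in> bdd_borel. f = (\<lambda>x. l * green_op f x)}" using fb by (auto simp: fun_eq_iff)
next
  fix f assume "f \<in> {f \<in> bdd_borel. f = (\<lambda>x. l * green_op f x)}"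
  then have fb: "f \<in> bdd_borel" and f: "f = green_op (\<lambda>x. l * f x)" unfolding green_op_scale by auto
  have u: "(\<lambda>x. l * f x) \<in> bdd_borel" by (rule bdd_borel_scale[OF fb])
  have fd: "f \<in> form_dom \<nu>" using green_op_form_dom[OF u] unfolding f[symmetric] .
  have "energy f h = l * (LINT x|\<nu>. f x * h x)" if h: "h \<in> form_dom \<nu>" for h
    using energy_green_op[OF u h] unfolding f[symmetric] by (simp add: ip_scale_left flip: ip_def)
  then show "f \<in> eigenspace \<nu> l" using fd by (simp add: eigenspace_def)
qed

lemma eigenspaceD:
  assumes "f \<in> eigenspace \<nu> l"
  shows "f \<in> bdd_borel" "f x = l * green_op f x"
  using assms by (auto simp: eigenspace_eq fun_eq_iff)

text \<open>An eigenfunction is a multiple of a value of T, and values of T are bounded pointwise by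
  the L^2 norm.\<close>

lemma eigenfunction_zeroI:
  assumes f: "f \<in> eigenspace \<nu> l" and z: "ip f f = 0"
  shows "f = (\<lambda>x. 0)"
  using abs_green_op_le[OF eigenspaceD(1)[OF f]] z eigenspaceD(2)[OF f] by (auto simp: fun_eq_iff)

lemma eigenspaces_orthogonal:
  assumes f: "f \<in> eigenspace \<nu> l" and h: "h \<in> eigenspace \<nu> k" and "l \<noteq> k"
  shows "ip f h = 0"
proof -
  have b: "f \<in> bdd_borel" "h \<in> bdd_borel" using eigenspaceD(1) f h by auto
  have fe: "f = (\<lambda>x. l * green_op f x)" and he: "h = (\<lambda>x. k * green_op h x)" using eigenspaceD(2) f h by auto
  have "ip f h = l * ip (green_op f) h" using ip_scale_left[of l "green_op f" h] unfolding fe[symmetric] .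
  moreover have "ip f h = k * ip (green_op f) h"
    using ip_scale_right[of f k "green_op h"] ip_green_op_commute[OF b] unfolding he[symmetric] by simp
  ultimately show ?thesis using \<open>l \<noteq> k\<close> by auto
qed

subsection \<open>Variational comparison\<close>

text \<open>Cauchy-Schwarz in the Dirichlet integral. For u = h it turns an upper bound on the
  energy of h into a lower bound on \<open>ip (green_op h) h\<close>, also when h is not affine on
  the gaps.\<close>

lemma ip_squared_le_gradient:
  assumes u: "u \<in> bdd_borel" and h: "is_gradient h k" "h 1 = 0" "h \<in> borel_measurable borel"
  shows "(ip u h)\<^sup>2 \<le> ip (green_op u) u * (LINT t|lborel. (k t)\<^sup>2)"
proof -
  let ?d = "\<lambda>t. indicator {0..1} t * green_grad u t"
  have g: "is_gradient (green_op u) ?d" by (rule green_op_is_gradient[OF u])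
  have "ip u h = (LINT t|lborel. k t * green_grad u t)"
    by (rule integral_green_grad_gradient[OF u h, symmetric])
  also have "\<dots> = (LINT t|lborel. ?d t * k t)"
    using is_gradientD(4)[OF h(1)] by (intro Bochner_Integration.integral_cong) (auto simp: indicator_def)
  finally have "(ip u h)\<^sup>2 = (LINT t|lborel. ?d t * k t)\<^sup>2" by simp
  also have "\<dots> \<le> (LINT t|lborel. (?d t)\<^sup>2) * (LINT t|lborel. (k t)\<^sup>2)"
    using is_gradientD(1,3)[OF g] is_gradientD(1,3)[OF h(1)]
    by (intro integral_mult_squared_le integrable_mult_of_squares) auto
  also have "(LINT t|lborel. (?d t)\<^sup>2) = ip (green_op u) u"
    using integral_green_grad_green_grad[OF u u] by (simp add: power2_eq_square ip_commute)
  finally show ?thesis .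
qed

text \<open>Cauchy-Schwarz for the positive form that sends u and v to
  \<open>ip (green_op u) v\<close>.\<close>

lemma ip_green_op_squared_le:
  assumes u: "u \<in> bdd_borel" and v: "v \<in> bdd_borel"
  shows "(ip u (green_op v))\<^sup>2 \<le> ip (green_op u) u * ip (green_op v) v"
proof -
  have "(ip u (green_op v))\<^sup>2 \<le> ip (green_op u) u * (LINT t|lborel. (indicator {0..1} t * green_grad v t)\<^sup>2)"
    by (rule ip_squared_le_gradient[OF u green_op_is_gradient[OF v]]) (auto intro: bdd_borelD green_op_bdd_borel v)
  then show ?thesis
    using integral_green_grad_green_grad[OF v v] by (simp add: power2_eq_square ip_commute)
qed

text \<open>The pointwise bound, squared and integrated. It makes the supremum of the Rayleigh
  quotients finite.\<close>

lemma ip_green_op_green_op_le: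
  assumes u: "u \<in> bdd_borel"
  shows "ip (green_op u) (green_op u) \<le> mass\<^sup>2 * ip u u"
proof -
  have "ip (green_op u) (green_op u) \<le> (LINT y|\<nu>. mass * ip u u)"
    unfolding ip_def[of "green_op u"]
  proof (rule integral_mono)
    show "integrable \<nu> (\<lambda>y. green_op u y * green_op u y)"
      by (intro integrable_bdd_borel bdd_borel_mult green_op_bdd_borel u)
    show "green_op u y * green_op u y \<le> mass * ip u u" for y
    proof -
      have "\<bar>green_op u y\<bar>\<^sup>2 \<le> (sqrt mass * sqrt (ip u u))\<^sup>2"
        by (intro power_mono abs_green_op_le u) simp
      then show ?thesis by (simp add: power_mult_distrib ip_self_nonneg) (simp add: power2_eq_square)
    qed
  qed simp
  then show ?thesis by (simp add: power2_eq_square mult.assoc)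
qed

lemma ip_tendsto:
  assumes w: "\<And>n. w n \<in> bdd_borel" "\<And>n x. \<bar>w n x\<bar> \<le> B" "\<And>x. (\<lambda>n. w n x) \<longlonglongrightarrow> w' x" "w' \<in> bdd_borel"
    and z: "\<And>n. z n \<in> bdd_borel" "\<And>n x. \<bar>z n x\<bar> \<le> C" "\<And>x. (\<lambda>n. z n x) \<longlonglongrightarrow> z' x" "z' \<in> bdd_borel"
  shows "(\<lambda>n. ip (w n) (z n)) \<longlonglongrightarrow> ip w' z'"
  unfolding ip_def
proof (rule integral_dominated_convergence[where w = "\<lambda>_. B * C"])
  note [measurable] = bdd_borelD[OF w(1)] bdd_borelD[OF w(4)] bdd_borelD[OF z(1)] bdd_borelD[OF z(4)]
  show "(\<lambda>y. w' y * z' y) \<in> borel_measurable \<nu>" "\<And>n. (\<lambda>y. w n y * z n y) \<in> borel_measurable \<nu>"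
    by measurable
  show "AE y in \<nu>. (\<lambda>n. w n y * z n y) \<longlonglongrightarrow> w' y * z' y"
    by (intro AE_I2 tendsto_mult w z)
  show "AE y in \<nu>. norm (w n y * z n y) \<le> B * C" for n
  proof (rule AE_I2)
    fix y
    have "0 \<le> B" using w(2)[of n y] by simp
    then show "norm (w n y * z n y) \<le> B * C"
      using w(2)[of n y] z(2)[of n y] by (simp add: abs_mult mult_mono)
  qed
qed simp

text \<open>
  A sequence maximising the Rayleigh quotient off \<open>E\<close> need not converge, but its images under the Green
  operator do, uniformly along a subsequence, and their limit is already an eigenfunction; so
  neither completeness nor weak compactness of an \<open>L\<^sup>2\<close> space is needed.
\<close>

lemma exists_orthogonal_eigenfunction:
  assumes E: "\<And>e. e \<in> E \<Longrightarrow> \<exists>l. e \<in> eigenspace \<nu> l"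
    and f: "f \<in> bdd_borel" "ip f f > 0" "\<And>e. e \<in> E \<Longrightarrow> ip f e = 0"
    and x: "ip f f \<le> x * ip (green_op f) f" "x > 0"
  shows "\<exists>l g. is_eigenvalue \<nu> l \<and> l \<le> x \<and> g \<in> eigenspace \<nu> l \<and> ip g g > 0 \<and> (\<forall>e\<in>E. ip g e = 0)"
proof -
  define W where "W = {u \<in> bdd_borel. \<forall>e\<in>E. ip u e = 0}"
  define A where "A = {ip (green_op u) u | u. u \<in> W \<and> ip u u = 1}"
  define \<mu> where "\<mu> = Sup A"
  have Eb: "e \<in> bdd_borel" if "e \<in> E" for e using E[OF that] eigenspaceD(1) by blast
  have Wb: "u \<in> bdd_borel" if "u \<in> W" for u using that by (simp add: W_def)
  \<comment> \<open>Symmetry of T makes the orthogonal complement of eigenfunctions invariant. Those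
    of norm zero are treated apart, since the argument divides by l.\<close>
  have TW: "green_op u \<in> W" if u: "u \<in> W" for u
  proof -
    have "ip (green_op u) e = 0" if e: "e \<in> E" for e
    proof (cases "ip e e = 0")
      case True
      then have "(ip (green_op u) e)\<^sup>2 \<le> 0"
        using ip_Cauchy_Schwarz[OF green_op_bdd_borel[OF Wb[OF u]] Eb[OF e]] by simp
      then show ?thesis by simp
    next
      case False
      obtain l where l: "e \<in> eigenspace \<nu> l" using E[OF e] by blast
      then have le: "e = (\<lambda>x. l * green_op e x)" using eigenspaceD(2) by auto
      have "l * ip (green_op u) e = l * ip u (green_op e)" using ip_green_op_commute[OF Wb[OF u] Eb[OF e]] by simp
      also have "\<dots> = ip u e" using ip_scale_right[of u l "green_op e"] unfolding le[symmetric] by simp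
      also have "\<dots> = 0" using u e by (simp add: W_def)
      finally have "l * ip (green_op u) e = 0" .
      moreover have "l \<noteq> 0"
      proof
        assume "l = 0"
        then have "e = (\<lambda>x. 0)" using le by simp
        then show False using False by (simp add: ip_def)
      qed
      ultimately show ?thesis by simp
    qed
    then show ?thesis using Wb[OF u] by (simp add: W_def green_op_bdd_borel)
  qed
  have A_le: "ip (green_op u) u \<le> mass" if u: "u \<in> W" "ip u u = 1" for u
  proof -
    have "(ip (green_op u) u)\<^sup>2 \<le> ip (green_op u) (green_op u) * ip u u"
      by (intro ip_Cauchy_Schwarz green_op_bdd_borel Wb u)
    also have "\<dots> \<le> mass\<^sup>2" using ip_green_op_green_op_le[OF Wb[OF u(1)]] u by simp
    finally show ?thesis by (simp add: abs_le_square_iff[symmetric])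
  qed
  have bdd: "bdd_above A" using A_le by (auto simp: A_def intro!: bdd_aboveI[of _ mass])
  have normalize: "\<exists>v. v \<in> W \<and> ip v v = 1 \<and> ip (green_op v) v * ip u u = ip (green_op u) u"
    if u: "u \<in> W" "ip u u \<noteq> 0" for u
  proof -
    define r where "r = 1 / sqrt (ip u u)"
    have r: "r * r * ip u u = 1" using u(2) ip_self_nonneg[of u] by (simp add: r_def)
    have "(\<lambda>y. r * u y) \<in> W" using u by (auto simp: W_def bdd_borel_scale ip_scale_left)
    moreover have "ip (\<lambda>y. r * u y) (\<lambda>y. r * u y) = 1"
      using r by (simp only: ip_scale_left ip_scale_right mult.assoc)
    moreover have "ip (green_op (\<lambda>y. r * u y)) (\<lambda>y. r * u y) * ip u u = (r * r * ip u u) * ip (green_op u) u"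
      unfolding green_op_scale by (simp only: ip_scale_left ip_scale_right mult_ac)
    ultimately show ?thesis using r by (intro exI[of _ "\<lambda>y. r * u y"]) auto
  qed
  have le_mu: "ip (green_op u) u \<le> \<mu> * ip u u" if u: "u \<in> W" for u
  proof (cases "ip u u = 0")
    case True
    then have "green_op u y = 0" for y using abs_green_op_le[OF Wb[OF u], of y] by simp
    then show ?thesis using True by (simp add: ip_def)
  next
    case False
    with normalize[OF u] obtain v where v: "v \<in> W" "ip v v = 1" "ip (green_op v) v * ip u u = ip (green_op u) u" by blast
    have "ip (green_op v) v \<le> \<mu>"
      unfolding \<mu>_def using v by (intro cSup_upper bdd) (auto simp: A_def)
    then have "ip (green_op v) v * ip u u \<le> \<mu> * ip u u" by (intro mult_right_mono ip_self_nonneg)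
    then show ?thesis using v by simp
  qed
  have fW: "f \<in> W" using f by (simp add: W_def)
  have "ip f f \<le> x * (\<mu> * ip f f)"
    using x le_mu[OF fW] by (meson mult_left_mono less_imp_le order_trans)
  \<comment> \<open>In other words \<open>1 / \<mu> \<le> x\<close>: the eigenvalue that the
    supremum produces is small enough.\<close>
  then have xmu: "1 \<le> x * \<mu>" using f(2) by (simp flip: mult.assoc)
  then have mu: "\<mu> > 0" using x(2) by (smt (verit) mult_nonneg_nonpos)
  \<comment> \<open>On \<open>W\<close> the supremum of the Rayleigh quotient also bounds the norm
    of T: \<open>ip_green_op_squared_le\<close> is applied to u and T u, and one factor
    cancels.\<close>
  have TT_le: "ip (green_op u) (green_op u) \<le> \<mu>\<^sup>2 * ip u u" if u: "u \<in> W" for u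
  proof -
    let ?s = "ip (green_op u) (green_op u)"
    have "?s\<^sup>2 = (ip u (green_op (green_op u)))\<^sup>2" using ip_green_op_commute[OF Wb[OF u] green_op_bdd_borel[OF Wb[OF u]]] by simp
    also have "\<dots> \<le> ip (green_op u) u * ip (green_op (green_op u)) (green_op u)" by (intro ip_green_op_squared_le green_op_bdd_borel Wb u)
    also have "\<dots> \<le> (\<mu> * ip u u) * (\<mu> * ?s)"
      using mu ip_self_nonneg by (intro mult_mono le_mu TW u ip_green_op_nonneg green_op_bdd_borel Wb) auto
    finally have "?s * ?s \<le> (\<mu>\<^sup>2 * ip u u) * ?s" by (simp add: power2_eq_square mult_ac)
    then show ?thesis
      using ip_self_nonneg[of "green_op u"] ip_self_nonneg[of u] by (cases "?s = 0") auto
  qed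
  have "A \<noteq> {}" using normalize[OF fW] f(2) unfolding A_def by fastforce
  have "\<exists>u. u \<in> W \<and> ip u u = 1 \<and> ip (green_op u) u > \<mu> - 1 / real (Suc n)" for n
    using less_cSupD[OF \<open>A \<noteq> {}\<close>, of "\<mu> - 1 / real (Suc n)"] unfolding \<mu>_def A_def by auto
  then obtain u where u: "\<And>n. u n \<in> W" "\<And>n. ip (u n) (u n) = 1"
    "\<And>n. ip (green_op (u n)) (u n) > \<mu> - 1 / real (Suc n)" by metis
  note ub = Wb[OF u(1)]
  define v where "v = (\<lambda>n. green_op (u n))"
  have vb: "v n \<in> bdd_borel" for n unfolding v_def by (intro green_op_bdd_borel ub)
  have v_le: "\<bar>v n y\<bar> \<le> sqrt mass" for n y using abs_green_op_le[OF ub[of n], of y] u(2) by (simp add: v_def)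
  have v_lip: "\<bar>v n y - v n z\<bar> \<le> \<bar>y - z\<bar> * sqrt mass" if "y \<in> {0..1}" "z \<in> {0..1}" for n y z
    using green_op_diff_le[OF ub[of n] that] u(2) by (simp add: v_def)
  have tau_le: "ip (green_op (u n)) (u n) \<le> \<mu>" for n using le_mu[OF u(1)] u(2) by simp
  have tau: "(\<lambda>n. ip (v n) (u n)) \<longlonglongrightarrow> \<mu>"
  proof (rule tendsto_sandwich[where f = "\<lambda>n. \<mu> - 1 / real (Suc n)" and h = "\<lambda>n. \<mu>"])
    show "(\<lambda>n. \<mu> - 1 / real (Suc n)) \<longlonglongrightarrow> \<mu>"
      using tendsto_diff[OF tendsto_const[of \<mu>] LIMSEQ_inverse_real_of_nat] by (simp add: inverse_eq_divide)
  qed (use u(3) tau_le in \<open>auto simp: v_def intro!: always_eventually less_imp_le\<close>)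
  have "\<exists>g k. continuous_on {0..1} g \<and> strict_mono (k :: nat \<Rightarrow> nat) \<and>
      (\<forall>e>0. \<exists>N. \<forall>n y. n \<ge> N \<and> y \<in> {0..1} \<longrightarrow> norm (v (k n) y - g y) < e)"
  proof (rule Arzela_Ascoli[of "{0..1::real}" v "sqrt mass"])
    show "compact {0..1::real}" by simp
    show "norm (v n y) \<le> sqrt mass" for n y using v_le by simp
    fix y e :: real assume y: "y \<in> {0..1}" and e: "0 < e"
    show "\<exists>d>0. \<forall>n z. z \<in> {0..1} \<and> norm (y - z) < d \<longrightarrow> norm (v n y - v n z) < e"
    proof (intro exI[of _ "e / (sqrt mass + 1)"] conjI allI impI)
      show "0 < e / (sqrt mass + 1)" using e by (simp add: add_nonneg_pos)
      fix n z assume z: "z \<in> {0..1} \<and> norm (y - z) < e / (sqrt mass + 1)"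
      have "\<bar>v n y - v n z\<bar> \<le> \<bar>y - z\<bar> * (sqrt mass + 1)"
        using v_lip[OF y, of z n] z by (smt (verit) mult_left_mono abs_ge_zero)
      also have "\<dots> < e" using z by (simp add: pos_less_divide_eq add_nonneg_pos)
      finally show "norm (v n y - v n z) < e" by simp
    qed
  qed blast
  then obtain g0 k where g0: "continuous_on {0..1} g0" and k: "strict_mono (k :: nat \<Rightarrow> nat)"
    and conv: "\<And>e. e > 0 \<Longrightarrow> \<exists>N. \<forall>n y. n \<ge> N \<and> y \<in> {0..1} \<longrightarrow> norm (v (k n) y - g0 y) < e"
    by blast
  define g where "g = (\<lambda>y. if y \<in> {0..1} then g0 y else 0)"
  have g_out: "g y = 0" if "y \<notin> {0..1}" for y unfolding g_def using that by (rule if_not_P)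
  have "continuous_on {0..1} g" using g0 by (subst continuous_on_cong[OF refl, of _ _ g0]) (auto simp: g_def)
  then have gb: "g \<in> bdd_borel" by (rule bdd_borel_of_continuous_on) (rule g_out)
  have vg: "(\<lambda>n. v (k n) y) \<longlonglongrightarrow> g y" for y
  proof (cases "y \<in> {0..1}")
    case True
    then show ?thesis
      using conv unfolding LIMSEQ_iff g_def by (metis True)
  qed (simp add: v_def g_out green_op_outside)
  \<comment> \<open>For a unit vector u and v = T u the square expands to
    \<open>ip v v - 2 * \<mu> * ip v u + \<mu>\<^sup>2\<close>. The first term is at most the last
    by \<open>TT_le\<close>, and \<open>ip v u\<close> tends to \<mu>.\<close>
  have w_sq: "(\<lambda>n. ip (\<lambda>y. v (k n) y - \<mu> * u (k n) y) (\<lambda>y. v (k n) y - \<mu> * u (k n) y)) \<longlonglongrightarrow> 0"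
  proof (rule tendsto_sandwich[where f = "\<lambda>n. 0" and h = "\<lambda>n. 2 * \<mu>\<^sup>2 - 2 * \<mu> * ip (v (k n)) (u (k n))"])
    have "(\<lambda>n. 2 * \<mu>\<^sup>2 - 2 * \<mu> * ip (v (k n)) (u (k n))) \<longlonglongrightarrow> 2 * \<mu>\<^sup>2 - 2 * \<mu> * \<mu>"
      by (intro tendsto_intros LIMSEQ_subseq_LIMSEQ[OF tau k, unfolded comp_def])
    then show "(\<lambda>n. 2 * \<mu>\<^sup>2 - 2 * \<mu> * ip (v (k n)) (u (k n))) \<longlonglongrightarrow> 0" by (simp add: power2_eq_square)
    have "ip (\<lambda>y. v n y - \<mu> * u n y) (\<lambda>y. v n y - \<mu> * u n y) \<le> 2 * \<mu>\<^sup>2 - 2 * \<mu> * ip (v n) (u n)" for n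
    proof -
      let ?w = "\<lambda>y. v n y - \<mu> * u n y"
      have wb: "?w \<in> bdd_borel" by (intro bdd_borel_diff bdd_borel_scale vb ub)
      have "ip ?w ?w = ip (v n) ?w - \<mu> * ip (u n) ?w"
        using ip_diff_left[OF vb bdd_borel_scale[OF ub] wb] by (simp only: ip_scale_left)
      also have "ip (v n) ?w = ip (v n) (v n) - \<mu> * ip (v n) (u n)"
        using ip_diff_left[OF vb bdd_borel_scale[OF ub] vb, of n \<mu> n n] by (simp only: ip_scale_left ip_commute)
      also have "ip (u n) ?w = ip (v n) (u n) - \<mu> * ip (u n) (u n)"
        using ip_diff_left[OF vb bdd_borel_scale[OF ub] ub, of n \<mu> n n] by (simp only: ip_scale_left ip_commute)
      also have "ip (v n) (v n) \<le> \<mu>\<^sup>2" using TT_le[OF u(1)[of n]] u(2) by (simp add: v_def)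
      finally show ?thesis using u(2)[of n] by (simp add: algebra_simps power2_eq_square)
    qed
    then show "\<forall>\<^sub>F n in sequentially. ip (\<lambda>y. v (k n) y - \<mu> * u (k n) y) (\<lambda>y. v (k n) y - \<mu> * u (k n) y)
        \<le> 2 * \<mu>\<^sup>2 - 2 * \<mu> * ip (v (k n)) (u (k n))" by simp
  qed (auto simp: ip_self_nonneg)
  \<comment> \<open>With v = T u one has T v - \<mu> v = T (v - \<mu> u): one more application of T
    converts smallness in L^2 into pointwise smallness.\<close>
  have Tg: "green_op g y = \<mu> * g y" for y
  proof (cases "y \<in> {0..1}")
    case y: True
    have "(\<lambda>n. ip (green y) (v (k n))) \<longlonglongrightarrow> ip (green y) g"
      by (rule ip_tendsto[where B = 1 and C = "sqrt mass"])
        (use y gb vb v_le vg in \<open>auto simp: abs_green_le green_bdd_borel\<close>)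
    then have "(\<lambda>n. green_op (v (k n)) y) \<longlonglongrightarrow> green_op g y" using y by (simp add: green_op_def ip_def)
    then have "(\<lambda>n. green_op (v (k n)) y - \<mu> * v (k n) y) \<longlonglongrightarrow> green_op g y - \<mu> * g y"
      by (intro tendsto_intros vg)
    moreover have "(\<lambda>n. green_op (v (k n)) y - \<mu> * v (k n) y) \<longlonglongrightarrow> 0"
    proof (rule Lim_null_comparison)
      have e: "green_op (v n) y - \<mu> * v n y = green_op (\<lambda>y. v n y - \<mu> * u n y) y" for n
        using green_op_diff[OF vb bdd_borel_scale[OF ub], of n \<mu> n] by (simp add: green_op_scale v_def)
      show "\<forall>\<^sub>F n in sequentially. norm (green_op (v (k n)) y - \<mu> * v (k n) y) \<le> sqrt mass *
          sqrt (ip (\<lambda>y. v (k n) y - \<mu> * u (k n) y) (\<lambda>y. v (k n) y - \<mu> * u (k n) y))"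
        unfolding e real_norm_def
        by (intro always_eventually allI abs_green_op_le bdd_borel_diff bdd_borel_scale vb ub)
      show "(\<lambda>n. sqrt mass * sqrt (ip (\<lambda>y. v (k n) y - \<mu> * u (k n) y) (\<lambda>y. v (k n) y - \<mu> * u (k n) y))) \<longlonglongrightarrow> 0"
        using tendsto_mult[OF tendsto_const[of "sqrt mass"] tendsto_real_sqrt[OF w_sq]] by simp
    qed
    ultimately have "green_op g y - \<mu> * g y = 0" by (rule LIMSEQ_unique)
    then show ?thesis by simp
  qed (simp add: green_op_outside g_out)
  \<comment> \<open>The limit is not zero, because \<open>ip (v n) (u n)\<close> tends to \<mu>
    while \<open>u n\<close> has norm 1.\<close>
  have "\<mu>\<^sup>2 \<le> ip g g"
  proof (rule LIMSEQ_le)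
    show "(\<lambda>n. (ip (v (k n)) (u (k n)))\<^sup>2) \<longlonglongrightarrow> \<mu>\<^sup>2"
      by (intro tendsto_power LIMSEQ_subseq_LIMSEQ[OF tau k, unfolded comp_def])
    show "(\<lambda>n. ip (v (k n)) (v (k n))) \<longlonglongrightarrow> ip g g"
      by (rule ip_tendsto[where B = "sqrt mass" and C = "sqrt mass"]) (use gb vb v_le vg in auto)
    show "\<exists>N. \<forall>n\<ge>N. (ip (v (k n)) (u (k n)))\<^sup>2 \<le> ip (v (k n)) (v (k n))"
      using ip_Cauchy_Schwarz[OF vb ub] u(2) by (metis mult.right_neutral)
  qed
  then have gg: "ip g g > 0" using mu by (smt (verit) zero_less_power)
  have ge: "ip g e = 0" if e: "e \<in> E" for e
  proof -
    obtain C where C: "\<And>y. \<bar>e y\<bar> \<le> C" using bdd_borelE[OF Eb[OF e]] by blast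
    have "(\<lambda>n. ip (v (k n)) e) \<longlonglongrightarrow> ip g e"
      by (rule ip_tendsto[where B = "sqrt mass" and C = C]) (use gb vb v_le vg C Eb[OF e] in auto)
    moreover have "ip (v n) e = 0" for n using TW[OF u(1)[of n]] e by (simp add: v_def W_def)
    ultimately show ?thesis using LIMSEQ_unique[OF tendsto_const] by fastforce
  qed
  have "g = (\<lambda>y. (1 / \<mu>) * green_op g y)" using mu by (simp add: Tg)
  then have ges: "g \<in> eigenspace \<nu> (1 / \<mu>)" unfolding eigenspace_eq using gb by blast
  moreover have "g \<noteq> (\<lambda>y. 0)" using gg by (auto simp: ip_def)
  ultimately have "is_eigenvalue \<nu> (1 / \<mu>)" by (auto simp: is_eigenvalue_def)
  moreover have "1 / \<mu> \<le> x" using xmu mu by (simp add: pos_divide_le_eq)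
  ultimately show ?thesis using ges gg ge by blast
qed

section \<open>Counting eigenvalues from above and from below\<close>

lemma eigenspace_sum:
  assumes "\<And>i. i \<in> S \<Longrightarrow> e i \<in> eigenspace \<nu> l"
  shows "(\<lambda>x. \<Sum>i\<in>S. c i * e i x) \<in> eigenspace \<nu> l"
proof -
  have b: "e i \<in> bdd_borel" if "i \<in> S" for i using assms[OF that] eigenspaceD(1) by blast
  have "(\<Sum>i\<in>S. c i * e i x) = l * (\<Sum>i\<in>S. c i * green_op (e i) x)" for x
  proof -
    have "(\<Sum>i\<in>S. c i * e i x) = (\<Sum>i\<in>S. l * (c i * green_op (e i) x))"
      using eigenspaceD(2)[OF assms, of _ x] by (intro sum.cong) auto
    then show ?thesis by (simp only: sum_distrib_left)
  qed
  then have "(\<lambda>x. \<Sum>i\<in>S. c i * e i x) = (\<lambda>x. l * green_op (\<lambda>x. \<Sum>i\<in>S. c i * e i x) x)"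
    using green_op_sum[of S e c, OF b] by metis
  moreover have "(\<lambda>x. \<Sum>i\<in>S. c i * e i x) \<in> bdd_borel" by (rule bdd_borel_sum[OF b])
  ultimately show ?thesis unfolding eigenspace_eq by blast
qed

text \<open>
  The set \<open>P\<close> supplies \<open>card P\<close> linear constraints beyond which all eigenvalues are at least \<open>1 / t\<close>.
\<close>

definition controls :: "real \<Rightarrow> real set \<Rightarrow> bool" where
  "controls t P \<longleftrightarrow> finite P \<and>
     (\<forall>u\<in>bdd_borel. (\<forall>p\<in>P. green_op u p = 0) \<longrightarrow> ip (green_op u) (green_op u) \<le> t * ip (green_op u) u)"

text \<open>Too many independent eigenfunctions admit a nontrivial combination f vanishing on
  \<open>P\<close>. Then f = T u for the same combination u weighted by the eigenvalues, and
  \<open>ip f f \<le> t * ip f u \<le> t * x * ip f f\<close> forces f to vanish. Since the finite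
  families \<open>B l\<close> are arbitrary, the bound is available before eigenspaces or sets of
  eigenvalues are known to be finite.\<close>

lemma eigen_family_card_le:
  assumes P: "controls t P" and t: "t * x < 1" "0 \<le> t" and L: "finite L" "\<And>l. l \<in> L \<Longrightarrow> l \<le> x"
    and B: "\<And>l. l \<in> L \<Longrightarrow> B l \<subseteq> eigenspace \<nu> l" "\<And>l. l \<in> L \<Longrightarrow> finite (B l)"
      "\<And>l. l \<in> L \<Longrightarrow> real_fun.independent (B l)"
  shows "(\<Sum>l\<in>L. card (B l)) \<le> card P"
proof (rule ccontr)
  assume "\<not> ?thesis"
  then have less: "card P < card (Sigma L B)" using L B by (simp add: card_SigmaI)
  have finS: "finite (Sigma L B)" using L B by auto
  have finP: "finite P" using P by (simp add: controls_def)
  obtain c where c: "\<exists>i\<in>Sigma L B. c i \<noteq> 0"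
    "\<And>p. p \<in> P \<Longrightarrow> (\<Sum>i\<in>Sigma L B. c i * snd i p) = 0"
    using homogeneous_system_nontrivial[OF finP finS less, of "\<lambda>p i. snd i p"] by blast
  define F where "F = (\<lambda>l y. \<Sum>e\<in>B l. c (l, e) * e y)"
  have F: "F l \<in> eigenspace \<nu> l" if "l \<in> L" for l
    unfolding F_def using B(1)[OF that] by (intro eigenspace_sum) auto
  have Fb: "F l \<in> bdd_borel" if "l \<in> L" for l using F[OF that] eigenspaceD(1) by blast
  \<comment> \<open>\<open>l * F l\<close> is a preimage of \<open>F l\<close> under T, which gives
    \<open>green_op u = f\<close>.\<close>
  define f u where "f = (\<lambda>y. \<Sum>l\<in>L. 1 * F l y)" and "u = (\<lambda>y. \<Sum>l\<in>L. l * F l y)"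
  have fb: "f \<in> bdd_borel" and ub: "u \<in> bdd_borel" unfolding f_def u_def by (intro bdd_borel_sum Fb; simp)+
  have Tu: "green_op u = f"
  proof
    fix y
    have "green_op u y = (\<Sum>l\<in>L. l * green_op (F l) y)" unfolding u_def using Fb by (subst green_op_sum) auto
    also have "\<dots> = f y" unfolding f_def
      by (intro sum.cong refl) (simp flip: eigenspaceD(2)[OF F])
    finally show "green_op u y = f y" .
  qed
  have "f p = 0" if "p \<in> P" for p
    using c(2)[OF that] L B by (simp add: f_def F_def sum.Sigma split_beta)
  then have "ip f f \<le> t * ip f u" using P ub Tu by (auto simp: controls_def)
  moreover have F_ip: "ip (F l) (\<lambda>y. \<Sum>k\<in>L. a k * F k y) = a l * ip (F l) (F l)" if l: "l \<in> L" for l a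
  proof -
    have "ip (F l) (\<lambda>y. \<Sum>k\<in>L. a k * F k y) = (\<Sum>k\<in>L. a k * ip (F l) (F k))"
      using Fb l by (intro ip_sum_right) auto
    also have "\<dots> = (\<Sum>k\<in>L. if k = l then a l * ip (F l) (F l) else 0)"
      using eigenspaces_orthogonal[OF F F] l by (intro sum.cong) auto
    finally show ?thesis using L l by simp
  qed
  have ip_f: "ip f (\<lambda>y. \<Sum>k\<in>L. a k * F k y) = (\<Sum>l\<in>L. a l * ip (F l) (F l))" for a
  proof -
    have "ip f (\<lambda>y. \<Sum>k\<in>L. a k * F k y) = (\<Sum>l\<in>L. 1 * ip (F l) (\<lambda>y. \<Sum>k\<in>L. a k * F k y))"
      unfolding f_def by (intro ip_sum_left Fb bdd_borel_sum)
    then show ?thesis by (simp add: F_ip)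
  qed
  have ff: "ip f f = (\<Sum>l\<in>L. ip (F l) (F l))" using ip_f[of "\<lambda>_. 1"] unfolding f_def[symmetric] by simp
  have fu: "ip f u = (\<Sum>l\<in>L. l * ip (F l) (F l))" using ip_f[of "\<lambda>l. l"] unfolding u_def[symmetric] .
  have "ip f u \<le> (\<Sum>l\<in>L. x * ip (F l) (F l))"
    unfolding fu using L by (intro sum_mono mult_right_mono ip_self_nonneg) auto
  then have "ip f u \<le> x * ip f f" by (simp add: ff sum_distrib_left)
  ultimately have "ip f f \<le> t * (x * ip f f)" using mult_left_mono[OF _ t(2)] order_trans by blast
  then have "(1 - t * x) * ip f f \<le> 0" by (simp add: algebra_simps)
  then have "ip f f = 0" using t ip_self_nonneg[of f] by (simp add: mult_le_0_iff)
  \<comment> \<open>Orthogonality across eigenvalues has split f into its components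
    \<open>F l\<close>, so linear independence is used only inside a single eigenspace.\<close>
  then have "\<forall>l\<in>L. ip (F l) (F l) = 0"
    using L(1) ip_self_nonneg by (simp add: ff sum_nonneg_eq_0_iff)
  then have F0: "F l = (\<lambda>y. 0)" if "l \<in> L" for l using eigenfunction_zeroI[OF F] that by blast
  from c(1) obtain l e where le: "l \<in> L" "e \<in> B l" "c (l, e) \<noteq> 0" by auto
  have "(\<Sum>e\<in>B l. fun_scale (c (l, e)) e) = 0"
    using F0[OF le(1)] sum_fun_scale_apply[of "\<lambda>e. c (l, e)" "\<lambda>e. e" "B l"]
    by (auto simp: F_def fun_eq_iff)
  then have "real_fun.dependent (B l)"
    unfolding real_fun.dependent_finite[OF B(2)[OF le(1)]] using le
    by (intro exI[of _ "\<lambda>e. c (l, e)"] conjI bexI[of _ e])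
  then show False using B(3)[OF le(1)] by simp
qed

text \<open>Excludes that the \<open>sum\<close> in \<open>eigenvalue_count\<close> is 0 by default.
  One eigenfunction for each of \<open>Suc (card P)\<close> eigenvalues already contradicts
  \<open>eigen_family_card_le\<close>.\<close>

lemma finite_eigenvalues:
  assumes P: "controls t P" and t: "t * x < 1" "0 \<le> t"
  shows "finite {l. is_eigenvalue \<nu> l \<and> l \<le> x}"
proof (rule ccontr)
  assume "infinite {l. is_eigenvalue \<nu> l \<and> l \<le> x}"
  then obtain L where L: "finite L" "card L = Suc (card P)" "L \<subseteq> {l. is_eigenvalue \<nu> l \<and> l \<le> x}"
    using infinite_arbitrarily_large by blast
  then have "\<forall>l\<in>L. \<exists>e. e \<in> eigenspace \<nu> l \<and> e \<noteq> 0"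
    by (auto simp: is_eigenvalue_def zero_fun_def)
  then obtain e where e: "\<And>l. l \<in> L \<Longrightarrow> e l \<in> eigenspace \<nu> l" "\<And>l. l \<in> L \<Longrightarrow> e l \<noteq> 0" by metis
  have "(\<Sum>l\<in>L. card {e l}) \<le> card P"
    using L e by (intro eigen_family_card_le[OF P t]) auto
  then show False using L by simp
qed

text \<open>An infinite basis would have \<open>card\<close> 0, so finiteness is what makes
  \<open>multiplicity\<close> the true dimension.\<close>

lemma eigenspace_finite_basis:
  assumes P: "controls t P" and t: "t * l < 1" "0 \<le> t"
  obtains B where "B \<subseteq> eigenspace \<nu> l" "finite B" "real_fun.independent B"
    "eigenspace \<nu> l \<subseteq> real_fun.span B" "card B = multiplicity \<nu> l"
proof -
  obtain B where B: "B \<subseteq> eigenspace \<nu> l" "real_fun.independent B"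
    "eigenspace \<nu> l \<subseteq> real_fun.span B" "card B = multiplicity \<nu> l"
    unfolding multiplicity_def using real_fun.basis_exists by blast
  have "finite B"
  proof (rule ccontr)
    assume "infinite B"
    then obtain C where C: "finite C" "card C = Suc (card P)" "C \<subseteq> B"
      using infinite_arbitrarily_large by blast
    have "(\<Sum>k\<in>{l}. card C) \<le> card P"
      using C B real_fun.independent_mono[OF B(2) C(3)]
      by (intro eigen_family_card_le[OF P t]) auto
    then show False using C by simp
  qed
  with B that show ?thesis by blast
qed

lemma eigenvalue_count_le:
  assumes P: "controls t P" and t: "t * x < 1" "0 \<le> t"
  shows "eigenvalue_count \<nu> x \<le> card P"
proof -
  have tl: "t * l < 1" if "l \<le> x" for l
    using t mult_left_mono[OF that t(2)] by simp
  have "\<exists>B. B \<subseteq> eigenspace \<nu> l \<and> finite B \<and> real_fun.independent B \<and> card B = multiplicity \<nu> l"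
    if "l \<le> x" for l
    using eigenspace_finite_basis[OF P tl[OF that] t(2)] by metis
  then obtain B where B: "\<And>l. l \<le> x \<Longrightarrow> B l \<subseteq> eigenspace \<nu> l" "\<And>l. l \<le> x \<Longrightarrow> finite (B l)"
    "\<And>l. l \<le> x \<Longrightarrow> real_fun.independent (B l)" "\<And>l. l \<le> x \<Longrightarrow> card (B l) = multiplicity \<nu> l"
    by metis
  have "eigenvalue_count \<nu> x = (\<Sum>l | is_eigenvalue \<nu> l \<and> l \<le> x. card (B l))"
    unfolding eigenvalue_count_def using B by (intro sum.cong) auto
  also have "\<dots> \<le> card P"
    using B by (intro eigen_family_card_le[OF P t] finite_eigenvalues[OF P t]) auto
  finally show ?thesis .
qed

text \<open>One half of the min-max principle. With fewer eigenfunctions than test functions, some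
  nonzero combination f of the latter is orthogonal to all of the former, and disjointness lets f
  inherit the bound on the Rayleigh quotient. Then \<open>exists_orthogonal_eigenfunction\<close>
  supplies an eigenfunction orthogonal to a spanning set of its own eigenspace. The hypothesis
  \<open>controls\<close> ensures that the count is genuine.\<close>

lemma eigenvalue_count_ge:
  assumes P: "controls t P" and t: "t * x < 1" "0 \<le> t" "0 < x"
    and K: "finite K" and \<phi>: "\<And>k. k \<in> K \<Longrightarrow> \<phi> k \<in> bdd_borel" "\<And>k. k \<in> K \<Longrightarrow> is_gradient (\<phi> k) (g k)"
      "\<And>k. k \<in> K \<Longrightarrow> \<phi> k 1 = 0"
    and orth: "\<And>j k y. j \<in> K \<Longrightarrow> k \<in> K \<Longrightarrow> j \<noteq> k \<Longrightarrow> \<phi> j y * \<phi> k y = 0"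
      "\<And>j k y. j \<in> K \<Longrightarrow> k \<in> K \<Longrightarrow> j \<noteq> k \<Longrightarrow> g j y * g k y = 0"
    and bound: "\<And>k. k \<in> K \<Longrightarrow> (LINT y|lborel. (g k y)\<^sup>2) \<le> x * ip (\<phi> k) (\<phi> k)"
      "\<And>k. k \<in> K \<Longrightarrow> ip (\<phi> k) (\<phi> k) > 0"
  shows "card K \<le> eigenvalue_count \<nu> x"
proof (rule ccontr)
  assume neg: "\<not> ?thesis"
  have tl: "t * l < 1" if "l \<le> x" for l
    using t mult_left_mono[OF that t(2)] by simp
  have "\<exists>B. B \<subseteq> eigenspace \<nu> l \<and> finite B \<and> eigenspace \<nu> l \<subseteq> real_fun.span B \<and> card B = multiplicity \<nu> l"
    if "l \<le> x" for l
    using eigenspace_finite_basis[OF P tl[OF that] t(2)] by metis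
  then obtain B where B: "\<And>l. l \<le> x \<Longrightarrow> B l \<subseteq> eigenspace \<nu> l" "\<And>l. l \<le> x \<Longrightarrow> finite (B l)"
    "\<And>l. l \<le> x \<Longrightarrow> eigenspace \<nu> l \<subseteq> real_fun.span (B l)" "\<And>l. l \<le> x \<Longrightarrow> card (B l) = multiplicity \<nu> l"
    by metis
  define L where "L = {l. is_eigenvalue \<nu> l \<and> l \<le> x}"
  have L: "finite L" unfolding L_def by (rule finite_eigenvalues[OF P t(1,2)])
  have "eigenvalue_count \<nu> x = (\<Sum>l\<in>L. card (B l))"
    unfolding eigenvalue_count_def L_def using B by (intro sum.cong) auto
  also have "\<dots> = card (Sigma L B)" using L B by (simp add: card_SigmaI L_def)
  finally have less: "card (Sigma L B) < card K" using neg by simp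
  have finS: "finite (Sigma L B)" using L B by (auto simp: L_def)
  have SB: "snd i \<in> bdd_borel" if "i \<in> Sigma L B" for i
    using that B(1) eigenspaceD(1) by (force simp: L_def)
  obtain c where c: "\<exists>k\<in>K. c k \<noteq> 0" "\<And>i. i \<in> Sigma L B \<Longrightarrow> (\<Sum>k\<in>K. c k * ip (\<phi> k) (snd i)) = 0"
    using homogeneous_system_nontrivial[OF finS K less, of "\<lambda>i k. ip (\<phi> k) (snd i)"] by blast
  define f h where "f = (\<lambda>y. \<Sum>k\<in>K. c k * \<phi> k y)" and "h = (\<lambda>y. \<Sum>k\<in>K. c k * g k y)"
  have fb: "f \<in> bdd_borel" unfolding f_def by (intro bdd_borel_sum \<phi>)
  \<comment> \<open>Mixed terms vanish at each point separately; this serves both the test functions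
    and their gradients.\<close>
  have diag: "(\<Sum>k\<in>K. c k * a k) * (\<Sum>k\<in>K. c k * a k) = (\<Sum>k\<in>K. (c k)\<^sup>2 * (a k)\<^sup>2)"
    if a: "\<And>j k. j \<in> K \<Longrightarrow> k \<in> K \<Longrightarrow> j \<noteq> k \<Longrightarrow> a j * a k = 0" for a :: "_ \<Rightarrow> real"
  proof -
    have "(\<Sum>k\<in>K. c k * a k) * (\<Sum>k\<in>K. c k * a k) = (\<Sum>j\<in>K. \<Sum>k\<in>K. (c j * a j) * (c k * a k))"
      by (rule sum_product)
    also have "\<dots> = (\<Sum>j\<in>K. \<Sum>k\<in>K. if k = j then (c j)\<^sup>2 * (a j)\<^sup>2 else 0)"
      using a by (intro sum.cong) (auto simp: power2_eq_square)
    also have "\<dots> = (\<Sum>k\<in>K. (c k)\<^sup>2 * (a k)\<^sup>2)" using K by (intro sum.cong) auto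
    finally show ?thesis .
  qed
  have ff: "ip f f = (\<Sum>k\<in>K. (c k)\<^sup>2 * ip (\<phi> k) (\<phi> k))"
  proof -
    have "f y * f y = (\<Sum>k\<in>K. (c k)\<^sup>2 * (\<phi> k y)\<^sup>2)" for y
      unfolding f_def by (rule diag) (rule orth)
    then have "ip f f = (LINT y|\<nu>. (\<Sum>k\<in>K. (c k)\<^sup>2 * (\<phi> k y * \<phi> k y)))"
      by (simp add: ip_def power2_eq_square)
    also have "\<dots> = (\<Sum>k\<in>K. (LINT y|\<nu>. (c k)\<^sup>2 * (\<phi> k y * \<phi> k y)))"
      by (intro Bochner_Integration.integral_sum integrable_bdd_borel bdd_borel_scale bdd_borel_mult \<phi>)
    finally show ?thesis by (simp add: ip_def)
  qed
  have hh: "(LINT y|lborel. (h y)\<^sup>2) = (\<Sum>k\<in>K. (c k)\<^sup>2 * (LINT y|lborel. (g k y)\<^sup>2))"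
    and hi: "integrable lborel (\<lambda>y. (h y)\<^sup>2)"
  proof -
    have e: "(h y)\<^sup>2 = (\<Sum>k\<in>K. (c k)\<^sup>2 * (g k y)\<^sup>2)" for y
      unfolding h_def power2_eq_square[of "sum _ _"] by (rule diag) (rule orth)
    have i: "integrable lborel (\<lambda>y. (c k)\<^sup>2 * (g k y)\<^sup>2)" if "k \<in> K" for k
      using is_gradientD(3)[OF \<phi>(2)[OF that]] by simp
    show "integrable lborel (\<lambda>y. (h y)\<^sup>2)" unfolding e using i by (rule Bochner_Integration.integrable_sum)
    show "(LINT y|lborel. (h y)\<^sup>2) = (\<Sum>k\<in>K. (c k)\<^sup>2 * (LINT y|lborel. (g k y)\<^sup>2))"
      unfolding e using i by (subst Bochner_Integration.integral_sum) auto
  qed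
  have grad: "is_gradient f h"
    unfolding is_gradient_def
  proof (intro conjI allI ballI impI hi)
    show "h \<in> borel_measurable borel"
      unfolding h_def by (intro borel_measurable_sum borel_measurable_times is_gradientD(1)[OF \<phi>(2)]) auto
    show "h y = 0" if "y \<notin> {0..1}" for y
      unfolding h_def using is_gradientD(4)[OF \<phi>(2) that] by simp
    fix y :: real assume y: "y \<in> {0..1}"
    have "(LINT s:{0..y}|lborel. h s) = (LINT s|lborel. (\<Sum>k\<in>K. c k * (indicator {0..y} s *\<^sub>R g k s)))"
      unfolding set_lebesgue_integral_def h_def by (simp add: sum_distrib_left algebra_simps)
    also have "\<dots> = (\<Sum>k\<in>K. (LINT s|lborel. c k * (indicator {0..y} s *\<^sub>R g k s)))"
      using set_integrable_of_integrable[OF is_gradientD(2)[OF \<phi>(2)], of _ "{0..y}"]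
      by (intro Bochner_Integration.integral_sum integrable_mult_right) (auto simp: set_integrable_def)
    also have "\<dots> = f y"
      unfolding f_def using is_gradientD(5)[OF \<phi>(2) y]
      by (intro sum.cong) (simp_all add: set_lebesgue_integral_def)
    finally show "f y = (LINT s:{0..y}|lborel. h s)" ..
  qed
  obtain k where k: "k \<in> K" "c k \<noteq> 0" using c(1) by blast
  have "(c k)\<^sup>2 * ip (\<phi> k) (\<phi> k) \<le> ip f f"
    unfolding ff using k K by (intro member_le_sum) (auto intro!: mult_nonneg_nonneg ip_self_nonneg)
  moreover have "0 < (c k)\<^sup>2 * ip (\<phi> k) (\<phi> k)" using k bound(2) by simp
  ultimately have pos: "ip f f > 0" by linarith
  have "(LINT y|lborel. (h y)\<^sup>2) \<le> (\<Sum>k\<in>K. (c k)\<^sup>2 * (x * ip (\<phi> k) (\<phi> k)))"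
    unfolding hh by (intro sum_mono mult_left_mono bound) auto
  also have "\<dots> = x * ip f f" unfolding ff by (simp add: sum_distrib_left algebra_simps)
  finally have hle: "(LINT y|lborel. (h y)\<^sup>2) \<le> x * ip f f" .
  have "(ip f f)\<^sup>2 \<le> ip (green_op f) f * (LINT y|lborel. (h y)\<^sup>2)"
    using \<phi>(3) by (intro ip_squared_le_gradient[OF fb grad] bdd_borelD[OF fb]) (simp add: f_def)
  also have "\<dots> \<le> ip (green_op f) f * (x * ip f f)"
    by (intro mult_left_mono hle ip_green_op_nonneg fb)
  finally have fx: "ip f f \<le> x * ip (green_op f) f"
    using pos by (simp add: power2_eq_square mult_ac)
  have "\<exists>l g. is_eigenvalue \<nu> l \<and> l \<le> x \<and> g \<in> eigenspace \<nu> l \<and> ip g g > 0 \<and> (\<forall>e\<in>snd ` Sigma L B. ip g e = 0)"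
  proof (rule exists_orthogonal_eigenfunction[OF _ fb pos _ fx t(3)])
    show "\<exists>l. e \<in> eigenspace \<nu> l" if e: "e \<in> snd ` Sigma L B" for e
    proof -
      obtain l where "l \<in> L" "e \<in> B l" using e by auto
      then show ?thesis using B(1)[of l] by (auto simp: L_def)
    qed
    show "ip f e = 0" if e: "e \<in> snd ` Sigma L B" for e
    proof -
      obtain i where i: "i \<in> Sigma L B" "e = snd i" using e by blast
      have "ip f e = (\<Sum>k\<in>K. c k * ip (\<phi> k) e)" unfolding f_def i
        by (intro ip_sum_left \<phi> SB i)
      then show ?thesis using c(2)[OF i(1)] i by simp
    qed
  qed
  then obtain l w where w: "is_eigenvalue \<nu> l" "l \<le> x" "w \<in> eigenspace \<nu> l" "ip w w > 0"
    "\<And>e. e \<in> snd ` Sigma L B \<Longrightarrow> ip w e = 0" by blast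
  have l: "l \<in> L" using w by (simp add: L_def)
  have Bl: "e \<in> bdd_borel" if "e \<in> B l" for e using SB[of "(l, e)"] that l by auto
  \<comment> \<open>w is a combination of functions to which it is orthogonal, so its norm is
    zero.\<close>
  have "w \<in> real_fun.span (B l)" using B(3)[OF w(2)] w(3) by blast
  then obtain a where "w = (\<Sum>e\<in>B l. fun_scale (a e) e)"
    using real_fun.span_finite[OF B(2)[OF w(2)]] by auto
  then have "w = (\<lambda>y. \<Sum>e\<in>B l. a e * e y)"
    using sum_fun_scale_apply[of a "\<lambda>e. e" "B l"] by (simp add: fun_eq_iff)
  then have "ip w w = (\<Sum>e\<in>B l. a e * ip w e)"
    using ip_sum_right[of "B l" "\<lambda>e. e" w a] Bl eigenspaceD(1)[OF w(3)] by simp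
  also have "\<dots> = 0" using w(5) l by (intro sum.neutral) (force intro!: image_eqI)
  finally show False using w(4) by simp
qed

end

subsection \<open>Dyadic cells and the upper bound\<close>

lemma is_gradient_increment:
  assumes f: "is_gradient f g" and ab: "0 \<le> a" "a \<le> x" "x \<le> 1"
  shows "f x - f a = (LINT s|lborel. indicator {a<..x} s * g s)"
proof -
  have i: "integrable lborel (\<lambda>s. indicator A s * g s)" if "A \<in> sets borel" for A
    using set_integrable_of_integrable[OF is_gradientD(2)[OF f] that] by (simp add: set_integrable_def)
  have "f x - f a = (LINT s|lborel. indicator {0..x} s * g s) - (LINT s|lborel. indicator {0..a} s * g s)"
    using is_gradientD(5)[OF f, of x] is_gradientD(5)[OF f, of a] ab by (simp add: set_lebesgue_integral_def)
  also have "\<dots> = (LINT s|lborel. indicator {0..x} s * g s - indicator {0..a} s * g s)"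
    using i by (intro Bochner_Integration.integral_diff[symmetric]) auto
  also have "\<dots> = (LINT s|lborel. indicator {a<..x} s * g s)"
    using ab by (intro Bochner_Integration.integral_cong) (auto simp: indicator_def)
  finally show ?thesis .
qed

text \<open>Cauchy-Schwarz for the increment from a zero at the left endpoint. A single zero per
  cell suffices, so a subdivision costs just the midpoint, the left end of the right half.\<close>

lemma is_gradient_squared_le:
  assumes f: "is_gradient f g" and a: "0 \<le> a" "f a = 0" and x: "a < x" "x \<le> b" "b \<le> 1"
  shows "(f x)\<^sup>2 \<le> (b - a) * (LINT s|lborel. indicator {a<..b} s * (g s)\<^sup>2)"
proof -
  let ?i = "\<lambda>c s. indicat_real {a<..c} s"
  note [measurable] = is_gradientD(1)[OF f]
  have i: "integrable lborel (\<lambda>s. ?i c s * (g s)\<^sup>2)" for c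
    using set_integrable_of_integrable[OF is_gradientD(3)[OF f], of "{a<..c}"] by (simp add: set_integrable_def)
  have sq: "(?i x s)\<^sup>2 = ?i x s" for s by (simp add: indicator_def)
  have i1: "integrable lborel (\<lambda>s. (?i x s)\<^sup>2)" unfolding sq using x by (simp add: integrable_real_indicator)
  have "f x = (LINT s|lborel. ?i x s * g s)"
    using is_gradient_increment[OF f a(1), of x] a x by simp
  then have "(f x)\<^sup>2 = (LINT s|lborel. ?i x s * (?i x s * g s))\<^sup>2" by (simp add: mult.assoc[symmetric] sq flip: power2_eq_square)
  also have "\<dots> \<le> (LINT s|lborel. (?i x s)\<^sup>2) * (LINT s|lborel. (?i x s * g s)\<^sup>2)"
    using i1 i[of x] by (intro integral_mult_squared_le integrable_mult_of_squares) (auto simp: power_mult_distrib sq)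
  also have "(LINT s|lborel. (?i x s)\<^sup>2) = x - a" unfolding sq using x by simp
  also have "(LINT s|lborel. (?i x s * g s)\<^sup>2) = (LINT s|lborel. ?i x s * (g s)\<^sup>2)"
    by (simp add: power_mult_distrib sq)
  also have "(x - a) * \<dots> \<le> (b - a) * (LINT s|lborel. ?i b s * (g s)\<^sup>2)"
  proof (rule mult_mono)
    show "(LINT s|lborel. ?i x s * (g s)\<^sup>2) \<le> (LINT s|lborel. ?i b s * (g s)\<^sup>2)"
      using x by (intro integral_mono i) (auto simp: indicator_def)
  qed (use x in auto)
  finally show ?thesis .
qed

lemma dyadic_interval_measurable [measurable, simp]: "dyadic_interval n k \<in> sets borel"
  by (simp add: dyadic_interval_def)

lemma dyadic_interval_split:
  "dyadic_interval n k = dyadic_interval (Suc n) (2 * k) \<union> dyadic_interval (Suc n) (2 * k + 1)"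
  "dyadic_interval (Suc n) (2 * k) \<inter> dyadic_interval (Suc n) (2 * k + 1) = {}"
proof -
  have e: "real k / 2 ^ n = real (2 * k) / 2 ^ Suc n" "(real k + 1) / 2 ^ n = (real (2 * k + 1) + 1) / 2 ^ Suc n"
    "(real (2 * k) + 1) / 2 ^ Suc n = real (2 * k + 1) / 2 ^ Suc n"
    by (simp_all add: field_simps)
  have l: "real (2 * k) / 2 ^ Suc n \<le> real (2 * k + 1) / 2 ^ Suc n"
    "real (2 * k + 1) / 2 ^ Suc n \<le> (real (2 * k + 1) + 1) / 2 ^ Suc n"
    by (intro divide_right_mono; simp)+
  show "dyadic_interval n k = dyadic_interval (Suc n) (2 * k) \<union> dyadic_interval (Suc n) (2 * k + 1)"
    unfolding dyadic_interval_def e using l by (intro ivl_disj_un_two(6)[symmetric])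
  show "dyadic_interval (Suc n) (2 * k) \<inter> dyadic_interval (Suc n) (2 * k + 1) = {}"
    unfolding dyadic_interval_def e by auto
qed

lemma indicator_dyadic_split:
  "indicator (dyadic_interval n k) s =
    (indicator (dyadic_interval (Suc n) (2 * k)) s + indicator (dyadic_interval (Suc n) (2 * k + 1)) s :: real)"
  using dyadic_interval_split[of n k] by (metis indicator_add)

lemma sum_lessThan_double:
  fixes f :: "nat \<Rightarrow> 'a::comm_monoid_add"
  shows "(\<Sum>k<2 * m. f k) = (\<Sum>k<m. f (2 * k) + f (2 * k + 1))"
  by (induction m) (simp_all add: add_ac)

section \<open>Subdivision at heavy cells\<close>

context string_measure
begin

definition cell_mass :: "nat \<Rightarrow> nat \<Rightarrow> real" where
  "cell_mass n k = measure \<nu> (dyadic_interval n k)"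

lemma cell_mass_nonneg: "0 \<le> cell_mass n k"
  by (simp add: cell_mass_def)

lemma cell_mass_le: "cell_mass n k \<le> mass"
  unfolding cell_mass_def by (intro finite_measure_mono) auto

lemma sum_cell_mass: "(\<Sum>k<2 ^ n. cell_mass n k) = mass"
proof (induction n)
  case 0
  have "measure \<nu> {0<..1} = measure \<nu> UNIV"
  proof (rule measure_eq_AE)
    show "AE y in \<nu>. y \<in> {0<..1} \<longleftrightarrow> y \<in> UNIV" using AE_inside by eventually_elim simp
  qed auto
  then show ?case by (simp add: cell_mass_def dyadic_interval_def)
next
  case (Suc n)
  have "cell_mass n k = cell_mass (Suc n) (2 * k) + cell_mass (Suc n) (2 * k + 1)" for k
    unfolding cell_mass_def dyadic_interval_split(1)[of n k]
    by (intro finite_measure_Union dyadic_interval_split(2)) auto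
  then show ?case using Suc by (simp add: sum_lessThan_double flip: One_nat_def)
qed

text \<open>On a cell that starts with a zero of f, mass times length bounds the \<nu>-integral of
  the square of f in terms of its energy. Heavy cells are those where this factor exceeds the target
  t.\<close>

definition heavy :: "real \<Rightarrow> nat \<Rightarrow> nat set" where
  "heavy t n = {k. k < 2 ^ n \<and> t < cell_mass n k / 2 ^ n}"

text \<open>Levels below \<open>L\<close> suffice once \<open>mass / 2 ^ L \<le> t\<close>, since no
  cell of level \<open>L\<close> is then heavy.\<close>

definition heavy_midpoints :: "real \<Rightarrow> nat \<Rightarrow> real set" where
  "heavy_midpoints t L = (\<Union>n<L. (\<lambda>k. real (2 * k + 1) / 2 ^ Suc n) ` heavy t n)"

lemma finite_heavy: "finite (heavy t n)"
  by (rule finite_subset[of _ "{..<2 ^ n}"]) (auto simp: heavy_def)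

lemma card_heavy_midpoints_le: "card (heavy_midpoints t L) \<le> (\<Sum>n<L. card (heavy t n))"
proof -
  have "card (heavy_midpoints t L) \<le> (\<Sum>n<L. card ((\<lambda>k. real (2 * k + 1) / 2 ^ Suc n) ` heavy t n))"
    unfolding heavy_midpoints_def by (rule card_UN_le) simp
  also have "\<dots> \<le> (\<Sum>n<L. card (heavy t n))"
    by (intro sum_mono card_image_le finite_heavy)
  finally show ?thesis .
qed

lemma light_cell_integral_le:
  assumes f: "f \<in> bdd_borel" "is_gradient f g" and k: "k < 2 ^ n" "f (real k / 2 ^ n) = 0"
    and light: "cell_mass n k / 2 ^ n \<le> t"
  shows "(LINT y|\<nu>. indicator (dyadic_interval n k) y * (f y)\<^sup>2)
    \<le> t * (LINT s|lborel. indicator (dyadic_interval n k) s * (g s)\<^sup>2)"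
proof -
  let ?G = "LINT s|lborel. indicator (dyadic_interval n k) s * (g s)\<^sup>2"
  have G: "0 \<le> ?G" by (intro Bochner_Integration.integral_nonneg) simp
  have k1: "(real k + 1) / 2 ^ n \<le> 1"
  proof -
    have "real (Suc k) \<le> real (2 ^ n)" using k(1) by (intro of_nat_mono) simp
    then show ?thesis by simp
  qed
  have w: "(real k + 1) / 2 ^ n - real k / 2 ^ n = 1 / 2 ^ n" by (simp add: field_simps)
  have "(LINT y|\<nu>. indicator (dyadic_interval n k) y * (f y)\<^sup>2)
      \<le> (LINT y|\<nu>. indicator (dyadic_interval n k) y * (1 / 2 ^ n * ?G))"
  proof (rule integral_mono)
    show "integrable \<nu> (\<lambda>y. indicator (dyadic_interval n k) y * (f y)\<^sup>2)"
      unfolding power2_eq_square using f(1)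
      by (intro integrable_bdd_borel bdd_borel_mult bdd_borel_indicator) auto
    fix y
    show "indicator (dyadic_interval n k) y * (f y)\<^sup>2 \<le> indicator (dyadic_interval n k) y * (1 / 2 ^ n * ?G)"
    proof (cases "y \<in> dyadic_interval n k")
      case True
      then have "(f y)\<^sup>2 \<le> ((real k + 1) / 2 ^ n - real k / 2 ^ n) * ?G"
        unfolding dyadic_interval_def
        by (intro is_gradient_squared_le[OF f(2) _ k(2)] k1) auto
      then show ?thesis using True by (simp add: w)
    qed simp
  qed (intro integrable_mult_left integrable_real_indicator; simp add: emeasure_eq_measure)
  also have "\<dots> = cell_mass n k / 2 ^ n * ?G" by (simp add: cell_mass_def)
  also have "\<dots> \<le> t * ?G" by (intro mult_right_mono light G)
  finally show ?thesis .
qed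

text \<open>Induction from level \<open>L\<close> upwards to coarser cells. A light cell is settled
  by itself; a heavy one is split at its midpoint, a zero of f, so both halves start with a zero and
  their estimates add up.\<close>

lemma cell_integral_le:
  assumes f: "f \<in> bdd_borel" "is_gradient f g"
    and mid: "\<And>p. p \<in> heavy_midpoints t L \<Longrightarrow> f p = 0" and L: "mass / 2 ^ L \<le> t"
    and k: "k < 2 ^ n" "f (real k / 2 ^ n) = 0" and n: "n \<le> L"
  shows "(LINT y|\<nu>. indicator (dyadic_interval n k) y * (f y)\<^sup>2)
    \<le> t * (LINT s|lborel. indicator (dyadic_interval n k) s * (g s)\<^sup>2)"
  using n k
proof (induction n arbitrary: k rule: inc_induct)
  case base
  have "cell_mass L k / 2 ^ L \<le> t"
    using L divide_right_mono[OF cell_mass_le[of L k], of "2 ^ L"] by simp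
  then show ?case using base by (intro light_cell_integral_le f) auto
next
  case (step n)
  show ?case
  proof (cases "k \<in> heavy t n")
    case False
    then show ?thesis using step.prems by (intro light_cell_integral_le f) (auto simp: heavy_def)
  next
    case True
    let ?A = "dyadic_interval (Suc n) (2 * k)" and ?B = "dyadic_interval (Suc n) (2 * k + 1)"
    have i: "integrable \<nu> (\<lambda>y. indicator A y * (f y)\<^sup>2)" if "A \<in> sets borel" for A
      unfolding power2_eq_square using f(1) that
      by (intro integrable_bdd_borel bdd_borel_mult bdd_borel_indicator) auto
    have j: "integrable lborel (\<lambda>s. indicator A s * (g s)\<^sup>2)" if "A \<in> sets borel" for A
      using set_integrable_of_integrable[OF is_gradientD(3)[OF f(2)] that] by (simp add: set_integrable_def)
    have "f (real (2 * k + 1) / 2 ^ Suc n) = 0"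
      using True step.hyps by (intro mid) (auto simp: heavy_midpoints_def)
    moreover have "f (real (2 * k) / 2 ^ Suc n) = 0" using step.prems(2) by simp
    ultimately have "(LINT y|\<nu>. indicator ?A y * (f y)\<^sup>2) \<le> t * (LINT s|lborel. indicator ?A s * (g s)\<^sup>2)"
      "(LINT y|\<nu>. indicator ?B y * (f y)\<^sup>2) \<le> t * (LINT s|lborel. indicator ?B s * (g s)\<^sup>2)"
      using step.prems(1) by (intro step.IH; simp)+
    moreover have "(LINT y|\<nu>. indicator (dyadic_interval n k) y * (f y)\<^sup>2)
        = (LINT y|\<nu>. indicator ?A y * (f y)\<^sup>2) + (LINT y|\<nu>. indicator ?B y * (f y)\<^sup>2)"
      unfolding indicator_dyadic_split[of n k] distrib_right by (intro Bochner_Integration.integral_add i) auto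
    moreover have "(LINT s|lborel. indicator (dyadic_interval n k) s * (g s)\<^sup>2)
        = (LINT s|lborel. indicator ?A s * (g s)\<^sup>2) + (LINT s|lborel. indicator ?B s * (g s)\<^sup>2)"
      unfolding indicator_dyadic_split[of n k] distrib_right by (intro Bochner_Integration.integral_add j) auto
    ultimately show ?thesis by (simp add: distrib_left)
  qed
qed

lemma controls_heavy_midpoints:
  assumes L: "mass / 2 ^ L \<le> t" shows "controls t (heavy_midpoints t L)"
  unfolding controls_def
proof (intro conjI ballI impI)
  show "finite (heavy_midpoints t L)" by (auto simp: heavy_midpoints_def finite_heavy)
  fix u assume u: "u \<in> bdd_borel" and z: "\<forall>p\<in>heavy_midpoints t L. green_op u p = 0"
  let ?g = "\<lambda>s. indicator {0..1} s * green_grad u s"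
  have t: "0 \<le> t" using L by (meson divide_nonneg_nonneg measure_nonneg order_trans zero_le_numeral zero_le_power)
  have "ip (green_op u) (green_op u) = (LINT y|\<nu>. indicator (dyadic_interval 0 0) y * (green_op u y)\<^sup>2)"
    unfolding ip_def
  proof (rule integral_cong_AE)
    show "AE y in \<nu>. green_op u y * green_op u y = indicator (dyadic_interval 0 0) y * (green_op u y)\<^sup>2"
      using AE_inside by eventually_elim (simp add: dyadic_interval_def power2_eq_square)
  qed (use bdd_borelD[OF green_op_bdd_borel[OF u]] in measurable)
  also have "\<dots> \<le> t * (LINT s|lborel. indicator (dyadic_interval 0 0) s * (?g s)\<^sup>2)"
    using z by (intro cell_integral_le[OF green_op_bdd_borel[OF u] green_op_is_gradient[OF u] _ L]) auto
  also have "\<dots> \<le> t * (LINT s|lborel. (?g s)\<^sup>2)"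
  proof (intro mult_left_mono t integral_mono)
    show sq: "integrable lborel (\<lambda>s. (?g s)\<^sup>2)" by (rule is_gradientD(3)[OF green_op_is_gradient[OF u]])
    show "integrable lborel (\<lambda>s. indicator (dyadic_interval 0 0) s * (?g s)\<^sup>2)"
      using set_integrable_of_integrable[OF sq, of "dyadic_interval 0 0"] by (simp add: set_integrable_def)
  qed (simp add: indicator_def)
  also have "(LINT s|lborel. (?g s)\<^sup>2) = ip (green_op u) u"
    using integral_green_grad_green_grad[OF u u] by (simp add: power2_eq_square ip_commute)
  finally show "ip (green_op u) (green_op u) \<le> t * ip (green_op u) u" .
qed

text \<open>Cells of mass zero contribute nothing even for q = 0, because
  \<open>0 powr q = 0\<close>; so this agrees with the sum over \<open>dyadic_cells\<close>.\<close>

definition partition_sum :: "nat \<Rightarrow> real \<Rightarrow> real" where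
  "partition_sum n q = (\<Sum>k<2 ^ n. cell_mass n k powr q)"

lemma card_heavy_le:
  assumes t: "t > 0" and q: "q \<ge> 0"
  shows "real (card (heavy t n)) \<le> partition_sum n q / (t * 2 ^ n) powr q"
proof -
  have "real (card (heavy t n)) = (\<Sum>k\<in>heavy t n. 1)" by simp
  also have "\<dots> \<le> (\<Sum>k\<in>heavy t n. cell_mass n k powr q / (t * 2 ^ n) powr q)"
  proof (rule sum_mono)
    fix k assume "k \<in> heavy t n"
    then have "t * 2 ^ n \<le> cell_mass n k" by (simp add: heavy_def pos_less_divide_eq)
    then have "(t * 2 ^ n) powr q \<le> cell_mass n k powr q" using t q by (intro powr_mono2) auto
    then show "1 \<le> cell_mass n k powr q / (t * 2 ^ n) powr q" using t by simp
  qed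
  also have "\<dots> \<le> (\<Sum>k<2 ^ n. cell_mass n k powr q / (t * 2 ^ n) powr q)"
    by (intro sum_mono2) (auto simp: heavy_def)
  finally show ?thesis by (simp add: partition_sum_def sum_divide_distrib)
qed

text \<open>For t = 1/(2x) only about log x levels matter, and each has at most C (2x)^q heavy cells
  because the powers of 2^n cancel in Markov's bound. The logarithm does not affect the
  exponent.\<close>

lemma upper_spectral_dim_le:
  assumes q: "q \<ge> 0" and C: "\<And>n. partition_sum n q \<le> C * (2 ^ n) powr q" and mass: "mass > 0"
  shows "upper_spectral_dim \<nu> \<le> ereal q"
proof -
  have C0: "C > 0"
  proof -
    have "partition_sum 0 q = mass powr q"
      using sum_cell_mass[of 0] by (simp add: partition_sum_def)
    then show ?thesis using C[of 0] mass by (simp add: order_less_le_trans[of 0 "mass powr q"])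
  qed
  define F where "F = (\<lambda>x::real. (log 2 (2 * x * mass) + 1) * (C * (2 * x) powr q))"
  have count: "real (eigenvalue_count \<nu> x) \<le> F x" if x: "x > 0" "2 * x * mass \<ge> 1" for x
  proof -
    \<comment> \<open>The factor 2 secures the strict inequality \<open>t * x < 1\<close>.\<close>
    define t where "t = 1 / (2 * x)"
    define L where "L = nat \<lceil>log 2 (2 * x * mass)\<rceil>"
    have t: "t > 0" using x by (simp add: t_def)
    have l0: "log 2 (2 * x * mass) \<ge> 0" using x by simp
    have L1: "log 2 (2 * x * mass) \<le> real L" "real L \<le> log 2 (2 * x * mass) + 1"
      unfolding L_def using l0 by linarith+
    have "2 * x * mass \<le> 2 powr (real L)" using L1(1) x mass by (simp add: log_le_iff)
    then have "2 * x * mass \<le> 2 ^ L" by (simp add: powr_realpow)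
    then have "mass / 2 ^ L \<le> t" using x by (simp add: t_def field_simps)
    then have "eigenvalue_count \<nu> x \<le> card (heavy_midpoints t L)"
      using x by (intro eigenvalue_count_le[OF controls_heavy_midpoints]) (auto simp: t_def)
    also have "\<dots> \<le> (\<Sum>n<L. card (heavy t n))" by (rule card_heavy_midpoints_le)
    finally have "real (eigenvalue_count \<nu> x) \<le> (\<Sum>n<L. real (card (heavy t n)))"
      using of_nat_mono by fastforce
    also have "\<dots> \<le> (\<Sum>n<L. C * (2 * x) powr q)"
    proof (rule sum_mono)
      fix n
      have "real (card (heavy t n)) \<le> partition_sum n q / (t * 2 ^ n) powr q" by (rule card_heavy_le[OF t q])
      also have "\<dots> \<le> (C * (2 ^ n) powr q) / (t * 2 ^ n) powr q" by (intro divide_right_mono C) simp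
      also have "\<dots> = C / t powr q" using t by (simp add: powr_mult)
      also have "\<dots> = C * (2 * x) powr q" using x by (simp add: t_def powr_divide powr_mult)
      finally show "real (card (heavy t n)) \<le> C * (2 * x) powr q" .
    qed
    also have "\<dots> = real L * (C * (2 * x) powr q)" by simp
    also have "\<dots> \<le> F x" unfolding F_def using C0 by (intro mult_right_mono L1) auto
    finally show ?thesis .
  qed
  have ev: "\<forall>\<^sub>F x in at_top. x > 1 \<and> 2 * x * mass \<ge> 1 \<and> F x \<ge> 1"
  proof (intro eventually_conj)
    show "\<forall>\<^sub>F x in at_top. x > (1::real)" by (rule eventually_gt_at_top)
    show "\<forall>\<^sub>F x in at_top. 2 * x * mass \<ge> 1" using mass by real_asymp
    show "\<forall>\<^sub>F x in at_top. F x \<ge> 1"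
    proof (cases "q = 0")
      case True
      have "\<forall>\<^sub>F x in at_top. 1 \<le> (log 2 (2 * x * mass) + 1) * C" using mass C0 by real_asymp
      then show ?thesis using eventually_gt_at_top[of 0]
        unfolding F_def True by eventually_elim simp
    next
      case False
      then have "q > 0" using q by simp
      then show ?thesis unfolding F_def using mass C0 by real_asymp
    qed
  qed
  have "\<forall>\<^sub>F x in at_top. ereal (ln (real (eigenvalue_count \<nu> x)) / ln x) \<le> ereal (ln (F x) / ln x)"
    using ev
  proof eventually_elim
    case (elim x)
    have "ln (real (eigenvalue_count \<nu> x)) \<le> ln (F x)"
    \<comment> \<open>A zero count is covered by \<open>ln 0 = 0\<close> together with
      \<open>F x \<ge> 1\<close>.\<close>
    proof (cases "eigenvalue_count \<nu> x = 0")
      case False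
      then show ?thesis using count[of x] elim by (intro ln_mono) auto
    qed (use elim in simp)
    then show ?case using elim by (simp add: divide_right_mono)
  qed
  then have "upper_spectral_dim \<nu> \<le> Limsup at_top (\<lambda>x. ereal (ln (F x) / ln x))"
    unfolding upper_spectral_dim_def by (rule Limsup_mono)
  also have "((\<lambda>x. ln (F x) / ln x) \<longlongrightarrow> q) at_top"
    unfolding F_def using mass C0 by real_asymp
  then have "Limsup at_top (\<lambda>x. ereal (ln (F x) / ln x)) = ereal q"
    by (intro lim_imp_Limsup) auto
  finally show ?thesis .
qed

end

subsection \<open>Tents and the lower bound\<close>

text \<open>A trapezoid over three consecutive intervals of length h: it rises on the first, equals
  1 on the second and falls on the third. As a difference of two clipped ramps it displays its own
  derivative.\<close>

definition tent :: "real \<Rightarrow> real \<Rightarrow> real \<Rightarrow> real" where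
  "tent h c x = (max 0 (min h (x - c)) - max 0 (min h (x - (c + 2 * h)))) / h"

definition tent_deriv :: "real \<Rightarrow> real \<Rightarrow> real \<Rightarrow> real" where
  "tent_deriv h c s = (indicator {c<..c + h} s - indicator {c + 2 * h<..c + 3 * h} s) / h"

lemma tent_bdd_borel: "h > 0 \<Longrightarrow> tent h c \<in> bdd_borel"
proof (rule bdd_borelI)
  show "tent h c \<in> borel_measurable borel" unfolding tent_def by measurable
  show "\<bar>tent h c x\<bar> \<le> 1" if "h > 0" for x
    using that by (auto simp: tent_def abs_le_iff pos_divide_le_eq minus_divide_left)
qed

lemma tent_eq_1: "h > 0 \<Longrightarrow> c + h \<le> x \<Longrightarrow> x \<le> c + 2 * h \<Longrightarrow> tent h c x = 1"
  by (auto simp: tent_def)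

lemma tent_eq_0: "h > 0 \<Longrightarrow> x \<le> c \<or> c + 3 * h \<le> x \<Longrightarrow> tent h c x = 0"
  by (auto simp: tent_def)

lemma tent_deriv_eq_0: "h > 0 \<Longrightarrow> s \<le> c \<or> c + 3 * h < s \<Longrightarrow> tent_deriv h c s = 0"
  by (auto simp: tent_deriv_def)

lemma tent_deriv_squared:
  "h > 0 \<Longrightarrow> (tent_deriv h c s)\<^sup>2 = (indicator {c<..c + h} s + indicator {c + 2 * h<..c + 3 * h} s) / h\<^sup>2"
  by (auto simp: tent_deriv_def power_divide indicator_def)

lemma integral_tent_deriv_squared:
  assumes h: "h > 0"
  shows "(LINT s|lborel. (tent_deriv h c s)\<^sup>2) = 2 / h"
proof -
  have "(LINT s|lborel. (tent_deriv h c s)\<^sup>2) = (h + h) / h\<^sup>2"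
    unfolding tent_deriv_squared[OF h] using h by (simp add: integrable_real_indicator)
  then show ?thesis using h by (simp add: power2_eq_square)
qed

lemma tent_is_gradient:
  assumes h: "h > 0" and c: "0 \<le> c" "c + 3 * h \<le> 1"
  shows "is_gradient (tent h c) (tent_deriv h c)"
  unfolding is_gradient_def
proof (intro conjI allI ballI impI)
  show "tent_deriv h c \<in> borel_measurable borel" unfolding tent_deriv_def by measurable
  show "integrable lborel (\<lambda>s. (tent_deriv h c s)\<^sup>2)"
    using h by (simp add: tent_deriv_squared integrable_real_indicator)
  show "tent_deriv h c s = 0" if "s \<notin> {0..1}" for s
    using that h c by (intro tent_deriv_eq_0) auto
  fix x :: real assume x: "x \<in> {0..1}"
  have e: "indicator {0..x} s *\<^sub>R tent_deriv h c s
      = (indicator {c<..min x (c + h)} s - indicator {c + 2 * h<..min x (c + 3 * h)} s) / h" for s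
    using c h by (auto simp: tent_deriv_def indicator_def)
  have m: "measure lborel {a<..b} = max 0 (b - a)" for a b :: real
    by (cases "a \<le> b") auto
  have i: "integrable lborel (indicator {a<..b} :: real \<Rightarrow> real)" for a b
    by (cases "a \<le> b") (auto intro!: integrable_real_indicator)
  have "(LINT s:{0..x}|lborel. tent_deriv h c s) = (max 0 (min x (c + h) - c) - max 0 (min x (c + 3 * h) - (c + 2 * h))) / h"
    unfolding set_lebesgue_integral_def e using i by (simp add: m)
  also have "\<dots> = tent h c x" unfolding tent_def by (auto simp: min_def max_def)
  finally show "tent h c x = (LINT s:{0..x}|lborel. tent_deriv h c s)" ..
qed

context string_measure
begin

text \<open>The trapezoid that is 1 on a cell of mass at least \<theta> has energy
  \<open>2 * 2 ^ n\<close> and squared norm at least \<theta>. It also occupies both neighbours, so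
  the indices are sorted by residue modulo 3 to make supports disjoint, and the two outermost cells
  are left out. Hence the 3 and the 2.\<close>

lemma eigenvalue_count_ge_cells:
  assumes \<theta>: "\<theta> > 0" "2 * 2 ^ n \<le> x * \<theta>"
  shows "card {k. k < 2 ^ n \<and> \<theta> \<le> cell_mass n k} \<le> 3 * eigenvalue_count \<nu> x + 2"
proof -
  have x: "x > 0"
  proof -
    have "0 < x * \<theta>" using \<theta>(2) by (rule less_le_trans[rotated]) simp
    then show ?thesis using \<theta>(1) by (simp add: zero_less_mult_iff)
  qed
  define M where "M = {k. k < 2 ^ n \<and> \<theta> \<le> cell_mass n k}"
  define R where "R = (\<lambda>r. {k \<in> M. 1 \<le> k \<and> k + 2 \<le> 2 ^ n \<and> k mod 3 = r})"
  have finM: "finite M" by (rule finite_subset[of _ "{..<2 ^ n}"]) (auto simp: M_def)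
  \<comment> \<open>A level deep enough for \<open>controls\<close> with t = 1/(2x), which makes the
    count meaningful.\<close>
  have "\<exists>L. mass / 2 ^ L \<le> 1 / (2 * x)"
  proof -
    obtain L where "mass * (2 * x) < 2 ^ L" using real_arch_pow[of 2] by auto
    then show ?thesis using x by (intro exI[of _ L]) (simp add: field_simps)
  qed
  then obtain L where L: "mass / 2 ^ L \<le> 1 / (2 * x)" by blast
  note ctrl = controls_heavy_midpoints[OF L]
  define h :: real where "h = 1 / 2 ^ n"
  have h: "h > 0" by (simp add: h_def)
  \<comment> \<open>The support starts one cell to the left of cell k; the subtraction is real, and
    \<open>1 \<le> k\<close> keeps the result nonnegative.\<close>
  define c where "c = (\<lambda>k. (real k - 1) * h)"
  have R_le: "card (R r) \<le> eigenvalue_count \<nu> x" for r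
  proof (rule eigenvalue_count_ge[OF ctrl, where \<phi> = "\<lambda>k. tent h (c k)" and g = "\<lambda>k. tent_deriv h (c k)"])
    show "finite (R r)" using finM by (simp add: R_def)
    show "1 / (2 * x) * x < 1" "0 \<le> 1 / (2 * x)" "0 < x" using x by auto
    have sep: "c j + 3 * h \<le> c k \<or> c k + 3 * h \<le> c j" if "j \<in> R r" "k \<in> R r" "j \<noteq> k" for j k
    proof -
      have "j mod 3 = k mod 3" using that by (simp add: R_def)
      then have "j + 3 \<le> k \<or> k + 3 \<le> j" using that(3) by presburger
      then have "real j + 3 \<le> real k \<or> real k + 3 \<le> real j" by linarith
      then show ?thesis
      proof
        assume "real j + 3 \<le> real k"
        then have "(real j + 2) * h \<le> (real k - 1) * h" using h by (intro mult_right_mono) auto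
        then show ?thesis by (simp add: c_def algebra_simps)
      next
        assume "real k + 3 \<le> real j"
        then have "(real k + 2) * h \<le> (real j - 1) * h" using h by (intro mult_right_mono) auto
        then show ?thesis by (simp add: c_def algebra_simps)
      qed
    qed
    show "tent h (c j) y * tent h (c k) y = 0" if "j \<in> R r" "k \<in> R r" "j \<noteq> k" for j k y
    proof -
      have "(y \<le> c j \<or> c j + 3 * h \<le> y) \<or> (y \<le> c k \<or> c k + 3 * h \<le> y)"
        using sep[OF that] by linarith
      then show ?thesis using tent_eq_0[OF h] by auto
    qed
    show "tent_deriv h (c j) y * tent_deriv h (c k) y = 0" if "j \<in> R r" "k \<in> R r" "j \<noteq> k" for j k y
    proof -
      have "(y \<le> c j \<or> c j + 3 * h < y) \<or> (y \<le> c k \<or> c k + 3 * h < y)"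
        using sep[OF that] by linarith
      then show ?thesis using tent_deriv_eq_0[OF h] by auto
    qed
    fix k assume k: "k \<in> R r"
    have ck: "0 \<le> c k" "c k + 3 * h \<le> 1"
    proof -
      show "0 \<le> c k" using k h by (simp add: c_def R_def)
      have "real (k + 2) \<le> real (2 ^ n)" using k by (intro of_nat_mono) (simp add: R_def)
      then have "(real k + 2) * h \<le> 2 ^ n * h" using h by (intro mult_right_mono) auto
      moreover have "2 ^ n * h = 1" by (simp add: h_def)
      moreover have "c k + 3 * h = (real k + 2) * h" by (simp add: c_def algebra_simps)
      ultimately show "c k + 3 * h \<le> 1" by simp
    qed
    show "tent h (c k) \<in> bdd_borel" by (rule tent_bdd_borel[OF h])
    show "is_gradient (tent h (c k)) (tent_deriv h (c k))" by (rule tent_is_gradient[OF h ck])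
    show "tent h (c k) 1 = 0" using ck by (intro tent_eq_0 h) auto
    have "cell_mass n k = (LINT y|\<nu>. indicator (dyadic_interval n k) y)" by (simp add: cell_mass_def)
    also have "\<dots> \<le> ip (tent h (c k)) (tent h (c k))"
      unfolding ip_def
    proof (rule integral_mono)
      show "integrable \<nu> (indicat_real (dyadic_interval n k))"
        "integrable \<nu> (\<lambda>y. tent h (c k) y * tent h (c k) y)"
        by (intro integrable_bdd_borel bdd_borel_mult bdd_borel_indicator tent_bdd_borel h; simp)+
      show "indicat_real (dyadic_interval n k) y \<le> tent h (c k) y * tent h (c k) y" for y
      proof (cases "y \<in> dyadic_interval n k")
        case True
        moreover have "c k + h = real k / 2 ^ n" "c k + 2 * h = (real k + 1) / 2 ^ n"
          by (simp_all add: c_def h_def diff_divide_distrib add_divide_distrib)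
        ultimately have "c k + h \<le> y" "y \<le> c k + 2 * h"
          by (auto simp: dyadic_interval_def)
        then show ?thesis using True by (simp add: tent_eq_1 h)
      qed simp
    qed
    finally have ip: "\<theta> \<le> ip (tent h (c k)) (tent h (c k))" using k by (auto simp: R_def M_def)
    then show "ip (tent h (c k)) (tent h (c k)) > 0" using \<theta> by linarith
    have "(LINT y|lborel. (tent_deriv h (c k) y)\<^sup>2) = 2 * 2 ^ n"
      using integral_tent_deriv_squared[OF h] by (simp add: h_def)
    also have "\<dots> \<le> x * \<theta>" by (rule \<theta>)
    also have "\<dots> \<le> x * ip (tent h (c k)) (tent h (c k))" using x ip by (intro mult_left_mono) auto
    finally show "(LINT y|lborel. (tent_deriv h (c k) y)\<^sup>2) \<le> x * ip (tent h (c k)) (tent h (c k))" .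
  qed
  have "M \<subseteq> (\<Union>r<3. R r) \<union> {0, 2 ^ n - 1}"
    by (auto simp: R_def M_def)
  then have "card M \<le> card ((\<Union>r<3. R r) \<union> {0, 2 ^ n - 1})"
    by (rule card_mono[rotated]) (use finM in \<open>auto simp: R_def\<close>)
  also have "\<dots> \<le> card (\<Union>r<3. R r) + card {0, 2 ^ n - 1 :: nat}" by (rule card_Un_le)
  also have "card (\<Union>r<3. R r) \<le> (\<Sum>r<3. card (R r))" by (rule card_UN_le) simp
  also have "\<dots> \<le> (\<Sum>r<3::nat. eigenvalue_count \<nu> x)" by (intro sum_mono R_le)
  also have "card {0, 2 ^ n - 1 :: nat} \<le> 2" by (simp add: card_insert_if)
  finally show ?thesis by (simp add: M_def)
qed

subsection \<open>The spectrum as a convex function\<close>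

text \<open>Distinct indices give distinct cells, so a sum over the set of cells loses no
  term.\<close>

lemma sum_dyadic_cells: "(\<Sum>C\<in>dyadic_cells \<nu> n. measure \<nu> C powr q) = partition_sum n q"
proof -
  let ?S = "{k. k < 2 ^ n \<and> cell_mass n k > 0}"
  have "inj (dyadic_interval n)"
  proof (rule injI)
    fix j k assume e: "dyadic_interval n j = dyadic_interval n k"
    have "real j / 2 ^ n < (real j + 1) / 2 ^ n" "real k / 2 ^ n < (real k + 1) / 2 ^ n"
      by (simp_all add: divide_strict_right_mono)
    then have "real j / 2 ^ n = real k / 2 ^ n"
      using e unfolding dyadic_interval_def by (subst (asm) Ioc_inj) auto
    then show "j = k" by simp
  qed
  moreover have "dyadic_cells \<nu> n = dyadic_interval n ` ?S"
    by (auto simp: dyadic_cells_def cell_mass_def)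
  ultimately have "(\<Sum>C\<in>dyadic_cells \<nu> n. measure \<nu> C powr q) = (\<Sum>k\<in>?S. cell_mass n k powr q)"
    by (simp add: sum.reindex inj_on_subset[OF _ subset_UNIV] cell_mass_def)
  also have "\<dots> = partition_sum n q"
    unfolding partition_sum_def using cell_mass_nonneg[of n]
    by (intro sum.mono_neutral_left) (auto simp: less_le)
  finally show ?thesis .
qed

text \<open>At n = 0 both sides are 0 through division by zero.\<close>

lemma Lq_spectrum_level_eq: "Lq_spectrum_level \<nu> n q = ln (partition_sum n q) / (real n * ln 2)"
  by (simp add: Lq_spectrum_level_def sum_dyadic_cells ln_realpow)

lemma partition_sum_0_le: "partition_sum n 0 \<le> 2 ^ n"
proof -
  have "partition_sum n 0 \<le> (\<Sum>k<(2::nat) ^ n. 1 :: real)"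
    unfolding partition_sum_def by (intro sum_mono) simp
  then show ?thesis by simp
qed

lemma partition_sum_1: "partition_sum n 1 = mass"
  using sum_cell_mass[of n] by (simp add: partition_sum_def cell_mass_nonneg)

lemma partition_sum_pos:
  assumes "mass > 0" shows "partition_sum n q > 0"
proof -
  have "\<exists>k<2 ^ n. cell_mass n k > 0"
  proof (rule ccontr)
    assume "\<not> ?thesis"
    then have "(\<Sum>k<2 ^ n. cell_mass n k) \<le> 0" by (intro sum_nonpos) (metis lessThan_iff not_le)
    then show False using assms sum_cell_mass[of n] by simp
  qed
  then obtain k where "k < 2 ^ n" "cell_mass n k > 0" by blast
  then show ?thesis unfolding partition_sum_def
    by (intro sum_pos2[of _ k]) auto
qed

text \<open>Log-convexity in the exponent: Hoelder's inequality on the cells of positive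
  mass.\<close>

lemma partition_sum_interpolate:
  assumes t: "0 \<le> t" "t \<le> 1"
  shows "partition_sum n ((1 - t) * p + t * r) \<le> partition_sum n p powr (1 - t) * partition_sum n r powr t"
proof -
  let ?S = "{k. k < 2 ^ n \<and> cell_mass n k > 0}"
  have ps: "partition_sum n q = (\<Sum>k\<in>?S. cell_mass n k powr q)" for q
    unfolding partition_sum_def using cell_mass_nonneg[of n]
    by (intro sum.mono_neutral_right) (auto simp: less_le)
  have "(\<Sum>k\<in>?S. cell_mass n k powr ((1 - t) * p + t * r))
      = (\<Sum>k\<in>?S. (cell_mass n k powr p) powr (1 - t) * (cell_mass n k powr r) powr t)"
    by (intro sum.cong) (auto simp: powr_powr powr_add mult.commute)
  also have "\<dots> \<le> (\<Sum>k\<in>?S. cell_mass n k powr p) powr (1 - t) * (\<Sum>k\<in>?S. cell_mass n k powr r) powr t"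
    using t by (intro sum_mult_powr_le) auto
  finally show ?thesis by (simp only: ps)
qed

lemma level_interpolate:
  assumes t: "0 \<le> t" "t \<le> 1" and mass: "mass > 0"
  shows "Lq_spectrum_level \<nu> n ((1 - t) * p + t * r)
    \<le> (1 - t) * Lq_spectrum_level \<nu> n p + t * Lq_spectrum_level \<nu> n r"
proof -
  note pos = partition_sum_pos[OF mass, of n]
  have "ln (partition_sum n ((1 - t) * p + t * r))
      \<le> ln (partition_sum n p powr (1 - t) * partition_sum n r powr t)"
    using pos by (intro ln_mono partition_sum_interpolate t)
  also have "\<dots> = (1 - t) * ln (partition_sum n p) + t * ln (partition_sum n r)"
    using pos[of p] pos[of r] by (simp add: ln_mult ln_powr)
  finally have "ln (partition_sum n ((1 - t) * p + t * r)) / (real n * ln 2)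
      \<le> ((1 - t) * ln (partition_sum n p) + t * ln (partition_sum n r)) / (real n * ln 2)"
    by (intro divide_right_mono) auto
  then show ?thesis by (simp add: Lq_spectrum_level_eq add_divide_distrib)
qed

lemma level_0_le:
  assumes mass: "mass > 0" shows "Lq_spectrum_level \<nu> n 0 \<le> 1"
proof -
  have "ln (partition_sum n 0) \<le> ln (2 ^ n)"
    using partition_sum_pos[OF mass] by (intro ln_mono partition_sum_0_le)
  then have "ln (partition_sum n 0) \<le> real n * ln 2" by (simp add: ln_realpow)
  then show ?thesis unfolding Lq_spectrum_level_eq by (cases "n = 0") (auto simp: pos_divide_le_eq)
qed

lemma level_1_tendsto: "(\<lambda>n. Lq_spectrum_level \<nu> n 1) \<longlonglongrightarrow> 0"
  unfolding Lq_spectrum_level_eq partition_sum_1 by real_asymp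

lemma level_le:
  assumes "mass > 0" "0 \<le> q" "q \<le> 1"
  shows "Lq_spectrum_level \<nu> n q \<le> (1 - q) + q * Lq_spectrum_level \<nu> n 1"
proof -
  have "Lq_spectrum_level \<nu> n q \<le> (1 - q) * Lq_spectrum_level \<nu> n 0 + q * Lq_spectrum_level \<nu> n 1"
    using level_interpolate[OF assms(2,3,1), of n 0 1] by simp
  moreover have "(1 - q) * Lq_spectrum_level \<nu> n 0 \<le> (1 - q) * 1"
    using assms by (intro mult_left_mono level_0_le) auto
  ultimately show ?thesis by simp
qed

text \<open>The defect 1 - q - \<open>Lq_spectrum_level \<nu> n q\<close> is concave in q,
  nonnegative at 0 and close to 0 at 1. If such a function is small at an interior point p, it is
  small at q, up to a factor independent of n. The term at 1 corrects for a total mass other than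
  1.\<close>

lemma level_defect_le:
  assumes mass: "mass > 0" and p: "0 < p" "p < 1" and q: "0 \<le> q" "q \<le> 1"
  shows "\<exists>K>0. \<forall>n. 1 - q - Lq_spectrum_level \<nu> n q
    \<le> K * ((1 - p - Lq_spectrum_level \<nu> n p) + \<bar>Lq_spectrum_level \<nu> n 1\<bar>)"
proof (cases "q \<le> p")
  case True
  \<comment> \<open>p lies between q and 1, with weight t at 1.\<close>
  define t where "t = (p - q) / (1 - q)"
  have t: "0 \<le> t" "t < 1" using True p by (auto simp: t_def)
  have tq: "t * (1 - q) = p - q" using p True by (simp add: t_def)
  have pe: "p = (1 - t) * q + t * 1" using tq by (simp add: algebra_simps)
  have pe': "1 - p = (1 - t) * (1 - q)" using tq by (simp add: algebra_simps)
  have "1 - q - Lq_spectrum_level \<nu> n q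
      \<le> 1 / (1 - t) * ((1 - p - Lq_spectrum_level \<nu> n p) + \<bar>Lq_spectrum_level \<nu> n 1\<bar>)" for n
  proof -
    have "Lq_spectrum_level \<nu> n p \<le> (1 - t) * Lq_spectrum_level \<nu> n q + t * Lq_spectrum_level \<nu> n 1"
      using level_interpolate[OF t(1) less_imp_le[OF t(2)] mass, of n q 1] unfolding pe[symmetric] .
    also have "t * Lq_spectrum_level \<nu> n 1 \<le> 1 * \<bar>Lq_spectrum_level \<nu> n 1\<bar>"
    proof -
      have "t * Lq_spectrum_level \<nu> n 1 \<le> t * \<bar>Lq_spectrum_level \<nu> n 1\<bar>"
        using t by (intro mult_left_mono) auto
      also have "\<dots> \<le> 1 * \<bar>Lq_spectrum_level \<nu> n 1\<bar>" using t by (intro mult_right_mono) auto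
      finally show ?thesis .
    qed
    finally have "(1 - t) * (1 - q - Lq_spectrum_level \<nu> n q)
        \<le> (1 - p - Lq_spectrum_level \<nu> n p) + \<bar>Lq_spectrum_level \<nu> n 1\<bar>"
      unfolding pe' by (simp add: right_diff_distrib)
    then show ?thesis using t by (simp add: pos_le_divide_eq mult.commute)
  qed
  then show ?thesis using t by (intro exI[of _ "1 / (1 - t)"]) auto
next
  case False
  \<comment> \<open>p lies between 0 and q, with weight t at q.\<close>
  define t where "t = p / q"
  have t: "0 < t" "t \<le> 1" "t * q = p" using False p by (auto simp: t_def)
  have "1 - q - Lq_spectrum_level \<nu> n q
      \<le> 1 / t * ((1 - p - Lq_spectrum_level \<nu> n p) + \<bar>Lq_spectrum_level \<nu> n 1\<bar>)" for n
  proof -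
    have "Lq_spectrum_level \<nu> n p \<le> (1 - t) * Lq_spectrum_level \<nu> n 0 + t * Lq_spectrum_level \<nu> n q"
      using level_interpolate[of t n 0 q] t mass by simp
    also have "(1 - t) * Lq_spectrum_level \<nu> n 0 \<le> (1 - t) * 1"
      using t by (intro mult_left_mono level_0_le mass) auto
    finally have "t * (1 - q - Lq_spectrum_level \<nu> n q)
        \<le> (1 - p - Lq_spectrum_level \<nu> n p) + \<bar>Lq_spectrum_level \<nu> n 1\<bar>"
      using t(3) by (simp add: right_diff_distrib)
    then show ?thesis using t by (simp add: pos_le_divide_eq mult.commute)
  qed
  then show ?thesis using t by (intro exI[of _ "1 / t"]) auto
qed

text \<open>The upper bound is the chord between 0 and 1. If the lower bound failed at q, the defect
  at q would stay away from 0 at all large levels, and by \<open>level_defect_le\<close> so would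
  the defect at p, contradicting even a bound on the limsup at p.\<close>

lemma Lq_spectrum_linear:
  assumes mass: "mass > 0" and p: "0 < p" "p < 1" "ereal (1 - p) \<le> Lq_spectrum \<nu> p" and q: "0 \<le> q" "q \<le> 1"
  shows "Lq_spectrum \<nu> q = ereal (1 - q)"
proof (rule antisym)
  have "Lq_spectrum \<nu> q \<le> limsup (\<lambda>n. ereal ((1 - q) + q * Lq_spectrum_level \<nu> n 1))"
    unfolding Lq_spectrum_def using level_le[OF mass q] by (intro Limsup_mono always_eventually) simp
  also have "(\<lambda>n. (1 - q) + q * Lq_spectrum_level \<nu> n 1) \<longlonglongrightarrow> (1 - q) + q * 0"
    by (intro tendsto_intros level_1_tendsto)
  then have "limsup (\<lambda>n. ereal ((1 - q) + q * Lq_spectrum_level \<nu> n 1)) = ereal (1 - q)"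
    by (intro lim_imp_Limsup) auto
  finally show "Lq_spectrum \<nu> q \<le> ereal (1 - q)" .
  show "ereal (1 - q) \<le> Lq_spectrum \<nu> q"
  proof (rule ccontr)
    assume "\<not> ?thesis"
    then have "Lq_spectrum \<nu> q < ereal (1 - q)" by simp
    then obtain r where r: "Lq_spectrum \<nu> q < ereal r" "r < 1 - q" using ereal_dense2 by force
    obtain K where K: "K > 0" "\<And>n. 1 - q - Lq_spectrum_level \<nu> n q
      \<le> K * ((1 - p - Lq_spectrum_level \<nu> n p) + \<bar>Lq_spectrum_level \<nu> n 1\<bar>)"
      using level_defect_le[OF mass p(1,2) q] by blast
    define d where "d = (1 - q - r) / K"
    have d: "d > 0" using r K by (simp add: d_def)
    have "\<forall>\<^sub>F n in sequentially. ereal (Lq_spectrum_level \<nu> n q) < ereal r"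
      using r(1) unfolding Lq_spectrum_def by (rule Limsup_lessD)
    then have "\<forall>\<^sub>F n in sequentially. ereal (Lq_spectrum_level \<nu> n p) \<le> ereal (1 - p - d + \<bar>Lq_spectrum_level \<nu> n 1\<bar>)"
    proof eventually_elim
      case (elim n)
      then have "1 - q - r \<le> K * ((1 - p - Lq_spectrum_level \<nu> n p) + \<bar>Lq_spectrum_level \<nu> n 1\<bar>)"
        using K(2)[of n] by simp
      then have "d \<le> (1 - p - Lq_spectrum_level \<nu> n p) + \<bar>Lq_spectrum_level \<nu> n 1\<bar>"
        using K(1) by (simp add: d_def pos_divide_le_eq mult.commute)
      then show ?case by simp
    qed
    then have "Lq_spectrum \<nu> p \<le> limsup (\<lambda>n. ereal (1 - p - d + \<bar>Lq_spectrum_level \<nu> n 1\<bar>))"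
      unfolding Lq_spectrum_def by (rule Limsup_mono)
    also have "(\<lambda>n. 1 - p - d + \<bar>Lq_spectrum_level \<nu> n 1\<bar>) \<longlonglongrightarrow> 1 - p - d + \<bar>0\<bar>"
      by (intro tendsto_intros level_1_tendsto)
    then have "limsup (\<lambda>n. ereal (1 - p - d + \<bar>Lq_spectrum_level \<nu> n 1\<bar>)) = ereal (1 - p - d)"
      by (intro lim_imp_Limsup) auto
    finally have "ereal (1 - p) \<le> ereal (1 - p - d)" using p(3) by (rule order_trans[rotated])
    then show False using d by simp
  qed
qed

section \<open>Spectral dimensions from the behaviour of the spectrum\<close>

lemma partition_sum_le_of_level:
  assumes "n > 0" "mass > 0" "Lq_spectrum_level \<nu> n q \<le> s"
  shows "partition_sum n q \<le> (2 ^ n) powr s"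
proof -
  have "ln (partition_sum n q) \<le> s * (real n * ln 2)"
    using assms(1,3) by (simp add: Lq_spectrum_level_eq pos_divide_le_eq)
  also have "\<dots> = ln ((2 ^ n) powr s)" by (simp add: ln_powr ln_realpow)
  finally show ?thesis
    using partition_sum_pos[OF assms(2), of n q] by (subst (asm) ln_le_cancel_iff) auto
qed

lemma partition_sum_ge_of_level:
  assumes "n > 0" "mass > 0" "s \<le> Lq_spectrum_level \<nu> n q"
  shows "(2 ^ n) powr s \<le> partition_sum n q"
proof -
  have "ln ((2 ^ n) powr s) = s * (real n * ln 2)" by (simp add: ln_powr ln_realpow)
  also have "\<dots> \<le> ln (partition_sum n q)"
    using assms(1,3) by (simp add: Lq_spectrum_level_eq pos_le_divide_eq)
  finally show ?thesis
    using partition_sum_pos[OF assms(2), of n q] by (subst (asm) ln_le_cancel_iff) auto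
qed

text \<open>At q = 1/2 the chord value 1 - q equals q. Interpolating between the number of cells and
  the total mass amounts to Cauchy-Schwarz for the square roots of the cell masses.\<close>

lemma upper_spectral_dim_le_half:
  assumes mass: "mass > 0" shows "upper_spectral_dim \<nu> \<le> ereal (1 / 2)"
proof (rule upper_spectral_dim_le[OF _ _ mass])
  fix n
  have "partition_sum n (1 / 2) \<le> partition_sum n 0 powr (1 / 2) * mass powr (1 / 2)"
    using partition_sum_interpolate[of "1 / 2" n 0 1] by (simp add: partition_sum_1)
  also have "\<dots> \<le> (2 ^ n) powr (1 / 2) * mass powr (1 / 2)"
    using partition_sum_pos[OF mass, of n 0]
    by (intro mult_right_mono powr_mono2 partition_sum_0_le) auto
  finally show "partition_sum n (1 / 2) \<le> mass powr (1 / 2) * (2 ^ n) powr (1 / 2)" by (simp add: mult.commute)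
qed simp

text \<open>A drop at 1/2 lowers the chord that starts at (0, 1), which then crosses the diagonal to
  the left of 1/2; \<open>upper_spectral_dim_le\<close> applies at the crossing.\<close>

lemma upper_spectral_dim_less_half:
  assumes mass: "mass > 0" and less: "Lq_spectrum \<nu> (1 / 2) < ereal (1 / 2)"
  shows "upper_spectral_dim \<nu> < ereal (1 / 2)"
proof -
  obtain r where r: "Lq_spectrum \<nu> (1 / 2) < ereal r" "r < 1 / 2" using ereal_dense2[OF less] by force
  \<comment> \<open>The chord from (0, 1) to (1/2, r) meets the diagonal here.\<close>
  define q where "q = 1 / (3 - 2 * r)"
  have q: "0 < q" "q < 1 / 2" "1 - 2 * q + 2 * q * r = q" using r(2) by (auto simp: q_def field_simps)
  have "\<forall>\<^sub>F n in sequentially. ereal (Lq_spectrum_level \<nu> n (1 / 2)) < ereal r"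
    using r(1) unfolding Lq_spectrum_def by (rule Limsup_lessD)
  then obtain N where N: "\<And>n. n \<ge> N \<Longrightarrow> Lq_spectrum_level \<nu> n (1 / 2) < r"
    by (auto simp: eventually_sequentially)
  have large: "partition_sum n q \<le> (2 ^ n) powr q" if n: "n > N" for n
  proof (rule partition_sum_le_of_level[OF _ mass])
    have "Lq_spectrum_level \<nu> n q \<le> (1 - 2 * q) * Lq_spectrum_level \<nu> n 0 + 2 * q * Lq_spectrum_level \<nu> n (1 / 2)"
      using level_interpolate[of "2 * q" n 0 "1 / 2"] q mass by simp
    also have "\<dots> \<le> (1 - 2 * q) * 1 + 2 * q * r"
      using q N[of n] n by (intro add_mono mult_left_mono level_0_le mass) auto
    finally show "Lq_spectrum_level \<nu> n q \<le> q" using q(3) by simp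
  qed (use n in simp)
  \<comment> \<open>The sum absorbs the levels up to \<open>N\<close>, and the 1 serves all later
    ones.\<close>
  let ?C = "1 + (\<Sum>n\<le>N. partition_sum n q)"
  have "upper_spectral_dim \<nu> \<le> ereal q"
  proof (rule upper_spectral_dim_le[OF _ _ mass])
    fix n
    have nn: "0 \<le> (\<Sum>n\<le>N. partition_sum n q)"
      by (intro sum_nonneg less_imp_le partition_sum_pos mass)
    show "partition_sum n q \<le> ?C * (2 ^ n) powr q"
    proof (cases "n > N")
      case True
      have "partition_sum n q \<le> 1 * (2 ^ n) powr q" using large[OF True] by simp
      also have "\<dots> \<le> ?C * (2 ^ n) powr q" using nn by (intro mult_right_mono) auto
      finally show ?thesis .
    next
      case False
      have "partition_sum n q \<le> (\<Sum>n\<le>N. partition_sum n q)"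
        using False by (intro member_le_sum less_imp_le partition_sum_pos mass) auto
      also have "\<dots> \<le> ?C * 1" by simp
      also have "\<dots> \<le> ?C * (2 ^ n) powr q"
        using nn q by (intro mult_left_mono ge_one_powr_ge_zero) auto
      finally show ?thesis .
    qed
  qed (use q in simp)
  also have "\<dots> < ereal (1 / 2)" using q by simp
  finally show ?thesis .
qed

text \<open>Cells below the threshold contribute at most 2^(n (1 - p - \<epsilon> p)) to the
  partition sum, too little to explain its size. The others must carry the rest, and by Hoelder's
  inequality few cells of bounded total mass cannot. Convergence gives this at every large level,
  not just along a subsequence.\<close>

lemma many_large_cells:
  assumes mass: "mass > 0" and p: "0 < p" "p < 1" and lim: "(\<lambda>n. Lq_spectrum_level \<nu> n p) \<longlonglongrightarrow> 1 - p"
    and \<epsilon>: "0 < \<epsilon>"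
  shows "\<exists>c>0. \<forall>\<^sub>F n in sequentially. c * 2 powr (real n * (1 - \<epsilon>))
    \<le> real (card {k. k < 2 ^ n \<and> 2 powr (- real n * (1 + \<epsilon>)) \<le> cell_mass n k})"
proof -
  \<comment> \<open>Below \<open>\<epsilon> * p\<close>, so that the small cells are negligible, and
    at most \<open>\<epsilon> * (1 - p)\<close>, so that the final root of order 1 - p loses no more
    than \<epsilon> in the exponent.\<close>
  define \<delta> where "\<delta> = \<epsilon> * p * (1 - p) / 2"
  have \<delta>: "0 < \<delta>" "\<delta> < \<epsilon> * p" "\<delta> \<le> \<epsilon> * (1 - p)"
  proof -
    show "0 < \<delta>" using \<epsilon> p by (simp add: \<delta>_def)
    have "\<epsilon> * p * (1 - p) \<le> \<epsilon> * p * 1" using \<epsilon> p by (intro mult_left_mono) auto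
    moreover have "0 < \<epsilon> * p" using \<epsilon> p by simp
    ultimately show "\<delta> < \<epsilon> * p" unfolding \<delta>_def by linarith
    have "\<epsilon> * (1 - p) * p \<le> \<epsilon> * (1 - p) * 1" using \<epsilon> p by (intro mult_left_mono) auto
    moreover have "0 < \<epsilon> * (1 - p)" using \<epsilon> p by simp
    moreover have "\<delta> = \<epsilon> * (1 - p) * p / 2" by (simp add: \<delta>_def)
    ultimately show "\<delta> \<le> \<epsilon> * (1 - p)" by linarith
  qed
  \<comment> \<open>The 2 pays for the small cells, which make up at most half of the sum.\<close>
  define b where "b = 1 / (2 * mass powr p)"
  have b: "b > 0" using mass by (simp add: b_def)
  have ev1: "\<forall>\<^sub>F n in sequentially. 1 - p - \<delta> < Lq_spectrum_level \<nu> n p"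
    using order_tendstoD(1)[OF lim, of "1 - p - \<delta>"] \<delta> by simp
  have ev2: "\<forall>\<^sub>F n in sequentially. 2 * 2 powr (real n * (1 - p - \<epsilon> * p)) \<le> 2 powr (real n * (1 - p - \<delta>))"
  proof -
    have "\<forall>\<^sub>F n in sequentially. 1 \<le> real n * (\<epsilon> * p - \<delta>)" using \<delta>(2) by real_asymp
    then show ?thesis
    proof eventually_elim
      case (elim n)
      have "2 * 2 powr (real n * (1 - p - \<epsilon> * p)) = 2 powr (1 + real n * (1 - p - \<epsilon> * p))" by (simp add: powr_add)
      also have "\<dots> \<le> 2 powr (real n * (1 - p - \<delta>))"
        using elim by (intro powr_mono) (auto simp: algebra_simps)
      finally show ?case .
    qed
  qed
  have "\<forall>\<^sub>F n in sequentially. b powr (1 / (1 - p)) * 2 powr (real n * (1 - \<epsilon>))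
    \<le> real (card {k. k < 2 ^ n \<and> 2 powr (- real n * (1 + \<epsilon>)) \<le> cell_mass n k})"
    using ev1 ev2 eventually_gt_at_top[of 0]
  proof eventually_elim
    case (elim n)
    define \<theta> where "\<theta> = 2 powr (- real n * (1 + \<epsilon>))"
    define M where "M = {k. k < 2 ^ n \<and> \<theta> \<le> cell_mass n k}"
    define N where "N = real (card M)"
    have \<theta>: "\<theta> > 0" by (simp add: \<theta>_def)
    have M: "finite M" "M \<subseteq> {..<2 ^ n}"
      by (rule finite_subset[of _ "{..<2 ^ n}"]) (auto simp: M_def)
    have "2 powr (real n * (1 - p - \<delta>)) = (2 ^ n) powr (1 - p - \<delta>)" by (simp add: powr_powr flip: powr_realpow)
    also have "\<dots> \<le> partition_sum n p"
      using elim mass by (intro partition_sum_ge_of_level) auto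
    also have "\<dots> = (\<Sum>k\<in>M. cell_mass n k powr p) + (\<Sum>k\<in>{..<2 ^ n} - M. cell_mass n k powr p)"
      unfolding partition_sum_def using M by (subst sum.subset_diff[of M]) (auto simp: add.commute)
    also have "(\<Sum>k\<in>{..<2 ^ n} - M. cell_mass n k powr p) \<le> 2 powr (real n * (1 - p - \<epsilon> * p))"
    proof -
      have "(\<Sum>k\<in>{..<2 ^ n} - M. cell_mass n k powr p) \<le> (\<Sum>k\<in>{..<2 ^ n} - M. \<theta> powr p)"
        using p by (intro sum_mono powr_mono2) (auto simp: M_def cell_mass_nonneg)
      also have "\<dots> \<le> (\<Sum>k<(2::nat) ^ n. \<theta> powr p)" by (intro sum_mono2) auto
      also have "\<dots> = 2 powr real n * 2 powr (- real n * (1 + \<epsilon>) * p)"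
        by (simp add: \<theta>_def powr_powr powr_realpow)
      also have "\<dots> = 2 powr (real n * (1 - p - \<epsilon> * p))" by (simp add: algebra_simps flip: powr_add)
      finally show ?thesis .
    qed
    also have "(\<Sum>k\<in>M. cell_mass n k powr p) \<le> N powr (1 - p) * mass powr p"
    proof -
      \<comment> \<open>The factor 1 prepares Hoelder's inequality, in which it turns into the
        number of cells.\<close>
      have "(\<Sum>k\<in>M. cell_mass n k powr p) = (\<Sum>k\<in>M. 1 powr (1 - p) * cell_mass n k powr p)" by simp
      also have "\<dots> \<le> (\<Sum>k\<in>M. 1) powr (1 - p) * (\<Sum>k\<in>M. cell_mass n k) powr p"
        using p M \<theta> by (intro sum_mult_powr_le) (auto simp: M_def)
      also have "\<dots> \<le> N powr (1 - p) * mass powr p"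
      proof -
        have "(\<Sum>k\<in>M. cell_mass n k) \<le> mass"
          unfolding sum_cell_mass[of n, symmetric] using M by (intro sum_mono2) (auto simp: cell_mass_nonneg)
        then show ?thesis using p
          by (intro mult_mono powr_mono2) (auto simp: N_def intro!: sum_nonneg cell_mass_nonneg)
      qed
      finally show ?thesis .
    qed
    finally have "2 powr (real n * (1 - p - \<delta>)) \<le> 2 * (N powr (1 - p) * mass powr p)"
      using elim(2) by linarith
    then have "b * 2 powr (real n * (1 - p - \<delta>)) \<le> N powr (1 - p)"
      using mass by (simp add: b_def pos_divide_le_eq mult_ac)
    moreover have "2 powr (real n * (1 - \<epsilon>) * (1 - p)) \<le> 2 powr (real n * (1 - p - \<delta>))"
    proof (rule powr_mono)
      have "real n * \<delta> \<le> real n * (\<epsilon> * (1 - p))" by (intro mult_left_mono \<delta>) simp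
      then show "real n * (1 - \<epsilon>) * (1 - p) \<le> real n * (1 - p - \<delta>)" by (simp add: algebra_simps)
    qed simp
    ultimately have "b * 2 powr (real n * (1 - \<epsilon>) * (1 - p)) \<le> N powr (1 - p)"
      using b by (meson mult_left_mono less_imp_le order_trans)
    then have "(b * 2 powr (real n * (1 - \<epsilon>) * (1 - p))) powr (1 / (1 - p)) \<le> (N powr (1 - p)) powr (1 / (1 - p))"
      using b p by (intro powr_mono2) auto
    then have "b powr (1 / (1 - p)) * 2 powr (real n * (1 - \<epsilon>)) \<le> N"
      using b p by (simp add: powr_mult powr_powr N_def)
    then show ?case by (simp add: N_def M_def \<theta>_def)
  qed
  then show ?thesis using b by (intro exI[of _ "b powr (1 / (1 - p))"]) auto
qed

text \<open>Cells of mass 2^(-n (1 + \<epsilon>)) give eigenvalues up to x as soon as x \<ge> 2^(n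
  (2 + \<epsilon>) + 1). As all levels from some \<open>n0\<close> on have many such cells, every
  large x finds a suitable level, and the liminf is bounded.\<close>

lemma lower_spectral_dim_ge:
  assumes mass: "mass > 0" and p: "0 < p" "p < 1" and lim: "(\<lambda>n. Lq_spectrum_level \<nu> n p) \<longlonglongrightarrow> 1 - p"
    and \<epsilon>: "0 < \<epsilon>" "\<epsilon> < 1"
  shows "ereal ((1 - \<epsilon>) / (2 + \<epsilon>)) \<le> lower_spectral_dim \<nu>"
proof -
  obtain c n0 where c: "c > 0" and n0: "\<And>n. n \<ge> n0 \<Longrightarrow> c * 2 powr (real n * (1 - \<epsilon>))
    \<le> real (card {k. k < 2 ^ n \<and> 2 powr (- real n * (1 + \<epsilon>)) \<le> cell_mass n k})"
    using many_large_cells[OF mass p lim \<epsilon>(1)] unfolding eventually_sequentially by blast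
  \<comment> \<open>Solves 2^(m (2 + \<epsilon>) + 1) = x; the level used is its integer
    part.\<close>
  define m where "m = (\<lambda>x. (log 2 x - 1) / (2 + \<epsilon>))"
  \<comment> \<open>The 2 and the 3 come from \<open>eigenvalue_count_ge_cells\<close>, and
    \<open>m x - 1\<close> bounds the integer part from below.\<close>
  define G where "G = (\<lambda>x. (c * 2 powr ((m x - 1) * (1 - \<epsilon>)) - 2) / 3)"
  have "\<forall>\<^sub>F x in at_top. x > 1 \<and> m x \<ge> real n0 + 1 \<and> G x > 0"
  proof (intro eventually_conj)
    show "\<forall>\<^sub>F x in at_top. x > (1::real)" by (rule eventually_gt_at_top)
    show "\<forall>\<^sub>F x in at_top. m x \<ge> real n0 + 1" unfolding m_def using \<epsilon> by real_asymp
    show "\<forall>\<^sub>F x in at_top. G x > 0" unfolding G_def m_def using \<epsilon> c by real_asymp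
  qed
  then have "\<forall>\<^sub>F x in at_top. ereal (ln (G x) / ln x) \<le> ereal (ln (real (eigenvalue_count \<nu> x)) / ln x)"
  proof eventually_elim
    case (elim x)
    define n where "n = nat \<lfloor>m x\<rfloor>"
    have n: "real n \<le> m x" "m x - 1 \<le> real n" "n \<ge> n0" using elim unfolding n_def by linarith+
    let ?\<theta> = "2 powr (- real n * (1 + \<epsilon>))"
    have "real n * (2 + \<epsilon>) + 1 \<le> log 2 x"
      using n(1) \<epsilon> unfolding m_def by (simp add: pos_le_divide_eq)
    then have "2 powr (real n * (2 + \<epsilon>) + 1) \<le> x" using elim by (simp add: le_log_iff)
    then have "2 powr (real n * (2 + \<epsilon>) + 1) * ?\<theta> \<le> x * ?\<theta>" by (intro mult_right_mono) auto
    moreover have "2 powr (real n * (2 + \<epsilon>) + 1) * ?\<theta> = 2 powr (real n + 1)"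
      by (simp add: algebra_simps flip: powr_add)
    moreover have "2 * 2 ^ n = 2 powr (real n + 1)" by (simp add: powr_add powr_realpow)
    ultimately have "2 * 2 ^ n \<le> x * ?\<theta>" by linarith
    then have "card {k. k < 2 ^ n \<and> ?\<theta> \<le> cell_mass n k} \<le> 3 * eigenvalue_count \<nu> x + 2"
      by (intro eigenvalue_count_ge_cells) auto
    then have "real (card {k. k < 2 ^ n \<and> ?\<theta> \<le> cell_mass n k}) \<le> real (3 * eigenvalue_count \<nu> x + 2)"
      by (rule of_nat_mono)
    moreover have "c * 2 powr ((m x - 1) * (1 - \<epsilon>)) \<le> c * 2 powr (real n * (1 - \<epsilon>))"
      using c n(2) \<epsilon> by (intro mult_left_mono powr_mono mult_right_mono) auto
    ultimately have "G x \<le> real (eigenvalue_count \<nu> x)" using n0[OF n(3)] by (simp add: G_def)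
    then have "ln (G x) \<le> ln (real (eigenvalue_count \<nu> x))" using elim by (intro ln_mono) auto
    then show ?case using elim by (simp add: divide_right_mono)
  qed
  then have "Liminf at_top (\<lambda>x. ereal (ln (G x) / ln x)) \<le> lower_spectral_dim \<nu>"
    unfolding lower_spectral_dim_def by (rule Liminf_mono)
  moreover have "((\<lambda>x. ln (G x) / ln x) \<longlongrightarrow> (1 - \<epsilon>) / (2 + \<epsilon>)) at_top"
    unfolding G_def m_def using c \<epsilon> by real_asymp (simp add: divide_inverse flip: mult.assoc)
  then have "Liminf at_top (\<lambda>x. ereal (ln (G x) / ln x)) = ereal ((1 - \<epsilon>) / (2 + \<epsilon>))"
    by (intro lim_imp_Liminf) auto
  ultimately show ?thesis by simp
qed

lemma lower_spectral_dim_ge_half: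
  assumes mass: "mass > 0" and p: "0 < p" "p < 1" and lim: "(\<lambda>n. Lq_spectrum_level \<nu> n p) \<longlonglongrightarrow> 1 - p"
  shows "ereal (1 / 2) \<le> lower_spectral_dim \<nu>"
proof (rule ccontr)
  assume "\<not> ?thesis"
  then have "lower_spectral_dim \<nu> < ereal (1 / 2)" by simp
  then obtain r where r: "lower_spectral_dim \<nu> < ereal r" "r < 1 / 2" using ereal_dense2 by force
  \<comment> \<open>For \<epsilon> in (0,1) the bound (1 - \<epsilon>) / (2 + \<epsilon>) is at
    least 1/2 - \<epsilon>, so \<epsilon> \<le> 1/2 - r leads to the contradiction.\<close>
  define \<epsilon> where "\<epsilon> = min (1 / 2) (1 / 2 - r)"
  have \<epsilon>: "0 < \<epsilon>" "\<epsilon> < 1" "r \<le> 1 / 2 - \<epsilon>" using r by (auto simp: \<epsilon>_def)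
  have "(1 / 2 - \<epsilon>) * (2 + \<epsilon>) \<le> 1 - \<epsilon>" using \<epsilon> by (simp add: algebra_simps)
  then have "1 / 2 - \<epsilon> \<le> (1 - \<epsilon>) / (2 + \<epsilon>)" using \<epsilon> by (simp add: pos_le_divide_eq)
  then have "ereal r \<le> ereal ((1 - \<epsilon>) / (2 + \<epsilon>))" using \<epsilon> by simp
  also have "\<dots> \<le> lower_spectral_dim \<nu>" by (rule lower_spectral_dim_ge[OF mass p lim \<epsilon>(1,2)])
  finally show False using r by simp
qed

end

theorem corollary1p4:
  fixes \<nu> :: "real measure"
  assumes "sets \<nu> = sets borel"
    and "finite_measure \<nu>"
    and "emeasure \<nu> (- {0<..<1}) = 0"
    and "emeasure \<nu> (space \<nu>) \<noteq> 0"
  shows "(upper_spectral_dim \<nu> = ereal (1 / 2) \<longrightarrow>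
            (\<forall>q\<in>{0..1}. Lq_spectrum \<nu> q = ereal (1 - q))) \<and>
         (\<forall>q0\<in>{0<..<1}.
            convergent (\<lambda>n. Lq_spectrum_level \<nu> n q0) \<and>
            Lq_spectrum \<nu> q0 = ereal (lim (\<lambda>n. Lq_spectrum_level \<nu> n q0)) \<and>
            lim (\<lambda>n. Lq_spectrum_level \<nu> n q0) = 1 - q0 \<longrightarrow>
            (\<forall>q\<in>{0..1}. Lq_spectrum \<nu> q = ereal (1 - q)) \<and>
            lower_spectral_dim \<nu> = ereal (1 / 2) \<and>
            upper_spectral_dim \<nu> = ereal (1 / 2))"
proof -
  interpret string_measure \<nu>
    using assms(1-3) by (auto simp: string_measure_def string_measure_axioms_def)
  have mass: "mass > 0"
    using assms(4) by (simp add: emeasure_eq_measure zero_less_measure_iff)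
  show ?thesis
  proof (intro conjI impI ballI)
    fix q :: real assume "upper_spectral_dim \<nu> = ereal (1 / 2)" and q: "q \<in> {0..1}"
    \<comment> \<open>Contrapositive of the strict bound; it is the hypothesis of
      \<open>Lq_spectrum_linear\<close> at p = 1/2.\<close>
    then have "\<not> Lq_spectrum \<nu> (1 / 2) < ereal (1 / 2)"
      using upper_spectral_dim_less_half[OF mass] by auto
    then show "Lq_spectrum \<nu> q = ereal (1 - q)"
      using q by (intro Lq_spectrum_linear[of "1 / 2"] mass) auto
  next
    fix p :: real assume p: "p \<in> {0<..<1}" and
      H: "convergent (\<lambda>n. Lq_spectrum_level \<nu> n p) \<and>
        Lq_spectrum \<nu> p = ereal (lim (\<lambda>n. Lq_spectrum_level \<nu> n p)) \<and>
        lim (\<lambda>n. Lq_spectrum_level \<nu> n p) = 1 - p"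
    then have lim: "(\<lambda>n. Lq_spectrum_level \<nu> n p) \<longlonglongrightarrow> 1 - p"
      unfolding convergent_LIMSEQ_iff by metis
    show "Lq_spectrum \<nu> q = ereal (1 - q)" if "q \<in> {0..1}" for q
      using p H that by (intro Lq_spectrum_linear[of p] mass) auto
    have low: "ereal (1 / 2) \<le> lower_spectral_dim \<nu>"
      using p by (intro lower_spectral_dim_ge_half[OF mass _ _ lim]) auto
    \<comment> \<open>Links the two halves of the sandwich: 1/2 bounds the liminf from below and the
      limsup from above.\<close>
    have le: "lower_spectral_dim \<nu> \<le> upper_spectral_dim \<nu>"
      unfolding lower_spectral_dim_def upper_spectral_dim_def by (rule Liminf_le_Limsup) simp
    note up = upper_spectral_dim_le_half[OF mass]
    show "lower_spectral_dim \<nu> = ereal (1 / 2)" "upper_spectral_dim \<nu> = ereal (1 / 2)"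
      using low le up by (auto intro: antisym order_trans)
  qed
qed

end
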